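(* Let $A$ be a nonzero unital $\mathbb F_2$-algebra and write $\Gamma_r=\mathrm{GL}_r(A)$. Suppose that $A^2\cong A$ as right $A$-modules. Assume also that: (1) for every $n>0$, the standard inclusion $\Gamma_{n+2}\to\Gamma_{n+3}$, $g\mapsto \mathrm{diag}(g,1)$, induces the zero map on $H_n(-,\mathbb Z)$; (2) $\widetilde H_i(X_r(A),\mathbb Z)=0$ for all $r\geq 4$ and $0\leq i\leq r-3$. Then $H_n(A^\times,\mathbb Z)=0$ for every $n>0$.
   Context: Algebras are associative and not necessarily commutative. Modules are right modules, and matrices act on columns from the left. $H_n(-,\mathbb Z)$ of a group is group homology with trivial integral coefficients. The ordered frame semisimplicial set $X_r(A)$: its $p$-simplices are the tuples $(v_1,\ldots,v_k)$ of vectors in $A^r$, where $k=p+1\le r$, admitting a decomposition $A^r=v_1A\oplus\cdots\oplus v_kA\oplus C$ with $C\cong A^{r-k}$ as right modules, where each map $A\to v_iA$, $a\mapsto v_ia$, is required to be an isomorphism. The complement $C$ and its basis are not part of the data. The faces delete vectors, and there are no simplices in dimensions $p\ge r$. $\widetilde H_*$ denotes its reduced homology. *)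

theory Defs
  imports
    "HOL-Algebra.Free_Abelian_Groups"
    "HOL-Library.Z2"
    "Jordan_Normal_Form.Matrix"
begin

section \<open>Homology of semisimplicial sets\<close>

text \<open>
  A semisimplicial set is given by its sets \<open>S p\<close> of \<open>p\<close>-simplices and its face maps \<open>d i\<close>.
  The simplices below are lists, so that one function \<open>d i\<close> can serve all
  dimensions \<open>p \<ge> i\<close>. As in HOL-Homology, integral chains are finitely supported integer-valued
  functions.
\<close>

definition ss_boundary :: "(nat \<Rightarrow> 's \<Rightarrow> 's) \<Rightarrow> nat \<Rightarrow> ('s \<Rightarrow>\<^sub>0 int) \<Rightarrow> ('s \<Rightarrow>\<^sub>0 int)"
  where "ss_boundary d p c =
    (if p = 0 then 0
     else frag_extend (\<lambda>x. \<Sum>i\<le>p. frag_cmul ((-1) ^ i) (frag_of (d i x))) c)"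

definition ss_cycles :: "(nat \<Rightarrow> 's set) \<Rightarrow> (nat \<Rightarrow> 's \<Rightarrow> 's) \<Rightarrow> nat \<Rightarrow> ('s \<Rightarrow>\<^sub>0 int) set"
  where "ss_cycles S d p = {c \<in> carrier (free_Abelian_group (S p)). ss_boundary d p c = 0}"

definition ss_boundaries :: "(nat \<Rightarrow> 's set) \<Rightarrow> (nat \<Rightarrow> 's \<Rightarrow> 's) \<Rightarrow> nat \<Rightarrow> ('s \<Rightarrow>\<^sub>0 int) set"
  where "ss_boundaries S d p = ss_boundary d (Suc p) ` carrier (free_Abelian_group (S (Suc p)))"

definition ss_cycle_group :: "(nat \<Rightarrow> 's set) \<Rightarrow> (nat \<Rightarrow> 's \<Rightarrow> 's) \<Rightarrow> nat \<Rightarrow> ('s \<Rightarrow>\<^sub>0 int) monoid"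
  where "ss_cycle_group S d p =
    subgroup_generated (free_Abelian_group (S p)) (ss_cycles S d p)"

definition ss_homology ::
  "nat \<Rightarrow> (nat \<Rightarrow> 's set) \<Rightarrow> (nat \<Rightarrow> 's \<Rightarrow> 's) \<Rightarrow> ('s \<Rightarrow>\<^sub>0 int) set monoid"
  where "ss_homology p S d = ss_cycle_group S d p Mod ss_boundaries S d p"

text \<open>
  Reduced homology in degrees \<open>p \<ge> 0\<close>, from the chain complex augmented by the sum of coefficients
  in degree \<open>0\<close>. (The group in degree \<open>-1\<close>, which is zero exactly for nonempty semisimplicial
  sets, is not represented.)
\<close>

definition augmentation :: "('s \<Rightarrow>\<^sub>0 int) \<Rightarrow> int"
  where "augmentation c = (\<Sum>x\<in>Poly_Mapping.keys c. Poly_Mapping.lookup c x)"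

definition ss_reduced_cycles :: "(nat \<Rightarrow> 's set) \<Rightarrow> (nat \<Rightarrow> 's \<Rightarrow> 's) \<Rightarrow> nat \<Rightarrow> ('s \<Rightarrow>\<^sub>0 int) set"
  where "ss_reduced_cycles S d p = {c \<in> ss_cycles S d p. p = 0 \<longrightarrow> augmentation c = 0}"

definition ss_reduced_homology ::
  "nat \<Rightarrow> (nat \<Rightarrow> 's set) \<Rightarrow> (nat \<Rightarrow> 's \<Rightarrow> 's) \<Rightarrow> ('s \<Rightarrow>\<^sub>0 int) set monoid"
  where "ss_reduced_homology p S d =
    subgroup_generated (free_Abelian_group (S p)) (ss_reduced_cycles S d p) Mod ss_boundaries S d p"

text \<open>
  The map on homology induced by a map \<open>\<phi>\<close> of simplices into the semisimplicial set \<open>(T, e)\<close>.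
  A homology class \<open>C\<close> is a coset of cycles; when \<open>\<phi>\<close> commutes with the faces, the cosets in the
  union over all representatives \<open>c\<close> coincide.
\<close>

definition ss_homology_map ::
  "nat \<Rightarrow> (nat \<Rightarrow> 't set) \<Rightarrow> (nat \<Rightarrow> 't \<Rightarrow> 't) \<Rightarrow> ('s \<Rightarrow> 't) \<Rightarrow> ('s \<Rightarrow>\<^sub>0 int) set \<Rightarrow> ('t \<Rightarrow>\<^sub>0 int) set"
  where "ss_homology_map p T e \<phi> C =
    (\<Union>c\<in>C. ss_boundaries T e p #>\<^bsub>ss_cycle_group T e p\<^esub> frag_extend (\<lambda>x. frag_of (\<phi> x)) c)"


section \<open>Group homology with trivial integral coefficients\<close>

text \<open>
  The (unnormalised, inhomogeneous) bar complex: the \<open>n\<close>-simplex \<open>[g\<^sub>1, \<dots>, g\<^sub>n]\<close> has faces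
  \<open>[g\<^sub>2, \<dots>, g\<^sub>n]\<close>, \<open>[g\<^sub>1, \<dots>, g\<^sub>i g\<^sub>i\<^sub>+\<^sub>1, \<dots>, g\<^sub>n]\<close> for \<open>0 < i < n\<close>, and \<open>[g\<^sub>1, \<dots>, g\<^sub>n\<^sub>-\<^sub>1]\<close>.
\<close>

definition bar_simplices :: "('g, 'b) monoid_scheme \<Rightarrow> nat \<Rightarrow> 'g list set"
  where "bar_simplices G n = {gs. length gs = n \<and> set gs \<subseteq> carrier G}"

definition bar_face :: "('g, 'b) monoid_scheme \<Rightarrow> nat \<Rightarrow> 'g list \<Rightarrow> 'g list"
  where "bar_face G i gs =
    (if i = 0 then tl gs
     else if i = length gs then butlast gs
     else take (i - 1) gs @ (gs ! (i - 1) \<otimes>\<^bsub>G\<^esub> gs ! i) # drop (i + 1) gs)"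

definition group_homology :: "nat \<Rightarrow> ('g, 'b) monoid_scheme \<Rightarrow> ('g list \<Rightarrow>\<^sub>0 int) set monoid"
  where "group_homology n G = ss_homology n (bar_simplices G) (bar_face G)"

definition group_homology_map ::
  "nat \<Rightarrow> ('h, 'b) monoid_scheme \<Rightarrow> ('g \<Rightarrow> 'h) \<Rightarrow> ('g list \<Rightarrow>\<^sub>0 int) set \<Rightarrow> ('h list \<Rightarrow>\<^sub>0 int) set"
  where "group_homology_map n H f = ss_homology_map n (bar_simplices H) (bar_face H) (map f)"


section \<open>Algebras, units and general linear groups\<close>

definition unital_algebra :: "('k::field \<Rightarrow> 'a::ring_1 \<Rightarrow> 'a) \<Rightarrow> bool"
  where "unital_algebra scale \<longleftrightarrow> vector_space scale \<and>
    (\<forall>c x y. scale c (x * y) = scale c x * y \<and> scale c (x * y) = x * scale c y)"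

definition ring_units :: "'a::ring_1 monoid"
  where "ring_units = units_of \<lparr>carrier = UNIV, monoid.mult = (*), one = 1\<rparr>"

definition GL :: "nat \<Rightarrow> 'a::ring_1 mat monoid"
  where "GL r = units_of (ring_mat TYPE('a) r ())"

definition GL_incl :: "'a::ring_1 mat \<Rightarrow> 'a mat"
  where "GL_incl g = diag_block_mat [g, 1\<^sub>m 1]"


section \<open>Right modules of column vectors\<close>

text \<open>The library's \<open>a \<cdot>\<^sub>v v\<close> multiplies by scalars on the left.\<close>

definition rsmult_vec :: "'a::times vec \<Rightarrow> 'a \<Rightarrow> 'a vec"  (infixl \<open>\<cdot>\<^sub>r\<close> 70)
  where "v \<cdot>\<^sub>r a = vec (dim_vec v) (\<lambda>i. v $ i * a)"

text \<open>Isomorphisms between right modules given by a carrier and a right action of \<open>'a\<close>.\<close>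

definition rmodule_iso ::
  "'m::plus set \<Rightarrow> ('m \<Rightarrow> 'a \<Rightarrow> 'm) \<Rightarrow> 'n::plus set \<Rightarrow> ('n \<Rightarrow> 'a \<Rightarrow> 'n) \<Rightarrow> ('m \<Rightarrow> 'n) \<Rightarrow> bool"
  where "rmodule_iso M actM N actN f \<longleftrightarrow> bij_betw f M N \<and>
    (\<forall>x\<in>M. \<forall>y\<in>M. f (x + y) = f x + f y) \<and> (\<forall>x\<in>M. \<forall>a. f (actM x a) = actN (f x) a)"

definition rsubmodule :: "nat \<Rightarrow> 'a::ring_1 vec set \<Rightarrow> bool"
  where "rsubmodule r N \<longleftrightarrow> N \<subseteq> carrier_vec r \<and> 0\<^sub>v r \<in> N \<and>
    (\<forall>x\<in>N. \<forall>y\<in>N. x + y \<in> N) \<and> (\<forall>x\<in>N. \<forall>a. x \<cdot>\<^sub>r a \<in> N)"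

definition internal_direct_sum :: "nat \<Rightarrow> 'a::ring_1 vec set list \<Rightarrow> bool"
  where "internal_direct_sum r Ns \<longleftrightarrow> (\<forall>N\<in>set Ns. rsubmodule r N) \<and>
    (\<forall>x\<in>carrier_vec r. \<exists>!ws. list_all2 (\<in>) ws Ns \<and> x = foldr (+) ws (0\<^sub>v r))"

definition cyclic_submodule :: "'a::ring_1 vec \<Rightarrow> 'a vec set"
  where "cyclic_submodule v = range (\<lambda>a. v \<cdot>\<^sub>r a)"


section \<open>The ordered frame semisimplicial set\<close>

definition is_frame :: "nat \<Rightarrow> 'a::ring_1 vec list \<Rightarrow> bool"
  where "is_frame r vs \<longleftrightarrow> set vs \<subseteq> carrier_vec r \<and>
    (\<forall>v\<in>set vs. rmodule_iso UNIV (*) (cyclic_submodule v) (\<cdot>\<^sub>r) (\<lambda>a. v \<cdot>\<^sub>r a)) \<and>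
    (\<exists>C. internal_direct_sum r (map cyclic_submodule vs @ [C]) \<and>
      (\<exists>f. rmodule_iso C (\<cdot>\<^sub>r) (carrier_vec (r - length vs)) (\<cdot>\<^sub>r) f))"

definition frame_simplices :: "nat \<Rightarrow> nat \<Rightarrow> 'a::ring_1 vec list set"
  where "frame_simplices r p = {vs. length vs = p + 1 \<and> p + 1 \<le> r \<and> is_frame r vs}"

definition frame_face :: "nat \<Rightarrow> 'a vec list \<Rightarrow> 'a vec list"
  where "frame_face i vs = take i vs @ drop (Suc i) vs"

definition frame_reduced_homology ::
  "'a::ring_1 itself \<Rightarrow> nat \<Rightarrow> nat \<Rightarrow> ('a vec list \<Rightarrow>\<^sub>0 int) set monoid"
  where "frame_reduced_homology _ i r = ss_reduced_homology i (frame_simplices r) frame_face"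

end

(* Since A and A^2 are isomorphic, so are all A^r with r > 0, and the frames of all the A^r can be
   viewed inside A. The hypothesis (2) then says that one infinite-dimensional semisimplicial set,
   whose p-simplices are the (p+1)-tuples of vectors in A spanning a free summand with free nonzero
   complement, is acyclic. Its stabilisers are affine groups; to get rid of them one passes to split
   frames, in which each vector comes with a dual functional. Split frames are again acyclic, by a
   double complex comparing them with frames. The unit group acts transitively on the split frames
   of each length, and each stabiliser is the automorphism group of the complement, hence isomorphic
   to the whole unit group. If the homology of the unit group vanishes in degrees between 0 and n,
   the spectral sequence of this action shows that the homology in degree n comes from the stabiliser
   of a split frame of length 1. This inclusion is a stabilisation map, which is zero by (1). *)

theory Submission
  imports Defs
begin

text \<open>Two double complexes occur, split frames against frames and split frames against bars,
  and both feed the chase \<open>zigzag\<close>. All complexes include the empty word, so column 0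
  is the complex under study, and the chase lifts a cycle of it to a cycle of column 1. In the first
  one the obstacle is that the column over vectors u is larger than the complex of split frames of a
  complement: vectors may be changed by elements of the span of u. The coordinates along u become
  labels, and a cycle is moved to label 0 by contracting links. Links are copies of the whole
  complex, so only exactness in lower degrees is used, whence an induction on the degree. In the top
  degree the column is not known to be exact, but its cycles can still be made orthogonal to chosen
  functionals, and a cone finishes the argument. In the second one the columns have the integers,
  not zero, as homology in degree 0, and the boundary of frames acts on them alternately as 0 and 1.
  This is why \<open>zigzag\<close> has a weaker hypothesis in its bottom row.\<close>

section \<open>Chains\<close>

definition chains_on :: "'a set \<Rightarrow> ('a \<Rightarrow>\<^sub>0 int) set"
  where "chains_on S = {c. Poly_Mapping.keys c \<subseteq> S}"

definition fmap :: "('a \<Rightarrow> 'b) \<Rightarrow> ('a \<Rightarrow>\<^sub>0 int) \<Rightarrow> ('b \<Rightarrow>\<^sub>0 int)"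
  where "fmap f = frag_extend (\<lambda>x. frag_of (f x))"

lemmas frag_linear = frag_extend_add frag_extend_diff frag_extend_minus frag_extend_cmul

lemma frag_extend_frag_extend:
  "frag_extend f (frag_extend g c) = frag_extend (\<lambda>x. frag_extend f (g x)) c"
  using subset_UNIV by (induction c rule: frag_induction) (simp_all add: frag_linear algebra_simps)

lemma frag_extend_fun_add: "frag_extend (\<lambda>x. f x + g x) c = frag_extend f c + frag_extend g c"
  using subset_UNIV by (induction c rule: frag_induction) (simp_all add: frag_linear algebra_simps)

lemma frag_extend_fun_diff: "frag_extend (\<lambda>x. f x - g x) c = frag_extend f c - frag_extend g c"
  using subset_UNIV by (induction c rule: frag_induction) (simp_all add: frag_linear algebra_simps)

lemma frag_extend_fun_minus: "frag_extend (\<lambda>x. - f x) c = - frag_extend f c"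
  using subset_UNIV by (induction c rule: frag_induction) (simp_all add: frag_linear algebra_simps)

lemma frag_extend_frag_of [simp]: "frag_extend frag_of c = c"
  by (simp flip: frag_expansion)

lemma frag_extend_fun_0 [simp]: "frag_extend (\<lambda>x. 0) c = 0"
  by (simp add: frag_extend_eq_0)

lemma fmap_frag_of [simp]: "fmap f (frag_of x) = frag_of (f x)"
  by (simp add: fmap_def)

lemma fmap_0 [simp]: "fmap f 0 = 0"
  by (simp add: fmap_def)

lemma fmap_add: "fmap f (c + d) = fmap f c + fmap f d"
  by (simp add: fmap_def frag_linear)

lemma fmap_diff: "fmap f (c - d) = fmap f c - fmap f d"
  by (simp add: fmap_def frag_linear)

lemma fmap_minus: "fmap f (- c) = - fmap f c"
  by (simp add: fmap_def frag_linear)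

lemma fmap_cmul: "fmap f (frag_cmul k c) = frag_cmul k (fmap f c)"
  by (simp add: fmap_def frag_linear)

lemmas fmap_linear = fmap_add fmap_diff fmap_minus fmap_cmul

lemma fmap_fmap: "fmap f (fmap g c) = fmap (\<lambda>x. f (g x)) c"
  by (simp add: fmap_def frag_extend_frag_extend)

lemma frag_extend_fmap: "frag_extend f (fmap g c) = frag_extend (\<lambda>x. f (g x)) c"
  by (simp add: fmap_def frag_extend_frag_extend)

lemma fmap_frag_extend: "fmap f (frag_extend g c) = frag_extend (\<lambda>x. fmap f (g x)) c"
  by (simp add: fmap_def frag_extend_frag_extend)

lemma fmap_cong:
  "(\<And>x. x \<in> Poly_Mapping.keys c \<Longrightarrow> f x = g x) \<Longrightarrow> fmap f c = fmap g c"
  unfolding fmap_def by (rule frag_extend_eq) simp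

lemma fmap_ident: "(\<And>x. x \<in> Poly_Mapping.keys c \<Longrightarrow> f x = x) \<Longrightarrow> fmap f c = c"
  using fmap_cong [of c f "\<lambda>x. x"] by (simp add: fmap_def)

lemma keys_fmap: "Poly_Mapping.keys (fmap f c) \<subseteq> f ` Poly_Mapping.keys c"
  unfolding fmap_def using keys_frag_extend [of "\<lambda>x. frag_of (f x)" c] by auto

lemma chains_0 [simp]: "0 \<in> chains_on S"
  by (simp add: chains_on_def)

lemma chains_frag_of [simp]: "frag_of x \<in> chains_on S \<longleftrightarrow> x \<in> S"
  by (simp add: chains_on_def)

lemma chains_add: "c \<in> chains_on S \<Longrightarrow> d \<in> chains_on S \<Longrightarrow> c + d \<in> chains_on S"
  using Poly_Mapping.keys_add [of c d] by (auto simp: chains_on_def)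

lemma chains_minus: "c \<in> chains_on S \<Longrightarrow> - c \<in> chains_on S"
  by (simp add: chains_on_def)

lemma chains_diff: "c \<in> chains_on S \<Longrightarrow> d \<in> chains_on S \<Longrightarrow> c - d \<in> chains_on S"
  using chains_add [of c S "- d"] by (simp add: chains_minus)

lemma chains_cmul: "c \<in> chains_on S \<Longrightarrow> frag_cmul k c \<in> chains_on S"
  using keys_cmul [of k c] by (auto simp: chains_on_def)

lemma chains_sum: "(\<And>i. i \<in> I \<Longrightarrow> f i \<in> chains_on S) \<Longrightarrow> sum f I \<in> chains_on S"
  by (induction I rule: infinite_finite_induct) (auto intro: chains_add)

lemma chains_mono: "c \<in> chains_on S \<Longrightarrow> S \<subseteq> T \<Longrightarrow> c \<in> chains_on T"
  by (auto simp: chains_on_def)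

lemma chains_frag_extend:
  "c \<in> chains_on S \<Longrightarrow> (\<And>x. x \<in> S \<Longrightarrow> f x \<in> chains_on T) \<Longrightarrow> frag_extend f c \<in> chains_on T"
  unfolding chains_on_def using keys_frag_extend [of f c] by blast

lemma chains_fmap: "c \<in> chains_on S \<Longrightarrow> (\<And>x. x \<in> S \<Longrightarrow> f x \<in> T) \<Longrightarrow> fmap f c \<in> chains_on T"
  unfolding fmap_def by (rule chains_frag_extend) auto

lemma keys_chains: "c \<in> chains_on S \<Longrightarrow> x \<in> Poly_Mapping.keys c \<Longrightarrow> x \<in> S"
  by (auto simp: chains_on_def)

lemma frag_extend_cong:
  "c \<in> chains_on S \<Longrightarrow> (\<And>x. x \<in> S \<Longrightarrow> f x = g x) \<Longrightarrow> frag_extend f c = frag_extend g c"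
  by (rule frag_extend_eq) (auto simp: chains_on_def)

lemma frag_extend_ident:
  "c \<in> chains_on S \<Longrightarrow> (\<And>x. x \<in> S \<Longrightarrow> f x = frag_of x) \<Longrightarrow> frag_extend f c = c"
  using frag_extend_cong [of c S f frag_of] by simp


section \<open>Augmented complexes of words, with deletions of letters as faces\<close>

section \<open>Words\<close>

text \<open>A word of length \<open>n\<close> has degree \<open>n\<close>, and a \<open>p\<close>-simplex is a word of length \<open>p + 1\<close>: the
  empty word makes the complexes augmented.\<close>

fun bdry :: "'a list \<Rightarrow> ('a list \<Rightarrow>\<^sub>0 int)"
  where "bdry [] = 0"
  | "bdry (x # xs) = frag_of xs - fmap ((#) x) (bdry xs)"

definition words :: "'a list set \<Rightarrow> nat \<Rightarrow> 'a list set"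
  where "words S n = {w \<in> S. length w = n}"

definition downclosed :: "'a list set \<Rightarrow> bool"
  where "downclosed S \<longleftrightarrow> (\<forall>xs x ys. xs @ x # ys \<in> S \<longrightarrow> xs @ ys \<in> S)"

definition exact_words :: "'a list set \<Rightarrow> nat \<Rightarrow> bool"
  where "exact_words S n \<longleftrightarrow> (\<forall>z \<in> chains_on (words S n).
    frag_extend bdry z = 0 \<longrightarrow> (\<exists>y \<in> chains_on (words S (Suc n)). frag_extend bdry y = z))"

lemma bdry_bdry: "frag_extend bdry (bdry w) = 0"
proof (induction w)
  case (Cons x w)
  have "frag_extend bdry (fmap ((#) x) c) = c - fmap ((#) x) (frag_extend bdry c)" for c
    by (simp add: frag_extend_fmap frag_extend_fun_diff fmap_frag_extend)
  with Cons show ?case by (simp add: frag_linear)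
qed simp

lemma bdry_bdry_chain: "frag_extend bdry (frag_extend bdry c) = 0"
  by (simp add: frag_extend_frag_extend bdry_bdry)

lemma bdry_map: "bdry (map f w) = fmap (map f) (bdry w)"
  by (induction w) (simp_all add: fmap_linear fmap_fmap)

lemma bdry_append:
  "bdry (xs @ ys) = fmap (\<lambda>w. w @ ys) (bdry xs) + frag_cmul ((-1) ^ length xs) (fmap (\<lambda>w. xs @ w) (bdry ys))"
proof (induction xs)
  case Nil
  then show ?case by (simp add: fmap_ident)
next
  case (Cons x xs)
  then show ?case by (simp add: fmap_linear fmap_fmap flip: minus_frag_cmul)
qed

lemma keys_bdry:
  "w \<in> Poly_Mapping.keys (bdry v) \<Longrightarrow> \<exists>xs x ys. v = xs @ x # ys \<and> w = xs @ ys"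
proof (induction v arbitrary: w)
  case (Cons x v)
  then have "w = v \<or> w \<in> Poly_Mapping.keys (fmap ((#) x) (bdry v))"
    using keys_diff [of "frag_of v" "fmap ((#) x) (bdry v)"] by auto
  then show ?case
  proof
    assume "w \<in> Poly_Mapping.keys (fmap ((#) x) (bdry v))"
    then obtain w' where "w' \<in> Poly_Mapping.keys (bdry v)" "w = x # w'"
      using keys_fmap [of "(#) x" "bdry v"] by auto
    moreover obtain xs y ys where "v = xs @ y # ys" "w' = xs @ ys"
      using Cons.IH calculation(1) by blast
    ultimately have "x # v = (x # xs) @ y # ys \<and> w = (x # xs) @ ys" by simp
    then show ?thesis by blast
  next
    assume "w = v"
    then have "x # v = [] @ x # v \<and> w = [] @ v" by simp
    then show ?thesis by blast
  qed
qed simp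

lemma bdry_chains:
  assumes "downclosed S" "w \<in> words S n"
  shows "bdry w \<in> chains_on (words S (n - 1))"
proof -
  have "v \<in> words S (n - 1)" if "v \<in> Poly_Mapping.keys (bdry w)" for v
    using keys_bdry [OF that] assms by (auto simp: downclosed_def words_def)
  then show ?thesis by (auto simp: chains_on_def)
qed

text \<open>Letterwise maps commute with \<open>bdry\<close>, and a retraction suffices: the cycle
  is moved to \<open>S\<close> by \<open>q\<close>, filled there, and the filling is moved back by
  \<open>p\<close>.\<close>

lemma exact_words_transfer:
  assumes S: "exact_words S n"
    and p: "\<And>w. w \<in> S \<Longrightarrow> map p w \<in> T" and q: "\<And>w. w \<in> T \<Longrightarrow> map q w \<in> S"
    and pq: "\<And>w. w \<in> T \<Longrightarrow> map p (map q w) = w"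
  shows "exact_words T n"
  unfolding exact_words_def
proof (intro ballI impI)
  fix z assume z: "z \<in> chains_on (words T n)" "frag_extend bdry z = 0"
  have "frag_extend bdry (fmap (map q) z) = 0"
    using z(2) by (simp add: frag_extend_fmap bdry_map flip: fmap_frag_extend)
  moreover have "fmap (map q) z \<in> chains_on (words S n)"
    using z(1) by (rule chains_fmap) (auto simp: words_def q)
  ultimately obtain y where y: "y \<in> chains_on (words S (Suc n))" "frag_extend bdry y = fmap (map q) z"
    using S unfolding exact_words_def by blast
  have "fmap (map p) y \<in> chains_on (words T (Suc n))"
    using y(1) by (rule chains_fmap) (auto simp: words_def p)
  moreover have "frag_extend bdry (fmap (map p) y) = z"
  proof -
    have "frag_extend bdry (fmap (map p) y) = fmap (map p) (fmap (map q) z)"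
      by (simp add: frag_extend_fmap bdry_map flip: fmap_frag_extend y(2))
    also have "\<dots> = z"
      unfolding fmap_fmap by (rule fmap_ident) (use keys_chains [OF z(1)] pq in \<open>auto simp: words_def\<close>)
    finally show ?thesis .
  qed
  ultimately show "\<exists>y\<in>chains_on (words T (Suc n)). frag_extend bdry y = z" by blast
qed

text \<open>In a free complex, exactness below degree \<open>c\<close> gives a contracting homotopy there: it is
  defined on basis words by induction on the degree, \<open>w - h (\<partial>w)\<close> being a cycle.\<close>

lemma exact_words_contraction:
  assumes down: "downclosed S" and exact: "\<And>n. n < c \<Longrightarrow> exact_words S n"
  shows "\<exists>h. \<forall>n<c. \<forall>w \<in> words S n. h w \<in> chains_on (words S (Suc n)) \<and>
    frag_extend bdry (h w) + frag_extend h (bdry w) = frag_of w"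
  using exact
proof (induction c)
  case (Suc c)
  have "\<exists>h. \<forall>n<c. \<forall>w \<in> words S n. h w \<in> chains_on (words S (Suc n)) \<and>
    frag_extend bdry (h w) + frag_extend h (bdry w) = frag_of w"
    by (rule Suc.IH) (rule Suc.prems, simp)
  then obtain h where h: "\<And>n w. n < c \<Longrightarrow> w \<in> words S n \<Longrightarrow> h w \<in> chains_on (words S (Suc n))"
      "\<And>n w. n < c \<Longrightarrow> w \<in> words S n \<Longrightarrow> frag_extend bdry (h w) + frag_extend h (bdry w) = frag_of w"
    by blast
  have step: "\<exists>y \<in> chains_on (words S (Suc c)). frag_extend bdry y + frag_extend h (bdry w) = frag_of w"
    if w: "w \<in> words S c" for w
  proof -
    let ?z = "frag_of w - frag_extend h (bdry w)"
    have "?z \<in> chains_on (words S c) \<and> frag_extend bdry ?z = 0"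
    proof (cases c)
      case 0
      with w show ?thesis by (auto simp: words_def)
    next
      case (Suc m)
      have dw: "bdry w \<in> chains_on (words S m)"
        using bdry_chains [OF down w] Suc by simp
      have "frag_extend h (bdry w) \<in> chains_on (words S c)"
        using dw by (rule chains_frag_extend) (use h(1) [of m] Suc in auto)
      moreover have "frag_extend bdry (frag_extend h (bdry w)) + frag_extend h (frag_extend bdry (bdry w)) = bdry w"
        unfolding frag_extend_frag_extend frag_extend_fun_add [symmetric]
        using dw by (rule frag_extend_ident) (use h(2) [of m] Suc in auto)
      ultimately show ?thesis
        using w by (simp add: chains_diff frag_linear bdry_bdry)
    qed
    then obtain y where "y \<in> chains_on (words S (Suc c))" "frag_extend bdry y = ?z"
      using Suc.prems [of c] unfolding exact_words_def by blast
    then show ?thesis by (intro bexI [of _ y]) auto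
  qed
  \<comment> \<open>Chosen fillings extend \<open>h\<close> to words of length \<open>c\<close>;
    shorter words keep their values, and with them the identities already established.\<close>
  define k where "k w = (if length w = c
    then SOME y. y \<in> chains_on (words S (Suc c)) \<and> frag_extend bdry y + frag_extend h (bdry w) = frag_of w
    else h w)" for w
  have kh: "frag_extend k (bdry w) = frag_extend h (bdry w)" if "n \<le> c" "w \<in> words S n" for n w
  proof (rule frag_extend_eq)
    fix v assume "v \<in> Poly_Mapping.keys (bdry w)"
    then show "k v = h v"
      using that keys_bdry [of v w] by (auto simp: k_def words_def)
  qed
  have "k w \<in> chains_on (words S (Suc n)) \<and> frag_extend bdry (k w) + frag_extend k (bdry w) = frag_of w"
    if n: "n < Suc c" and w: "w \<in> words S n" for n w
  proof (cases "n = c")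
    case True
    then have "k w \<in> chains_on (words S (Suc c)) \<and> frag_extend bdry (k w) + frag_extend h (bdry w) = frag_of w"
      using someI_ex [of "\<lambda>y. y \<in> chains_on (words S (Suc c)) \<and> frag_extend bdry y + frag_extend h (bdry w) = frag_of w"]
        step [of w] w by (auto simp: k_def words_def)
    with True w kh [of c w] show ?thesis by simp
  next
    case False
    with n w have "k w = h w" "n < c" by (auto simp: k_def words_def)
    with h w kh [of n w] show ?thesis by auto
  qed
  then show ?case by blast
qed simp

section \<open>Diagram chases in double complexes\<close>

section \<open>Exactness arguments\<close>

text \<open>In a spectral sequence this says that column 1 accounts for all cycles of column 0 in
  degree \<open>c\<close>: rows are exact in total degree \<open>c\<close>, and columns 2 to
  \<open>c\<close> are exact in total degree \<open>c + 1\<close>, so nothing obstructs the lift. At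
  the bottom of column \<open>c + 1\<close> the weaker \<open>b_exact_0\<close> also admits columns
  with homology in degree 0.\<close>

lemma zigzag:
  fixes a b :: "'c::ab_group_add \<Rightarrow> 'c" and E :: "nat \<Rightarrow> nat \<Rightarrow> 'c set"
  assumes a_diff: "\<And>x y. a (x - y) = a x - a y" and b_diff: "\<And>x y. b (x - y) = b x - b y"
    and E_diff: "\<And>i j x y. x \<in> E i j \<Longrightarrow> y \<in> E i j \<Longrightarrow> x - y \<in> E i j"
    and E_a: "\<And>i j x. x \<in> E (Suc i) j \<Longrightarrow> a x \<in> E i j"
    and E_b: "\<And>i j x. x \<in> E i (Suc j) \<Longrightarrow> b x \<in> E i j"
    and ab: "\<And>i j x. x \<in> E i j \<Longrightarrow> a (b x) = b (a x)"
    and aa: "\<And>i j x. x \<in> E i j \<Longrightarrow> a (a x) = 0" and bb: "\<And>i j x. x \<in> E i j \<Longrightarrow> b (b x) = 0"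
    and a_exact: "\<And>i j w. i + j = c \<Longrightarrow> w \<in> E i j \<Longrightarrow> a w = 0 \<Longrightarrow> \<exists>y \<in> E (Suc i) j. a y = w"
    and b_exact: "\<And>i j w. Suc i + j = c \<Longrightarrow> i \<ge> 1 \<Longrightarrow> w \<in> E (Suc i) (Suc j) \<Longrightarrow> b w = 0 \<Longrightarrow>
      \<exists>x \<in> E (Suc i) (Suc (Suc j)). b x = w"
    and b_exact_0: "\<And>y v. y \<in> E (Suc c) 0 \<Longrightarrow> v \<in> E c (Suc 0) \<Longrightarrow> a y = b v \<Longrightarrow>
      \<exists>x \<in> E (Suc c) (Suc 0). a (b x) = a y"
    and c: "c > 0" and z: "z \<in> E 0 c" "a z = 0" "b z = 0"
  shows "\<exists>y \<in> E (Suc 0) c. b y = 0 \<and> a y = z"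
proof -
  \<comment> \<open>For a lift \<open>y\<close> of \<open>z\<close>, the defect is
    \<open>b y\<close>. The claim writes such a defect as \<open>a (b x)\<close>, so that
    \<open>y - a x\<close> is still a lift and is a \<open>b\<close>-cycle. The induction descends
    an antidiagonal to row 0, where \<open>b_exact_0\<close> applies.\<close>
  have *: "\<exists>x \<in> E (Suc i) (Suc j). b v = a (b x)"
    if "i \<ge> 1" "i + j = c" "v \<in> E i (Suc j)" "a (b v) = 0" for i j v
    using that
  proof (induction j arbitrary: i v)
    case 0
    then have "b v \<in> E i 0" using E_b by blast
    with 0 obtain y where y: "y \<in> E (Suc c) 0" "a y = b v"
      using a_exact [of i 0 "b v"] by auto
    from 0 have i: "i = c" by simp
    obtain x where x: "x \<in> E (Suc c) (Suc 0)" "a (b x) = a y"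
      using b_exact_0 [OF y(1) _ y(2)] 0(3) i by blast
    then have "b v = a (b x)" using y(2) by simp
    with x(1) show ?case unfolding i by blast
  next
    case (Suc j)
    then have bv: "b v \<in> E i (Suc j)" using E_b by blast
    with Suc obtain y where y: "y \<in> E (Suc i) (Suc j)" "a y = b v"
      using a_exact [of i "Suc j" "b v"] by auto
    have "a (b y) = 0"
      using ab [OF y(1)] y(2) bb Suc.prems(3) by simp
    then obtain x' where x': "x' \<in> E (Suc (Suc i)) (Suc j)" "b y = a (b x')"
      using Suc.IH [of "Suc i" y] Suc.prems y(1) by auto
    have "y - a x' \<in> E (Suc i) (Suc j)"
      using E_diff [OF y(1) E_a [OF x'(1)]] .
    moreover have "b (y - a x') = 0"
      using x'(2) ab [OF x'(1)] by (simp add: b_diff)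
    ultimately obtain x where x: "x \<in> E (Suc i) (Suc (Suc j))" "b x = y - a x'"
      using b_exact [of i j "y - a x'"] Suc.prems by auto
    have "a (b x) = b v"
      using x(2) y(2) aa [OF x'(1)] by (simp add: a_diff)
    with x(1) show ?case by force
  qed
  obtain y where y: "y \<in> E (Suc 0) c" "a y = z"
    using a_exact [of 0 c z] z by auto
  obtain m where m: "c = Suc m" using c by (cases c) auto
  have "a (b y) = 0" using ab [OF y(1)] y(2) z(3) by simp
  then obtain x where x: "x \<in> E (Suc (Suc 0)) (Suc m)" "b y = a (b x)"
    using * [of "Suc 0" m y] y(1) m by auto
  have "y - a x \<in> E (Suc 0) c"
    using E_diff [OF y(1)] E_a [OF x(1)] m by simp
  moreover have "b (y - a x) = 0"
    using x(2) ab [OF x(1)] by (simp add: b_diff)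
  moreover have "a (y - a x) = z"
    using y(2) aa [OF x(1)] by (simp add: a_diff)
  ultimately show ?thesis by blast
qed

lemma frag_extend_fun_sum:
  "finite X \<Longrightarrow> (\<Sum>x\<in>X. frag_extend (f x) c) = frag_extend (\<lambda>t. \<Sum>x\<in>X. f x t) c"
  by (induction X rule: finite_induct) (simp_all add: frag_extend_fun_add)

text \<open>\<open>\<iota>\<close> identifies the basis with pairs, and \<open>D\<close>
  differentiates only the second component, so the complex is a direct sum of fibres. A chain meets
  finitely many of them; its slices are decomposed one by one.\<close>

lemma fibrewise_decomposition:
  fixes \<iota> :: "'x \<Rightarrow> 'w \<Rightarrow> 't"
  assumes \<iota>: "\<And>x w. \<pi> (\<iota> x w) = x" "\<And>x w. \<rho> (\<iota> x w) = w" "\<And>t. \<iota> (\<pi> t) (\<rho> t) = t"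
    and D: "\<And>t. D t = fmap (\<iota> (\<pi> t)) (d (\<rho> t))"
    and fibre: "\<And>x c. c \<in> chains_on {w. \<iota> x w \<in> T} \<Longrightarrow> frag_extend d c = 0 \<Longrightarrow>
      \<exists>y0 \<in> chains_on {w. \<iota> x w \<in> T0}. \<exists>y \<in> chains_on {w. \<iota> x w \<in> T1}. c = y0 + frag_extend d y"
    and z: "z \<in> chains_on T" "frag_extend D z = 0"
  shows "\<exists>y0 \<in> chains_on T0. \<exists>y \<in> chains_on T1. z = y0 + frag_extend D y"
proof -
  define slice where "slice x = frag_extend (\<lambda>t. if \<pi> t = x then frag_of (\<rho> t) else 0)" for x
  have "slice x z \<in> chains_on {w. \<iota> x w \<in> T}" for x
    unfolding slice_def using z(1) by (rule chains_frag_extend) (auto simp: \<iota>)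
  moreover have "frag_extend d (slice x z) = 0" for x
  proof -
    have "slice x (D t) = frag_extend d (if \<pi> t = x then frag_of (\<rho> t) else 0)" for t
      by (auto simp: slice_def D frag_extend_fmap \<iota>)
    then have "frag_extend d (slice x z) = slice x (frag_extend D z)"
      by (simp add: slice_def frag_extend_frag_extend)
    with z(2) show ?thesis by (simp add: slice_def)
  qed
  ultimately have "\<forall>x. \<exists>y0 y. y0 \<in> chains_on {w. \<iota> x w \<in> T0} \<and> y \<in> chains_on {w. \<iota> x w \<in> T1}
      \<and> slice x z = y0 + frag_extend d y"
    using fibre by meson
  then obtain Y0 Y where Y: "\<And>x. Y0 x \<in> chains_on {w. \<iota> x w \<in> T0}"
      "\<And>x. Y x \<in> chains_on {w. \<iota> x w \<in> T1}" "\<And>x. slice x z = Y0 x + frag_extend d (Y x)"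
    by metis
  define X where "X = \<pi> ` Poly_Mapping.keys z"
  have X: "finite X" by (simp add: X_def)
  have D\<iota>: "frag_extend D (fmap (\<iota> x) y) = fmap (\<iota> x) (frag_extend d y)" for x y
    by (simp add: frag_extend_fmap fmap_frag_extend D \<iota>)
  have "z = frag_extend (\<lambda>t. \<Sum>x\<in>X. if \<pi> t = x then frag_of t else 0) z"
    using X by (intro frag_extend_ident [symmetric, of _ "Poly_Mapping.keys z"])
      (auto simp: chains_on_def X_def)
  also have "\<dots> = (\<Sum>x\<in>X. fmap (\<iota> x) (slice x z))"
    unfolding frag_extend_fun_sum [OF X, symmetric] slice_def fmap_frag_extend
    by (intro sum.cong refl arg_cong2 [of _ _ _ _ frag_extend] ext) (auto simp: \<iota>)
  also have "\<dots> = (\<Sum>x\<in>X. fmap (\<iota> x) (Y0 x)) + frag_extend D (\<Sum>x\<in>X. fmap (\<iota> x) (Y x))"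
    by (simp add: Y(3) fmap_linear sum.distrib frag_extend_sum [OF X] D\<iota>)
  finally have "z = \<dots>" .
  moreover have "(\<Sum>x\<in>X. fmap (\<iota> x) (Y0 x)) \<in> chains_on T0"
    by (intro chains_sum chains_fmap [OF Y(1)]) auto
  moreover have "(\<Sum>x\<in>X. fmap (\<iota> x) (Y x)) \<in> chains_on T1"
    by (intro chains_sum chains_fmap [OF Y(2)]) auto
  ultimately show ?thesis by blast
qed

lemma fibrewise_exact:
  fixes \<iota> :: "'x \<Rightarrow> 'w \<Rightarrow> 't"
  assumes \<iota>: "\<And>x w. \<pi> (\<iota> x w) = x" "\<And>x w. \<rho> (\<iota> x w) = w" "\<And>t. \<iota> (\<pi> t) (\<rho> t) = t"
    and D: "\<And>t. D t = fmap (\<iota> (\<pi> t)) (d (\<rho> t))"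
    and fibre: "\<And>x c. c \<in> chains_on {w. \<iota> x w \<in> T} \<Longrightarrow> frag_extend d c = 0 \<Longrightarrow>
      \<exists>y \<in> chains_on {w. \<iota> x w \<in> T1}. frag_extend d y = c"
    and z: "z \<in> chains_on T" "frag_extend D z = 0"
  shows "\<exists>y \<in> chains_on T1. frag_extend D y = z"
proof -
  have "\<exists>y0 \<in> chains_on {}. \<exists>y \<in> chains_on T1. z = y0 + frag_extend D y"
    using \<iota> D _ z
  proof (rule fibrewise_decomposition)
    fix x c assume "c \<in> chains_on {w. \<iota> x w \<in> T}" "frag_extend d c = 0"
    then obtain y where "y \<in> chains_on {w. \<iota> x w \<in> T1}" "frag_extend d y = c"
      using fibre by blast
    then show "\<exists>y0 \<in> chains_on {w. \<iota> x w \<in> {}}. \<exists>y \<in> chains_on {w. \<iota> x w \<in> T1}. c = y0 + frag_extend d y"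
      by (intro bexI [of _ 0] bexI [of _ y]) auto
  qed
  then show ?thesis by (auto simp: chains_on_def)
qed


section \<open>Normalising the labels of a cycle\<close>

section \<open>Labelled words\<close>

definition labelled :: "'b list set \<Rightarrow> ('b \<times> 'l) list set"
  where "labelled S = {w. map fst w \<in> S}"

text \<open>The filtration is by the length of the suffix starting at the first letter whose label is not
  \<open>l0\<close>; its graded pieces are sums of complexes of links.\<close>

lemma labelled_words_relabel:
  fixes l0 :: 'l and S :: "'b list set"
  assumes down: "downclosed S"
    and link: "\<And>\<tau> n. \<tau> \<in> S \<Longrightarrow> \<tau> \<noteq> [] \<Longrightarrow> n < c \<Longrightarrow> exact_words {\<alpha>. \<alpha> @ \<tau> \<in> S} n"
    and z: "z \<in> chains_on (words (labelled S) n)" "frag_extend bdry z = 0" and n: "n \<le> c"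
  shows "\<exists>z0 \<in> chains_on {w \<in> words (labelled S) n. \<forall>x\<in>set w. snd x = l0}.
    \<exists>y \<in> chains_on (words (labelled S) (Suc n)). z = z0 + frag_extend bdry y"
proof -
  define good :: "'b \<times> 'l \<Rightarrow> bool" where "good x \<longleftrightarrow> snd x = l0" for x
  define lab :: "'b list \<Rightarrow> ('b \<times> 'l) list" where "lab = map (\<lambda>x. (x, l0))"
  have fst_lab [simp]: "map fst (lab \<alpha>) = \<alpha>" and length_lab [simp]: "length (lab \<alpha>) = length \<alpha>" for \<alpha>
    by (simp_all add: lab_def comp_def)
  have good_lab: "\<And>x. x \<in> set (lab \<alpha>) \<Longrightarrow> good x" for \<alpha>
    by (auto simp: lab_def good_def)
  define tl where "tl w = dropWhile good w" for w
  define Wt where "Wt n m = {w \<in> words (labelled S) n. length (tl w) \<le> m}" for n m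
  have "\<forall>\<tau>\<in>S - {[]}. \<exists>h. \<forall>n<c. \<forall>w \<in> words {\<alpha>. \<alpha> @ \<tau> \<in> S} n. h w \<in> chains_on (words {\<alpha>. \<alpha> @ \<tau> \<in> S} (Suc n)) \<and>
      frag_extend bdry (h w) + frag_extend h (bdry w) = frag_of w"
  proof
    fix \<tau> assume "\<tau> \<in> S - {[]}"
    then show "\<exists>h. \<forall>n<c. \<forall>w \<in> words {\<alpha>. \<alpha> @ \<tau> \<in> S} n. h w \<in> chains_on (words {\<alpha>. \<alpha> @ \<tau> \<in> S} (Suc n)) \<and>
      frag_extend bdry (h w) + frag_extend h (bdry w) = frag_of w"
      using down link by (intro exact_words_contraction) (auto simp: downclosed_def)
  qed
  then obtain h where "\<forall>\<tau>\<in>S - {[]}. \<forall>n<c. \<forall>w \<in> words {\<alpha>. \<alpha> @ \<tau> \<in> S} n.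
      h \<tau> w \<in> chains_on (words {\<alpha>. \<alpha> @ \<tau> \<in> S} (Suc n)) \<and> frag_extend bdry (h \<tau> w) + frag_extend (h \<tau>) (bdry w) = frag_of w"
    by (rule bchoice [THEN exE])
  then have h: "h \<tau> \<alpha> \<in> chains_on (words {\<alpha>. \<alpha> @ \<tau> \<in> S} (Suc (length \<alpha>)))"
      "frag_extend bdry (h \<tau> \<alpha>) + frag_extend (h \<tau>) (bdry \<alpha>) = frag_of \<alpha>"
    if "\<alpha> @ \<tau> \<in> S" "\<tau> \<noteq> []" "length \<alpha> < c" "\<tau> \<in> S" for \<alpha> \<tau>
    using that by (auto simp: words_def)
  have suffix: "\<tau> \<in> S" if "\<alpha> @ \<tau> \<in> S" for \<alpha> \<tau>
    using that
  proof (induction \<alpha>)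
    case (Cons a \<alpha>)
    then have "[] @ \<alpha> @ \<tau> \<in> S"
      using down unfolding downclosed_def by (metis append_Cons append_Nil)
    with Cons show ?case by simp
  qed simp
  \<comment> \<open>The contraction of the link of the tail acts on the prefix, and the letters that
    it adds get the label \<open>l0\<close>. A word with empty tail is already normalised; its link
    would be all of \<open>S\<close>, for which no exactness is assumed.\<close>
  define k where "k w = (if tl w = [] then 0 else
      fmap (\<lambda>\<alpha>. lab \<alpha> @ tl w) (h (map fst (tl w)) (map fst (takeWhile good w))))" for w
  have k_lab: "k (lab \<alpha>) = 0" and tl_lab: "tl (lab \<alpha>) = []" for \<alpha>
    using good_lab by (auto simp: k_def tl_def)
  have tl_append: "tl (lab \<alpha> @ t) = t" "takeWhile good (lab \<alpha> @ t) = lab \<alpha>"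
      "k (lab \<alpha> @ t) = fmap (\<lambda>\<alpha>. lab \<alpha> @ t) (h (map fst t) \<alpha>)"
    if "t \<noteq> []" "\<not> good (hd t)" for \<alpha> t
  proof -
    have "dropWhile good t = t" "takeWhile good t = []"
      using that by (cases t; simp)+
    then show 1: "tl (lab \<alpha> @ t) = t" and 2: "takeWhile good (lab \<alpha> @ t) = lab \<alpha>"
      using good_lab by (simp_all add: tl_def dropWhile_append takeWhile_append)
    show "k (lab \<alpha> @ t) = fmap (\<lambda>\<alpha>. lab \<alpha> @ t) (h (map fst t) \<alpha>)"
      using that by (simp add: k_def 1 2)
  qed
  have tl_le: "length (tl (lab \<alpha> @ v)) \<le> length v" for \<alpha> v
    using good_lab by (simp add: tl_def dropWhile_append length_dropWhile_le)
  have split: "(\<exists>\<alpha>. w = lab \<alpha>) \<or> (\<exists>\<alpha> t. w = lab \<alpha> @ t \<and> t \<noteq> [] \<and> \<not> good (hd t))" for w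
  proof -
    have w: "w = lab (map fst (takeWhile good w)) @ dropWhile good w"
    proof -
      have "lab (map fst (takeWhile good w)) = takeWhile good w"
        unfolding lab_def map_map by (rule map_idI) (auto dest!: set_takeWhileD simp: good_def)
      then show ?thesis by simp
    qed
    show ?thesis
    proof (cases "dropWhile good w = []")
      case True
      with w show ?thesis by (metis append_Nil2)
    next
      case False
      with w hd_dropWhile [OF False] show ?thesis by blast
    qed
  qed
  have k_closed: "k w \<in> chains_on (Wt (Suc n) m)" if w: "w \<in> Wt n m" "n \<le> c" for w n m
  proof (cases "\<exists>\<alpha>. w = lab \<alpha>")
    case False
    then obtain \<alpha> t where t: "w = lab \<alpha> @ t" "t \<noteq> []" "\<not> good (hd t)" using split by blast
    have S: "\<alpha> @ map fst t \<in> S" "length \<alpha> + length t = n" "length t \<le> m"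
      using w by (auto simp: Wt_def words_def labelled_def t tl_append)
    \<comment> \<open>The tail is nonempty, so the prefix has degree below \<open>c\<close> even if
      the word has length \<open>c\<close>. Exactness of links below \<open>c\<close> thus settles
      degree \<open>c\<close> too.\<close>
    have "length \<alpha> < c"
      using S(2) w(2) t(2) by (cases t) auto
    then have "h (map fst t) \<alpha> \<in> chains_on (words {\<alpha>. \<alpha> @ map fst t \<in> S} (Suc (length \<alpha>)))"
      using S(1) t(2) suffix by (intro h(1)) auto
    then show ?thesis
      unfolding t(1) tl_append [OF t(2,3)] 
      by (rule chains_fmap) (use S t in \<open>auto simp: Wt_def words_def labelled_def tl_append\<close>)
  qed (auto simp: k_lab)
  \<comment> \<open>Deleting a letter of the tail shortens the tail. Modulo shorter tails the
    boundary therefore acts on the prefix alone, where \<open>h\<close> contracts.\<close>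
  have shrink: "frag_of w - frag_extend bdry (k w) - frag_extend k (bdry w) \<in> chains_on (Wt n m)"
    if w: "w \<in> Wt n (Suc m)" "n \<le> c" for w n m
  proof (cases "\<exists>\<alpha>. w = lab \<alpha>")
    case True
    then obtain \<alpha> where \<alpha>: "w = lab \<alpha>" by blast
    then have "bdry w = fmap lab (bdry \<alpha>)" by (simp add: lab_def bdry_map)
    then have "frag_extend k (bdry w) = 0" by (simp add: frag_extend_fmap k_lab)
    with w(1) show ?thesis by (simp add: \<alpha> k_lab Wt_def tl_lab)
  next
    case False
    then obtain \<alpha> t where t: "w = lab \<alpha> @ t" "t \<noteq> []" "\<not> good (hd t)" using split by blast
    have S: "\<alpha> @ map fst t \<in> S" "length \<alpha> + length t = n" "length t \<le> Suc m"
      using w(1) by (auto simp: Wt_def words_def labelled_def t tl_append)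
    have \<alpha>: "length \<alpha> < c"
      using S(2) w(2) t(2) by (cases t) auto
    have tS: "map fst t \<in> S" using suffix [OF S(1)] .
    have "map fst t \<noteq> []" using t by simp
    note h\<alpha> = h [OF S(1) this \<alpha> tS]
    let ?j = "\<lambda>\<alpha>. lab \<alpha> @ t" and ?h = "h (map fst t)"
    \<comment> \<open>\<open>?r\<close> collects the faces that delete a letter of the tail.\<close>
    let ?r = "\<lambda>\<alpha>. frag_cmul ((-1) ^ length \<alpha>) (fmap (\<lambda>v. lab \<alpha> @ v) (bdry t))"
    have bdryj: "bdry (?j \<alpha>) = fmap ?j (bdry \<alpha>) + ?r \<alpha>" for \<alpha>
      by (simp add: bdry_append) (simp add: lab_def bdry_map fmap_fmap)
    have kw: "k w = fmap ?j (?h \<alpha>)" using t by (simp add: tl_append)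
    have "frag_extend bdry (k w) = fmap ?j (frag_extend bdry (?h \<alpha>)) + frag_extend ?r (?h \<alpha>)"
      by (simp add: kw frag_extend_fmap bdryj frag_extend_fun_add fmap_frag_extend)
    moreover have "frag_extend k (bdry w) = fmap ?j (frag_extend ?h (bdry \<alpha>)) + frag_extend k (?r \<alpha>)"
      using t by (simp add: bdryj frag_extend_add frag_extend_fmap tl_append fmap_frag_extend)
    moreover have "fmap ?j (frag_extend bdry (?h \<alpha>)) + fmap ?j (frag_extend ?h (bdry \<alpha>)) = frag_of w"
      using h\<alpha>(2) t by (simp flip: fmap_add)
    ultimately have eq: "frag_of w - frag_extend bdry (k w) - frag_extend k (bdry w)
        = - frag_extend ?r (?h \<alpha>) - frag_extend k (?r \<alpha>)"
      by (simp add: algebra_simps)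
    have r: "?r \<alpha>' \<in> chains_on (Wt (n' - 1) m)"
      if "\<alpha>' @ map fst t \<in> S" "length \<alpha>' + length t = n'" for \<alpha>' n'
    proof -
      have "lab \<alpha>' @ v \<in> Wt (n' - 1) m" if v: "v \<in> Poly_Mapping.keys (bdry t)" for v
      proof -
        obtain xs x ys where xs: "t = xs @ x # ys" "v = xs @ ys" using keys_bdry [OF v] by blast
        have "(\<alpha>' @ map fst xs) @ map fst ys \<in> S"
          using down \<open>\<alpha>' @ map fst t \<in> S\<close> unfolding downclosed_def xs
          by (metis append.assoc list.simps(9) map_append)
        then show ?thesis
          using xs S(3) \<open>length \<alpha>' + length t = n'\<close> tl_le [of \<alpha>' v] by (auto simp: Wt_def words_def labelled_def)
      qed
      then have "fmap (\<lambda>v. lab \<alpha>' @ v) (bdry t) \<in> chains_on (Wt (n' - 1) m)"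
        by (intro chains_fmap [of _ "Poly_Mapping.keys (bdry t)"]) (auto simp: chains_on_def)
      then show ?thesis by (rule chains_cmul)
    qed
    have "frag_extend ?r (?h \<alpha>) \<in> chains_on (Wt n m)"
      using h\<alpha>(1) by (rule chains_frag_extend) (use r [of _ "Suc n"] S(2) in \<open>auto simp: words_def\<close>)
    moreover have "frag_extend k (?r \<alpha>) \<in> chains_on (Wt n m)"
    proof -
      have "Suc (n - 1) = n" "n - 1 \<le> c" using S(2) t(2) w(2) by (cases t; simp)+
      then show ?thesis
        using chains_frag_extend [OF r [OF S(1,2)], of k "Wt n m"] k_closed [of _ "n - 1" m] by simp
    qed
    ultimately show ?thesis unfolding eq by (intro chains_diff chains_minus)
  qed
  have "\<exists>z0 \<in> chains_on (Wt n 0). \<exists>y \<in> chains_on (words (labelled S) (Suc n)). z = z0 + frag_extend bdry y"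
    if "z \<in> chains_on (Wt n m)" "frag_extend bdry z = 0" for m z
    using that
  proof (induction m arbitrary: z)
    case 0
    then show ?case by (intro bexI [of _ z] bexI [of _ 0]) auto
  next
    case (Suc m)
    let ?z = "z - frag_extend bdry (frag_extend k z)"
    have "frag_extend k z \<in> chains_on (Wt (Suc n) (Suc m))"
      using Suc.prems(1) by (rule chains_frag_extend) (rule k_closed [OF _ n])
    then have kz: "frag_extend k z \<in> chains_on (words (labelled S) (Suc n))"
      by (rule chains_mono) (auto simp: Wt_def)
    have "?z = frag_extend (\<lambda>w. frag_of w - frag_extend bdry (k w) - frag_extend k (bdry w)) z"
      using Suc.prems(2) by (simp add: frag_extend_fun_diff flip: frag_extend_frag_extend)
    also have "\<dots> \<in> chains_on (Wt n m)"
      using Suc.prems(1) by (rule chains_frag_extend) (rule shrink [OF _ n])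
    finally have "?z \<in> chains_on (Wt n m)" .
    moreover have "frag_extend bdry ?z = 0"
      using Suc.prems(2) by (simp add: frag_linear bdry_bdry_chain)
    ultimately obtain z0 y where "z0 \<in> chains_on (Wt n 0)"
        "y \<in> chains_on (words (labelled S) (Suc n))" "?z = z0 + frag_extend bdry y"
      using Suc.IH by blast
    then show ?case
      using kz by (intro bexI [of _ z0] bexI [of _ "y + frag_extend k z"])
        (auto simp: frag_linear algebra_simps intro: chains_add)
  qed
  moreover have "z \<in> chains_on (Wt n n)"
    using z(1) by (rule chains_mono)
      (auto simp: Wt_def tl_def words_def intro: order_trans [OF length_dropWhile_le])
  moreover have "Wt n 0 = {w \<in> words (labelled S) n. \<forall>x\<in>set w. snd x = l0}"
    by (auto simp: Wt_def tl_def dropWhile_eq_Nil_conv good_def)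
  ultimately show ?thesis using z(2) by auto
qed

section \<open>Split frames in A and their links\<close>

section \<open>Split frames\<close>

text \<open>A split frame is a list of pairs of a vector in \<open>A\<close> and a functional on \<open>A\<close>, acting by left
  multiplication. In \<open>compl\<close>, left multiplication by \<open>\<alpha>\<close> identifies \<open>A\<close> with the complement; when
  \<open>A\<close> is isomorphic to \<open>A\<^sup>2\<close>, such complements are the free ones of any positive rank.\<close>

definition orth :: "('a::ring_1 \<times> 'a) list \<Rightarrow> bool"
  where "orth \<sigma> \<longleftrightarrow> (\<forall>p\<in>set \<sigma>. snd p * fst p = 1) \<and>
    sorted_wrt (\<lambda>p q. snd p * fst q = 0 \<and> snd q * fst p = 0) \<sigma>"

text \<open>For an orthogonal list this is the idempotent whose image is the span of the vectors and
  whose kernel is the common kernel of the functionals.\<close>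

definition proj :: "('a::ring_1 \<times> 'a) list \<Rightarrow> 'a"
  where "proj \<sigma> = (\<Sum>p\<leftarrow>\<sigma>. fst p * snd p)"

definition compl :: "('a::ring_1 \<times> 'a) list \<Rightarrow> 'a \<Rightarrow> 'a \<Rightarrow> bool"
  where "compl \<sigma> \<alpha> \<beta> \<longleftrightarrow> \<beta> * \<alpha> = 1 \<and> \<alpha> * \<beta> = 1 - proj \<sigma>"

definition split_frames :: "('a::ring_1 \<times> 'a) list set"
  where "split_frames = {\<sigma>. orth \<sigma> \<and> (\<exists>\<alpha> \<beta>. compl \<sigma> \<alpha> \<beta>)}"

text \<open>Transport along a map \<open>\<alpha>\<close> with left inverse \<open>\<beta>\<close>:
  vectors are pushed forward, functionals are composed with \<open>\<beta>\<close>.\<close>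

definition lrmult :: "'a::ring_1 \<Rightarrow> 'a \<Rightarrow> 'a \<times> 'a \<Rightarrow> 'a \<times> 'a"
  where "lrmult \<alpha> \<beta> p = (\<alpha> * fst p, snd p * \<beta>)"

lemma fst_lrmult [simp]: "fst (lrmult \<alpha> \<beta> p) = \<alpha> * fst p" and snd_lrmult [simp]: "snd (lrmult \<alpha> \<beta> p) = snd p * \<beta>"
  by (simp_all add: lrmult_def)

lemma orth_Nil [simp]: "orth []"
  by (simp add: orth_def)

lemma orth_Cons: "orth (p # \<sigma>) \<longleftrightarrow>
    snd p * fst p = 1 \<and> (\<forall>q\<in>set \<sigma>. snd p * fst q = 0 \<and> snd q * fst p = 0) \<and> orth \<sigma>"
  by (auto simp: orth_def)

lemma orth_append: "orth (\<sigma> @ \<tau>) \<longleftrightarrow>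
    orth \<sigma> \<and> orth \<tau> \<and> (\<forall>p\<in>set \<sigma>. \<forall>q\<in>set \<tau>. snd p * fst q = 0 \<and> snd q * fst p = 0)"
  by (induction \<sigma>) (auto simp: orth_Cons)

lemma proj_append: "proj (\<sigma> @ \<tau>) = proj \<sigma> + proj \<tau>"
  by (simp add: proj_def)

lemma proj_lrmult: "proj (map (lrmult \<alpha> \<beta>) \<sigma>) = \<alpha> * proj \<sigma> * \<beta>"
  by (induction \<sigma>) (simp_all add: proj_def algebra_simps)

lemma sum_list_mult_eq_0:
  fixes x :: "'a::ring_1"
  shows "(\<And>q. q \<in> set \<sigma> \<Longrightarrow> g q * x = 0) \<Longrightarrow> (\<Sum>q\<leftarrow>\<sigma>. f q * g q) * x = 0"
  by (induction \<sigma>) (simp_all add: algebra_simps)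

lemma mult_sum_list_eq_0:
  fixes x :: "'a::ring_1"
  shows "(\<And>q. q \<in> set \<sigma> \<Longrightarrow> x * g q = 0) \<Longrightarrow> x * (\<Sum>q\<leftarrow>\<sigma>. g q * f q) = 0"
  by (induction \<sigma>) (simp_all add: algebra_simps flip: mult.assoc)

text \<open>The dual functionals build the linear map with prescribed values \<open>f y\<close> on
  the vectors. The indexing by \<open>k\<close> lets \<open>f\<close> depend on labels that the
  pairs do not contain.\<close>

lemma orth_pick:
  assumes "orth (map k \<tau>)" "y \<in> set \<tau>"
  shows "(\<Sum>x\<leftarrow>\<tau>. f x * snd (k x)) * fst (k y) = f y"
  using assms
proof (induction \<tau>)
  case (Cons x \<tau>)
  show ?case
  proof (cases "y \<in> set \<tau>")
    case True
    with Cons show ?thesis by (simp add: orth_Cons algebra_simps)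
  next
    case False
    with Cons.prems have "(\<Sum>x\<leftarrow>\<tau>. f x * snd (k x)) * fst (k y) = 0" "y = x"
      by (auto intro!: sum_list_mult_eq_0 simp: orth_Cons)
    with Cons.prems show ?thesis by (simp add: orth_Cons algebra_simps)
  qed
qed simp

lemma proj_0: "(\<And>q. q \<in> set \<sigma> \<Longrightarrow> snd q * x = 0) \<Longrightarrow> proj \<sigma> * x = 0"
  unfolding proj_def by (rule sum_list_mult_eq_0)

lemma proj_0': "(\<And>q. q \<in> set \<sigma> \<Longrightarrow> x * fst q = 0) \<Longrightarrow> x * proj \<sigma> = 0"
  unfolding proj_def by (rule mult_sum_list_eq_0)

lemma proj_fst: "orth \<sigma> \<Longrightarrow> p \<in> set \<sigma> \<Longrightarrow> proj \<sigma> * fst p = fst p"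
  using orth_pick [of "\<lambda>x. x" \<sigma> p fst] by (simp add: proj_def)

lemma snd_proj: "orth \<sigma> \<Longrightarrow> p \<in> set \<sigma> \<Longrightarrow> snd p * proj \<sigma> = snd p"
proof (induction \<sigma>)
  case (Cons q \<sigma>)
  show ?case
  proof (cases "p \<in> set \<sigma>")
    case True
    with Cons have "snd p * proj \<sigma> = snd p" "snd p * fst q = 0" by (auto simp: orth_Cons)
    then show ?thesis by (simp add: proj_def algebra_simps flip: mult.assoc)
  next
    case False
    with Cons.prems have "snd p * proj \<sigma> = 0" "p = q"
      by (auto intro!: proj_0' simp: orth_Cons)
    with Cons.prems show ?thesis by (simp add: orth_Cons proj_def algebra_simps flip: mult.assoc)
  qed
qed simp

text \<open>Inserting \<open>\<beta> * \<alpha> = 1\<close> brings in the factor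
  \<open>1 - proj \<sigma>\<close>, which is annihilated by the functionals of
  \<open>\<sigma>\<close> and annihilates its vectors.\<close>

lemma compl_orth:
  assumes "orth \<sigma>" "compl \<sigma> \<alpha> \<beta>" "p \<in> set \<sigma>"
  shows "snd p * \<alpha> = 0" "\<beta> * fst p = 0"
proof -
  have \<beta>\<alpha>: "\<beta> * \<alpha> = 1" and \<alpha>\<beta>: "\<alpha> * \<beta> = 1 - proj \<sigma>" using assms(2) by (auto simp: compl_def)
  have "snd p * \<alpha> = snd p * (\<alpha> * (\<beta> * \<alpha>))" by (simp add: \<beta>\<alpha>)
  also have "\<dots> = snd p * (\<alpha> * \<beta>) * \<alpha>" by (simp only: mult.assoc)
  also have "snd p * (\<alpha> * \<beta>) = 0"
    using snd_proj [OF assms(1,3)] by (simp add: \<alpha>\<beta> right_diff_distrib)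
  finally show "snd p * \<alpha> = 0" by simp
  have "\<beta> * fst p = \<beta> * \<alpha> * \<beta> * fst p" by (simp add: \<beta>\<alpha>)
  also have "\<dots> = \<beta> * (\<alpha> * \<beta> * fst p)" by (simp only: mult.assoc)
  also have "\<alpha> * \<beta> * fst p = 0"
    using proj_fst [OF assms(1,3)] by (simp add: \<alpha>\<beta> left_diff_distrib)
  finally show "\<beta> * fst p = 0" by simp
qed

lemma compl_proj:
  assumes "orth \<sigma>" "compl \<sigma> \<alpha> \<beta>"
  shows "proj \<sigma> * \<alpha> = 0" "\<beta> * proj \<sigma> = 0"
  using assms by (auto intro: proj_0 proj_0' compl_orth)

lemma mult_pull:
  fixes a :: "'a::ring_1"
  shows "a * b = c \<Longrightarrow> a * (b * x) = c * x"
  by (simp flip: mult.assoc)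

lemma orth_map_lrmult:
  assumes "orth \<sigma>" "\<And>p q. p \<in> set \<sigma> \<Longrightarrow> q \<in> set \<sigma> \<Longrightarrow> snd p * (\<beta> * (\<alpha> * fst q)) = snd p * fst q"
  shows "orth (map (lrmult \<alpha> \<beta>) \<sigma>)"
  using assms by (induction \<sigma>) (auto simp: orth_Cons mult.assoc)

text \<open>The next two lemmas identify the link of a split frame with complement \<open>\<alpha>A\<close> with
  \<open>split_frames\<close>.\<close>

lemma split_frames_lrmult_append:
  assumes "orth \<tau>" "compl \<tau> \<alpha> \<beta>" "\<sigma> \<in> split_frames"
  shows "map (lrmult \<alpha> \<beta>) \<sigma> @ \<tau> \<in> split_frames"
proof -
  obtain \<gamma> \<delta> where \<sigma>: "orth \<sigma>" "compl \<sigma> \<gamma> \<delta>" using assms(3) by (auto simp: split_frames_def)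
  have \<beta>\<alpha>: "\<beta> * (\<alpha> * x) = x" for x
    using assms(2) by (simp add: compl_def flip: mult.assoc)
  have "orth (map (lrmult \<alpha> \<beta>) \<sigma>)"
    using \<sigma>(1) by (rule orth_map_lrmult) (simp add: \<beta>\<alpha>)
  then have "orth (map (lrmult \<alpha> \<beta>) \<sigma> @ \<tau>)"
    using assms(1) compl_orth [OF assms(1,2)] by (auto simp: orth_append mult.assoc mult_pull [of _ \<alpha> 0])
  moreover have "compl (map (lrmult \<alpha> \<beta>) \<sigma> @ \<tau>) (\<alpha> * \<gamma>) (\<delta> * \<beta>)"
  proof -
    have "\<alpha> * \<gamma> * (\<delta> * \<beta>) = \<alpha> * (\<gamma> * \<delta>) * \<beta>" by (simp add: mult.assoc)
    also have "\<gamma> * \<delta> = 1 - proj \<sigma>" using \<sigma>(2) by (simp add: compl_def)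
    also have "\<alpha> * (1 - proj \<sigma>) * \<beta> = \<alpha> * \<beta> - proj (map (lrmult \<alpha> \<beta>) \<sigma>)"
      by (simp add: proj_lrmult left_diff_distrib right_diff_distrib)
    finally have "\<alpha> * \<gamma> * (\<delta> * \<beta>) = 1 - proj (map (lrmult \<alpha> \<beta>) \<sigma> @ \<tau>)"
      using assms(2) by (simp add: compl_def proj_append)
    then show ?thesis
      using \<sigma>(2) by (simp add: compl_def mult.assoc \<beta>\<alpha>)
  qed
  ultimately show ?thesis by (auto simp: split_frames_def)
qed

lemma split_frames_append_lrmult:
  assumes \<tau>: "orth \<tau>" "compl \<tau> \<alpha> \<beta>" and \<sigma>: "\<sigma> @ \<tau> \<in> split_frames"
  shows "map (lrmult \<beta> \<alpha>) \<sigma> \<in> split_frames" "map (lrmult \<alpha> \<beta>) (map (lrmult \<beta> \<alpha>) \<sigma>) = \<sigma>"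
proof -
  obtain \<gamma> \<delta> where o: "orth (\<sigma> @ \<tau>)" and c: "compl (\<sigma> @ \<tau>) \<gamma> \<delta>"
    using \<sigma> by (auto simp: split_frames_def)
  have \<alpha>\<beta>: "\<alpha> * \<beta> = 1 - proj \<tau>" and \<beta>\<alpha>: "\<beta> * \<alpha> = 1" using \<tau>(2) by (auto simp: compl_def)
  have 1: "proj \<tau> * fst p = 0" "snd p * proj \<tau> = 0" if "p \<in> set \<sigma>" for p
    using o that by (auto simp: orth_append intro!: proj_0 proj_0')
  have 2: "proj \<tau> * \<gamma> = 0"
    using compl_orth [OF o c] by (auto intro!: proj_0)
  have lk1: "\<alpha> * (\<beta> * fst p) = fst p" and lk2: "snd p * \<alpha> * \<beta> = snd p" if "p \<in> set \<sigma>" for p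
  proof -
    show "\<alpha> * (\<beta> * fst p) = fst p"
      using 1 [OF that] unfolding mult.assoc [symmetric] \<alpha>\<beta> by (simp add: left_diff_distrib)
    show "snd p * \<alpha> * \<beta> = snd p"
      using 1 [OF that] unfolding mult.assoc \<alpha>\<beta> by (simp add: right_diff_distrib)
  qed
  show "map (lrmult \<alpha> \<beta>) (map (lrmult \<beta> \<alpha>) \<sigma>) = \<sigma>"
    unfolding map_map by (rule map_idI) (simp add: prod_eq_iff lk1 lk2)
  have "orth (map (lrmult \<beta> \<alpha>) \<sigma>)"
    using o by (intro orth_map_lrmult) (auto simp: orth_append lk1)
  moreover have "compl (map (lrmult \<beta> \<alpha>) \<sigma>) (\<beta> * \<gamma>) (\<delta> * \<alpha>)"
  proof -
    have "\<delta> * \<alpha> * (\<beta> * \<gamma>) = \<delta> * (\<alpha> * \<beta>) * \<gamma>" by (simp add: mult.assoc)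
    also have "\<dots> = 1"
      using c 2 by (simp add: \<alpha>\<beta> compl_def left_diff_distrib right_diff_distrib mult.assoc)
    finally have "\<delta> * \<alpha> * (\<beta> * \<gamma>) = 1" .
    moreover have "\<beta> * \<gamma> * (\<delta> * \<alpha>) = 1 - proj (map (lrmult \<beta> \<alpha>) \<sigma>)"
    proof -
      have "\<beta> * \<gamma> * (\<delta> * \<alpha>) = \<beta> * (\<gamma> * \<delta>) * \<alpha>" by (simp add: mult.assoc)
      also have "\<gamma> * \<delta> = 1 - proj \<sigma> - proj \<tau>" using c by (simp add: compl_def proj_append)
      also have "\<beta> * (1 - proj \<sigma> - proj \<tau>) * \<alpha> = \<beta> * \<alpha> - \<beta> * proj \<sigma> * \<alpha> - \<beta> * proj \<tau> * \<alpha>"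
        by (simp add: left_diff_distrib right_diff_distrib)
      finally show ?thesis
        using compl_proj [OF \<tau>] \<beta>\<alpha> by (simp add: proj_lrmult)
    qed
    ultimately show ?thesis by (simp add: compl_def)
  qed
  ultimately show "map (lrmult \<beta> \<alpha>) \<sigma> \<in> split_frames" by (auto simp: split_frames_def)
qed

lemma split_frames_commute: "\<sigma> @ \<tau> \<in> split_frames \<Longrightarrow> \<tau> @ \<sigma> \<in> split_frames"
  by (auto simp: split_frames_def orth_append compl_def proj_append add.commute)

text \<open>The pair of \<open>g\<close> and \<open>h\<close> is a complement of the empty frame, so
  the description of links applies.\<close>

lemma split_frames_unit:
  assumes gh: "g * h = 1" "h * g = 1" and "\<sigma> \<in> split_frames"
  shows "map (lrmult g h) \<sigma> \<in> split_frames"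
proof -
  have "compl [] g h" using gh by (simp add: compl_def proj_def)
  then show ?thesis using split_frames_lrmult_append [of "[]" g h \<sigma>] assms(3) by simp
qed

section \<open>Frames, mixed frames and coordinates on them\<close>

definition frames :: "'a::ring_1 list set"
  where "frames = {u. \<exists>ws. length ws = length u \<and> zip u ws \<in> split_frames}"

text \<open>Choosing functionals dual to \<open>u\<close> amounts to choosing a complement of
  \<open>u\<close>, so quantifying over them leaves only the vectors as data. An empty
  \<open>u\<close> gives split frames and an empty \<open>\<sigma>\<close> gives frames, which is
  why this set compares the two.\<close>

definition mixed_frames :: "(('a::ring_1 \<times> 'a) list \<times> 'a list) set"
  where "mixed_frames = {(\<sigma>, u). \<exists>ws. length ws = length u \<and> \<sigma> @ zip u ws \<in> split_frames}"

lemma proj_zip: "length ws = length u \<Longrightarrow> proj (zip u ws) = (\<Sum>j<length u. u ! j * ws ! j)"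
  by (simp add: proj_def sum_list_sum_nth atLeast0LessThan)

lemma map_lrmult_zip: "map (lrmult \<alpha> \<beta>) (zip u ws) = zip (map ((*) \<alpha>) u) (map (\<lambda>w. w * \<beta>) ws)"
  by (simp add: zip_map_map lrmult_def case_prod_unfold)

text \<open>The complement of \<open>\<tau>\<close> is a copy of A through \<open>\<alpha>\<close>,
  so the link of \<open>\<tau>\<close> is a copy of the whole complex.\<close>

lemma exact_words_link:
  fixes \<tau> :: "('a::ring_1 \<times> 'a) list"
  assumes "exact_words (split_frames :: ('a \<times> 'a) list set) n" "\<tau> \<in> split_frames"
  shows "exact_words {\<sigma>. \<sigma> @ \<tau> \<in> split_frames} n"
proof -
  obtain \<alpha> \<beta> where \<tau>: "orth \<tau>" "compl \<tau> \<alpha> \<beta>" using assms(2) by (auto simp: split_frames_def)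
  show ?thesis using assms(1)
  proof (rule exact_words_transfer [where p = "lrmult \<alpha> \<beta>" and q = "lrmult \<beta> \<alpha>"])
    fix w
    show "w \<in> split_frames \<Longrightarrow> map (lrmult \<alpha> \<beta>) w \<in> {\<sigma>. \<sigma> @ \<tau> \<in> split_frames}"
      using split_frames_lrmult_append [OF \<tau>] by blast
    assume "w \<in> {\<sigma>. \<sigma> @ \<tau> \<in> split_frames}"
    then show "map (lrmult \<beta> \<alpha>) w \<in> split_frames" "map (lrmult \<alpha> \<beta>) (map (lrmult \<beta> \<alpha>) w) = w"
      using split_frames_append_lrmult [OF \<tau>] by blast+
  qed
qed

text \<open>If \<open>\<gamma>\<close>, \<open>\<delta>\<close> give the complement of the frame of
  \<open>u\<close> and \<open>ws\<close>, every vector is \<open>\<gamma>\<close> times an element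
  plus a combination of \<open>u\<close>; the coefficients of the latter form the label. Functionals
  vanishing on \<open>u\<close> are determined on the complement and need no label.
  \<open>relabel\<close> reads off these data.\<close>

definition unlabel :: "'a::ring_1 \<Rightarrow> 'a \<Rightarrow> 'a list \<Rightarrow> ('a \<times> 'a) \<times> (nat \<Rightarrow> 'a) \<Rightarrow> 'a \<times> 'a"
  where "unlabel \<gamma> \<delta> u x = (\<gamma> * fst (fst x) + (\<Sum>j<length u. u ! j * snd x j), snd (fst x) * \<delta>)"

definition relabel :: "'a::ring_1 \<Rightarrow> 'a \<Rightarrow> 'a list \<Rightarrow> 'a \<times> 'a \<Rightarrow> ('a \<times> 'a) \<times> (nat \<Rightarrow> 'a)"
  where "relabel \<gamma> \<delta> ws p = (lrmult \<delta> \<gamma> p, \<lambda>j. if j < length ws then ws ! j * fst p else 0)"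

text \<open>The functionals \<open>ws'\<close> witnessing the mixed frame may differ from
  \<open>ws\<close>, but both projections have the span of \<open>u\<close> as image. The
  functionals of \<open>\<sigma>\<close>, \<open>\<beta>\<close> and \<open>\<delta>\<close> all
  kill this span, so the projections disappear next to them.\<close>

lemma mixed_frames_relabel:
  assumes len: "length ws = length u" and \<tau>: "orth (zip u ws)" "compl (zip u ws) \<gamma> \<delta>"
    and \<sigma>: "(\<sigma>, u) \<in> mixed_frames"
  shows "map (relabel \<gamma> \<delta> ws) \<sigma> \<in> labelled split_frames"
    "map (unlabel \<gamma> \<delta> u) (map (relabel \<gamma> \<delta> ws) \<sigma>) = \<sigma>"
proof -
  let ?\<tau> = "zip u ws"
  obtain ws' where len': "length ws' = length u" and "\<sigma> @ zip u ws' \<in> split_frames"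
    using \<sigma> by (auto simp: mixed_frames_def)
  then obtain \<alpha> \<beta> where o: "orth (\<sigma> @ zip u ws')" and c: "compl (\<sigma> @ zip u ws') \<alpha> \<beta>"
    by (auto simp: split_frames_def)
  have \<gamma>\<delta>: "\<gamma> * \<delta> = 1 - proj ?\<tau>" and \<delta>\<gamma>: "\<delta> * \<gamma> = 1" using \<tau>(2) by (auto simp: compl_def)
  have fst_zip: "x \<in> fst ` set (zip u ws') \<longleftrightarrow> x \<in> fst ` set ?\<tau>" for x
    using len len' by (metis map_fst_zip set_map)
  have 1: "snd p * proj ?\<tau> = 0" if "p \<in> set \<sigma>" for p
  proof (rule proj_0')
    fix q assume "q \<in> set ?\<tau>"
    then have "fst q \<in> fst ` set (zip u ws')" using fst_zip by blast
    then obtain q' where q': "q' \<in> set (zip u ws')" "fst q = fst q'" by blast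
    then have "snd p * fst q' = 0" using o that unfolding orth_append by blast
    then show "snd p * fst q = 0" by (simp add: q'(2))
  qed
  have 2: "\<beta> * proj ?\<tau> = 0"
  proof (rule proj_0')
    fix q assume "q \<in> set ?\<tau>"
    then have "fst q \<in> fst ` set (zip u ws')" using fst_zip by blast
    then show "\<beta> * fst q = 0" by (elim imageE) (simp add: compl_orth(2) [OF o c])
  qed
  have 3: "\<delta> * proj (zip u ws') = 0"
  proof (rule proj_0')
    fix q assume "q \<in> set (zip u ws')"
    then have "fst q \<in> fst ` set ?\<tau>" using fst_zip by blast
    then show "\<delta> * fst q = 0" by (elim imageE) (simp add: compl_orth(2) [OF \<tau>])
  qed
  have sg: "snd p * \<gamma> * \<delta> = snd p" if "p \<in> set \<sigma>" for p
    using 1 [OF that] unfolding mult.assoc \<gamma>\<delta> by (simp add: right_diff_distrib)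
  have "orth (map (lrmult \<delta> \<gamma>) \<sigma>)"
    using o by (intro orth_map_lrmult) (auto simp: orth_append sg simp flip: mult.assoc)
  moreover have "compl (map (lrmult \<delta> \<gamma>) \<sigma>) (\<delta> * \<alpha>) (\<beta> * \<gamma>)"
  proof -
    have "\<beta> * \<gamma> * (\<delta> * \<alpha>) = \<beta> * (\<gamma> * \<delta>) * \<alpha>" by (simp add: mult.assoc)
    also have "\<dots> = 1"
      using c 2 by (simp add: \<gamma>\<delta> compl_def left_diff_distrib right_diff_distrib)
    finally have "\<beta> * \<gamma> * (\<delta> * \<alpha>) = 1" .
    moreover have "\<delta> * \<alpha> * (\<beta> * \<gamma>) = 1 - proj (map (lrmult \<delta> \<gamma>) \<sigma>)"
    proof -
      have "\<delta> * \<alpha> * (\<beta> * \<gamma>) = \<delta> * (\<alpha> * \<beta>) * \<gamma>" by (simp add: mult.assoc)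
      also have "\<alpha> * \<beta> = 1 - proj \<sigma> - proj (zip u ws')" using c by (simp add: compl_def proj_append)
      also have "\<delta> * (1 - proj \<sigma> - proj (zip u ws')) * \<gamma> = \<delta> * \<gamma> - \<delta> * proj \<sigma> * \<gamma> - \<delta> * proj (zip u ws') * \<gamma>"
        by (simp add: left_diff_distrib right_diff_distrib)
      finally show ?thesis using 3 \<delta>\<gamma> by (simp add: proj_lrmult)
    qed
    ultimately show ?thesis by (simp add: compl_def)
  qed
  ultimately show "map (relabel \<gamma> \<delta> ws) \<sigma> \<in> labelled split_frames"
    by (auto simp: labelled_def relabel_def comp_def split_frames_def)
  show "map (unlabel \<gamma> \<delta> u) (map (relabel \<gamma> \<delta> ws) \<sigma>) = \<sigma>"
    unfolding map_map
  proof (rule map_idI)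
    fix p assume p: "p \<in> set \<sigma>"
    have "(\<Sum>j<length u. u ! j * (ws ! j * fst p)) = proj ?\<tau> * fst p"
      by (simp add: proj_zip len sum_distrib_right mult.assoc)
    moreover have "\<gamma> * (\<delta> * fst p) = fst p - proj ?\<tau> * fst p"
      unfolding mult.assoc [symmetric] \<gamma>\<delta> by (simp add: left_diff_distrib)
    ultimately have "\<gamma> * (\<delta> * fst p) + (\<Sum>j<length u. u ! j * (ws ! j * fst p)) = fst p"
      by simp
    with sg [OF p] show "(unlabel \<gamma> \<delta> u \<circ> relabel \<gamma> \<delta> ws) p = p"
      by (simp add: unlabel_def relabel_def len prod_eq_iff)
  qed
qed

text \<open>The transvection \<open>1 + n\<close> adds the labels to the vectors of a split frame of \<open>ker ws\<close> and
  fixes the vectors \<open>u\<close> and the functionals of the split frame.\<close>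

lemma mixed_frames_unlabel:
  assumes len: "length ws = length u" and \<tau>: "orth (zip u ws)" "compl (zip u ws) \<gamma> \<delta>"
    and x: "x \<in> labelled split_frames"
  shows "(map (unlabel \<gamma> \<delta> u) x, u) \<in> mixed_frames"
proof -
  let ?\<tau> = "zip u ws"
  let ?L = "\<lambda>y. \<Sum>j<length u. u ! j * snd y j"
  \<comment> \<open>\<open>n\<close> kills \<open>u\<close> and sends \<open>\<gamma>\<close> times
    the vector of a letter to the combination of \<open>u\<close> prescribed by its label. Its image
    lies in the span of \<open>u\<close>, which \<open>\<delta>\<close> kills; hence
    \<open>n * n = 0\<close>, and \<open>1 - n\<close> inverts \<open>1 + n\<close>.\<close>
  define n where "n = (\<Sum>y\<leftarrow>x. ?L y * snd (fst y)) * \<delta>"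
  have ox: "orth (map fst x)" using x by (auto simp: labelled_def split_frames_def)
  have \<delta>\<gamma>: "\<delta> * \<gamma> = 1" using \<tau>(2) by (auto simp: compl_def)
  have \<delta>u: "\<delta> * u ! j = 0" if "j < length u" for j
    using compl_orth(2) [OF \<tau>, of "(u ! j, ws ! j)"] that len by (auto simp: set_zip)
  have nu: "n * u ! j = 0" if "j < length u" for j
    using \<delta>u [OF that] by (simp add: n_def mult.assoc)
  have \<delta>n: "\<delta> * n = 0"
  proof -
    have "\<delta> * (\<Sum>y\<leftarrow>x. ?L y * snd (fst y)) = 0"
      by (rule mult_sum_list_eq_0) (simp add: sum_distrib_left \<delta>u flip: mult.assoc)
    then show ?thesis by (simp add: n_def flip: mult.assoc)
  qed
  have nn: "n * n = 0" using \<delta>n by (simp add: n_def mult.assoc)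
  have n\<gamma>: "n * (\<gamma> * fst (fst y)) = ?L y" if "y \<in> set x" for y
    using orth_pick [OF ox that, of ?L] \<delta>\<gamma>
    by (simp add: n_def mult.assoc mult_pull [of \<delta> \<gamma> 1])
  have "map (lrmult \<gamma> \<delta>) (map fst x) @ ?\<tau> \<in> split_frames"
    using x by (intro split_frames_lrmult_append \<tau>) (simp add: labelled_def)
  then have *: "map (lrmult (1 + n) (1 - n)) (map (lrmult \<gamma> \<delta>) (map fst x) @ ?\<tau>) \<in> split_frames"
    by (rule split_frames_unit [rotated 2]) (simp_all add: algebra_simps nn)
  have 1: "map (lrmult (1 + n) (1 - n)) (map (lrmult \<gamma> \<delta>) (map fst x)) = map (unlabel \<gamma> \<delta> u) x"
    by (auto simp: unlabel_def n\<gamma> prod_eq_iff algebra_simps \<delta>n)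
  have 2: "map ((*) (1 + n)) u = u"
    by (auto simp: in_set_conv_nth nu algebra_simps intro!: map_idI)
  \<comment> \<open>The transvection changes the functionals dual to \<open>u\<close>, but a mixed
    frame does not record them.\<close>
  show ?thesis
    using * unfolding mixed_frames_def map_append 1 map_lrmult_zip 2
    by (auto simp: len intro!: exI [of _ "map (\<lambda>w. w * (1 - n)) ws"])
qed

text \<open>The relations of the Leavitt algebra: sending \<open>(x, y)\<close> to
  \<open>s1 * x + s2 * y\<close> is an isomorphism from A^2 to A, and \<open>t1\<close>,
  \<open>t2\<close> are the components of its inverse.\<close>

locale leavitt =
  fixes s1 s2 t1 t2 :: "'a::ring_1"
  assumes ts: "t1 * s1 = 1" "t2 * s2 = 1" "t1 * s2 = 0" "t2 * s1 = 0"
    and st: "s1 * t1 + s2 * t2 = 1"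
begin

lemma ts_mult: "t1 * (s1 * x) = x" "t2 * (s2 * x) = x" "t1 * (s2 * x) = 0" "t2 * (s1 * x) = 0"
  using ts by (simp_all flip: mult.assoc)

text \<open>Deleting a pair enlarges the complement by the line of its vector. The new complement is
  a copy of A^2, which the Leavitt relations turn into a copy of A again.\<close>

lemma downclosed_split_frames: "downclosed (split_frames :: ('a \<times> 'a) list set)"
  unfolding downclosed_def
proof (intro allI impI)
  fix xs p ys assume "xs @ p # ys \<in> (split_frames :: ('a \<times> 'a) list set)"
  then obtain \<alpha> \<beta> where o: "orth (xs @ p # ys)" and c: "compl (xs @ p # ys) \<alpha> \<beta>"
    by (auto simp: split_frames_def)
  have \<beta>\<alpha>: "\<beta> * \<alpha> = 1" and \<alpha>\<beta>: "\<alpha> * \<beta> = 1 - proj (xs @ p # ys)" using c by (auto simp: compl_def)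
  have p: "snd p * \<alpha> = 0" "\<beta> * fst p = 0" "snd p * fst p = 1"
    using compl_orth [OF o c, of p] o by (auto simp: orth_append orth_Cons)
  define \<gamma> \<delta> where "\<gamma> = \<alpha> * t1 + fst p * t2" and "\<delta> = s1 * \<beta> + s2 * snd p"
  have "\<delta> * \<gamma> = s1 * (\<beta> * \<alpha>) * t1 + s1 * (\<beta> * fst p) * t2
      + s2 * (snd p * \<alpha>) * t1 + s2 * (snd p * fst p) * t2"
    by (simp add: \<gamma>_def \<delta>_def algebra_simps)
  then have "\<delta> * \<gamma> = 1" by (simp add: \<beta>\<alpha> p st)
  moreover have "\<gamma> * \<delta> = \<alpha> * \<beta> + fst p * snd p"
    by (simp add: \<gamma>_def \<delta>_def ring_distribs mult.assoc ts_mult)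
  then have "\<gamma> * \<delta> = 1 - proj (xs @ ys)"
    by (simp add: \<alpha>\<beta> proj_append) (simp add: proj_def)
  ultimately have "compl (xs @ ys) \<gamma> \<delta>" by (simp add: compl_def)
  moreover have "orth (xs @ ys)" using o by (auto simp: orth_append orth_Cons)
  ultimately show "xs @ ys \<in> split_frames" by (auto simp: split_frames_def)
qed

lemma split_frames_prefix:
  assumes "\<sigma> @ \<tau> \<in> (split_frames :: ('a \<times> 'a) list set)"
  shows "\<sigma> \<in> split_frames"
  using assms
proof (induction \<tau>)
  case (Cons p \<tau>)
  then show ?case using downclosed_split_frames unfolding downclosed_def by blast
qed simp

lemma base_split_frame:
  "orth [(s2, t2)]" "compl [(s2, t2)] s1 t1" "[(s2, t2)] \<in> split_frames"
proof -
  show 1: "orth [(s2, t2)]" by (simp add: orth_Cons ts)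
  show "compl [(s2, t2)] s1 t1"
    using st by (simp add: compl_def proj_def ts eq_diff_eq)
  with 1 show "[(s2, t2)] \<in> split_frames" by (auto simp: split_frames_def)
qed

text \<open>The base frame is transported into the complement of \<open>\<tau>\<close>, a copy of
  A.\<close>

lemma split_frames_extend:
  assumes "\<tau> \<in> (split_frames :: ('a \<times> 'a) list set)"
  shows "\<exists>p. p # \<tau> \<in> split_frames"
proof -
  obtain \<alpha> \<beta> where \<tau>: "orth \<tau>" "compl \<tau> \<alpha> \<beta>" using assms by (auto simp: split_frames_def)
  show ?thesis using split_frames_lrmult_append [OF \<tau> base_split_frame(3)] by (metis append_Cons append_Nil list.simps(8,9))
qed

lemma ex_split_frame: "\<exists>\<tau> \<in> (split_frames :: ('a \<times> 'a) list set). length \<tau> = n"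
proof (induction n)
  case 0
  have "compl [] 1 (1::'a)" by (simp add: compl_def proj_def)
  then have "[] \<in> (split_frames :: ('a \<times> 'a) list set)" unfolding split_frames_def by fastforce
  then show ?case by (metis list.size(3))
next
  case (Suc n)
  then show ?case using split_frames_extend by (metis length_Cons)
qed

lemma mixed_frames_down1:
  "(xs @ x # ys, u) \<in> mixed_frames \<Longrightarrow> (xs @ ys, u) \<in> (mixed_frames :: (('a \<times> 'a) list \<times> 'a list) set)"
  using downclosed_split_frames unfolding downclosed_def mixed_frames_def by (auto; blast)

lemma mixed_frames_down2:
  assumes "(\<sigma>, xs @ x # ys) \<in> (mixed_frames :: (('a \<times> 'a) list \<times> 'a list) set)"
  shows "(\<sigma>, xs @ ys) \<in> mixed_frames"
proof -
  obtain ws where ws: "length ws = length (xs @ x # ys)" "\<sigma> @ zip (xs @ x # ys) ws \<in> split_frames"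
    using assms by (auto simp: mixed_frames_def)
  define as b bs where "as = take (length xs) ws" and "b = ws ! length xs" and "bs = drop (Suc (length xs)) ws"
  have ws': "ws = as @ b # bs" "length as = length xs" "length bs = length ys"
    using ws(1) by (simp_all add: as_def b_def bs_def id_take_nth_drop)
  have "(\<sigma> @ zip xs as) @ (x, b) # zip ys bs \<in> split_frames"
    using ws(2) ws' by simp
  then have "(\<sigma> @ zip xs as) @ zip ys bs \<in> split_frames"
    using downclosed_split_frames unfolding downclosed_def by blast
  then show ?thesis
    unfolding mixed_frames_def using ws' by (auto intro!: exI [of _ "as @ bs"])
qed

text \<open>The functionals of \<open>\<sigma>\<close> kill the vectors \<open>u\<close>, which
  therefore lie in the complement of \<open>\<sigma>\<close>. As this is a copy of A, the row over
  \<open>\<sigma>\<close> is a copy of the complex of frames.\<close>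

lemma exact_words_mixed_frames:
  assumes "exact_words (frames :: 'a list set) n" "\<sigma> \<in> (split_frames :: ('a \<times> 'a) list set)"
  shows "exact_words {u. (\<sigma>, u) \<in> mixed_frames} n"
proof -
  obtain \<alpha> \<beta> where \<sigma>: "orth \<sigma>" "compl \<sigma> \<alpha> \<beta>" using assms(2) by (auto simp: split_frames_def)
  show ?thesis using assms(1)
  proof (rule exact_words_transfer [where p = "(*) \<alpha>" and q = "(*) \<beta>"])
    fix u :: "'a list" assume "u \<in> frames"
    then obtain ws where ws: "length ws = length u" "zip u ws \<in> split_frames" by (auto simp: frames_def)
    have "\<sigma> @ map (lrmult \<alpha> \<beta>) (zip u ws) \<in> split_frames"
      by (rule split_frames_commute) (rule split_frames_lrmult_append [OF \<sigma> ws(2)])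
    then show "map ((*) \<alpha>) u \<in> {u. (\<sigma>, u) \<in> mixed_frames}"
      using ws(1) unfolding mixed_frames_def map_lrmult_zip
      by (auto intro!: exI [of _ "map (\<lambda>w. w * \<beta>) ws"])
  next
    fix u assume "u \<in> {u. (\<sigma>, u) \<in> mixed_frames}"
    then obtain ws where ws: "length ws = length u" "\<sigma> @ zip u ws \<in> split_frames"
      by (auto simp: mixed_frames_def)
    note * = split_frames_append_lrmult [OF \<sigma> split_frames_commute [OF ws(2)]]
    have "map ((*) \<beta>) u = map fst (map (lrmult \<beta> \<alpha>) (zip u ws))"
      unfolding map_lrmult_zip by (simp add: ws(1))
    moreover show "map ((*) \<beta>) u \<in> frames"
      using *(1) ws(1) unfolding frames_def map_lrmult_zip by (auto intro!: exI [of _ "map (\<lambda>w. w * \<alpha>) ws"])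
    ultimately show "map ((*) \<alpha>) (map ((*) \<beta>) u) = u"
      using arg_cong [OF *(2), of "map fst"] ws(1) by (simp add: map_lrmult_zip comp_def)
  qed
qed

text \<open>The column over \<open>u\<close> consists of split frames labelled by coordinates along
  \<open>u\<close>. Label zero means that \<open>ws\<close> vanishes on the vectors, so normalising
  the labels produces \<open>z0\<close>. This includes \<open>n = c\<close>, where the column is not
  yet known to be exact.\<close>

lemma mixed_frames_decomposition:
  fixes u ws :: "'a list"
  assumes exact: "\<And>m. m < c \<Longrightarrow> exact_words (split_frames :: ('a \<times> 'a) list set) m"
    and ws: "length ws = length u" "zip u ws \<in> split_frames"
    and z: "z \<in> chains_on (words {\<sigma>. (\<sigma>, u) \<in> mixed_frames} n)" "frag_extend bdry z = 0" and n: "n \<le> c"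
  shows "\<exists>z0 \<in> chains_on (words {\<sigma>. \<sigma> @ zip u ws \<in> split_frames} n).
    \<exists>y \<in> chains_on (words {\<sigma>. (\<sigma>, u) \<in> mixed_frames} (Suc n)). z = z0 + frag_extend bdry y"
proof -
  obtain \<gamma> \<delta> where \<tau>: "orth (zip u ws)" "compl (zip u ws) \<gamma> \<delta>"
    using ws(2) by (auto simp: split_frames_def)
  let ?p = "unlabel \<gamma> \<delta> u" and ?q = "relabel \<gamma> \<delta> ws"
  note q = mixed_frames_relabel [OF ws(1) \<tau>] and p = mixed_frames_unlabel [OF ws(1) \<tau>]
  have "fmap (map ?q) z \<in> chains_on (words (labelled split_frames) n)"
    using z(1) by (rule chains_fmap) (use q(1) in \<open>auto simp: words_def\<close>)
  moreover have "frag_extend bdry (fmap (map ?q) z) = 0"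
    using z(2) by (simp add: frag_extend_fmap bdry_map flip: fmap_frag_extend)
  moreover have "exact_words {\<alpha>. \<alpha> @ \<tau> \<in> split_frames} m"
    if "\<tau> \<in> split_frames" "m < c" for \<tau> :: "('a \<times> 'a) list" and m
    using exact_words_link [OF exact] that by blast
  ultimately obtain z0 y where
      z0: "z0 \<in> chains_on {w \<in> words (labelled split_frames) n. \<forall>x\<in>set w. snd x = (\<lambda>_. 0)}"
      and y: "y \<in> chains_on (words (labelled split_frames) (Suc n))"
      and eq: "fmap (map ?q) z = z0 + frag_extend bdry y"
    using labelled_words_relabel [OF downclosed_split_frames, of c "fmap (map ?q) z" n "\<lambda>_. 0"] n by blast
  have "map ?p w @ zip u ws \<in> split_frames"
    if "w \<in> labelled split_frames" "\<forall>x\<in>set w. snd x = (\<lambda>_. 0)" for w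
  proof -
    have *: "map ?p w = map (lrmult \<gamma> \<delta>) (map fst w)"
      using that(2) by (auto simp: unlabel_def prod_eq_iff)
    show ?thesis
      unfolding * using split_frames_lrmult_append [OF \<tau>, of "map fst w"] that(1) by (simp add: labelled_def)
  qed
  then have "fmap (map ?p) z0 \<in> chains_on (words {\<sigma>. \<sigma> @ zip u ws \<in> split_frames} n)"
    using z0 by (elim chains_fmap) (auto simp: words_def)
  moreover have "fmap (map ?p) y \<in> chains_on (words {\<sigma>. (\<sigma>, u) \<in> mixed_frames} (Suc n))"
    using y p by (elim chains_fmap) (auto simp: words_def)
  moreover have "z = fmap (map ?p) (fmap (map ?q) z)"
    unfolding fmap_fmap
    by (rule fmap_ident [symmetric]) (use keys_chains [OF z(1)] q(2) in \<open>auto simp: words_def\<close>)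
  then have "z = fmap (map ?p) z0 + frag_extend bdry (fmap (map ?p) y)"
    unfolding eq by (simp add: fmap_linear frag_extend_fmap fmap_frag_extend bdry_map)
  ultimately show ?thesis by blast
qed

text \<open>What the decomposition leaves over lies in the link of the split frame of
  \<open>u\<close> and \<open>ws\<close>, and links are exact below \<open>c\<close>.\<close>

lemma mixed_frames_exact:
  fixes u :: "'a list"
  assumes exact: "\<And>m. m < c \<Longrightarrow> exact_words (split_frames :: ('a \<times> 'a) list set) m" and n: "n < c"
  shows "exact_words {\<sigma>. (\<sigma>, u) \<in> mixed_frames} n"
  unfolding exact_words_def
proof (intro ballI impI)
  fix z assume z: "z \<in> chains_on (words {\<sigma>. (\<sigma>, u) \<in> mixed_frames} n)" "frag_extend bdry z = 0"
  show "\<exists>y \<in> chains_on (words {\<sigma>. (\<sigma>, u) \<in> mixed_frames} (Suc n)). frag_extend bdry y = z"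
  proof (cases "u \<in> frames")
    case True
    then obtain ws where ws: "length ws = length u" "zip u ws \<in> split_frames"
      by (auto simp: frames_def)
    have "n \<le> c" using n by simp
    then obtain z0 y where z0: "z0 \<in> chains_on (words {\<sigma>. \<sigma> @ zip u ws \<in> split_frames} n)"
      and y: "y \<in> chains_on (words {\<sigma>. (\<sigma>, u) \<in> mixed_frames} (Suc n))" and eq: "z = z0 + frag_extend bdry y"
      using mixed_frames_decomposition [OF exact ws z] by blast
    have "exact_words {\<sigma>. \<sigma> @ zip u ws \<in> split_frames} n"
      using exact_words_link [OF exact [OF n] ws(2)] .
    moreover have "frag_extend bdry z0 = 0"
      using z(2) eq by (simp add: frag_linear bdry_bdry_chain)
    ultimately obtain y0 where y0: "y0 \<in> chains_on (words {\<sigma>. \<sigma> @ zip u ws \<in> split_frames} (Suc n))"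
        "frag_extend bdry y0 = z0"
      using z0 unfolding exact_words_def by blast
    have "y0 \<in> chains_on (words {\<sigma>. (\<sigma>, u) \<in> mixed_frames} (Suc n))"
      using y0(1) by (rule chains_mono) (use ws(1) in \<open>auto simp: words_def mixed_frames_def\<close>)
    then show ?thesis
      using y y0(2) eq by (intro bexI [of _ "y0 + y"]) (auto simp: frag_linear intro: chains_add)
  next
    case False
    have "{\<sigma>. (\<sigma>, u) \<in> mixed_frames} = {}"
      using False split_frames_commute split_frames_prefix
      unfolding frames_def mixed_frames_def by blast
    then show ?thesis using z(1) by (intro bexI [of _ 0]) (auto simp: chains_on_def words_def)
  qed
qed

text \<open>Exactness of split frames is deduced from that of frames through the double complex of
  mixed frames, whose rows are complexes of frames and whose columns are complexes of labelled split
  frames. A cycle in the leftmost column comes from cycles of split frames \<open>\<sigma>\<close> orthogonal to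
  \<open>(u, w)\<close>, for vectors \<open>u\<close>; such a cycle is killed by the cone with apex \<open>(u, w)\<close>.\<close>

lemma exact_split_frames:
  assumes frames: "\<And>n. exact_words (frames :: 'a list set) n"
  shows "exact_words (split_frames :: ('a \<times> 'a) list set) c"
proof (induction c rule: less_induct)
  case (less c)
  note exact = less.IH
  show ?case
  proof (cases "c = 0")
    case True
    have "\<exists>y \<in> chains_on (words split_frames (Suc 0)). frag_extend bdry y = z"
      if z: "z \<in> chains_on (words split_frames 0)" for z :: "('a \<times> 'a) list \<Rightarrow>\<^sub>0 int"
    proof
      show "fmap (\<lambda>_. [(s2, t2)]) z \<in> chains_on (words split_frames (Suc 0))"
        using z by (rule chains_fmap) (simp add: words_def base_split_frame)
      show "frag_extend bdry (fmap (\<lambda>_. [(s2, t2)]) z) = z"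
        unfolding frag_extend_fmap using z by (rule frag_extend_ident) (auto simp: words_def)
    qed
    with True show ?thesis by (auto simp: exact_words_def)
  next
    case False
    define M :: "nat \<Rightarrow> nat \<Rightarrow> (('a \<times> 'a) list \<times> 'a list) set"
      where "M i j = {(\<sigma>, u) \<in> mixed_frames. length u = i \<and> length \<sigma> = j}" for i j
    define A :: "('a \<times> 'a) list \<times> 'a list \<Rightarrow> _" where "A t = fmap (Pair (fst t)) (bdry (snd t))" for t
    define B :: "('a \<times> 'a) list \<times> 'a list \<Rightarrow> _" where "B t = fmap (\<lambda>\<sigma>. (\<sigma>, snd t)) (bdry (fst t))" for t
    let ?a = "frag_extend A" and ?b = "frag_extend B"
    have A: "A t \<in> chains_on (M i j)" if "t \<in> M (Suc i) j" for t i j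
    proof -
      have "bdry (snd t) \<in> chains_on (Poly_Mapping.keys (bdry (snd t)))" by (simp add: chains_on_def)
      then show ?thesis
        unfolding A_def using that
        by (elim chains_fmap) (auto simp: M_def dest!: keys_bdry intro: mixed_frames_down2)
    qed
    have B: "B t \<in> chains_on (M i j)" if "t \<in> M i (Suc j)" for t i j
    proof -
      have "bdry (fst t) \<in> chains_on (Poly_Mapping.keys (bdry (fst t)))" by (simp add: chains_on_def)
      then show ?thesis
        unfolding B_def using that
        by (elim chains_fmap) (auto simp: M_def dest!: keys_bdry intro: mixed_frames_down1)
    qed
    have AA: "?a (?a x) = 0" for x
      by (simp add: frag_extend_frag_extend A_def frag_extend_fmap bdry_bdry flip: fmap_frag_extend)
    have BB: "?b (?b x) = 0" for x
      by (simp add: frag_extend_frag_extend B_def frag_extend_fmap bdry_bdry flip: fmap_frag_extend)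
    have AB: "?a (?b x) = ?b (?a x)" for x
    proof -
      have "?a (B t) = ?b (A t)" for t
      proof -
        have "frag_extend (\<lambda>\<sigma>. fmap (Pair \<sigma>) e) d = frag_extend (\<lambda>u. fmap (\<lambda>\<sigma>. (\<sigma>, u)) d) e"
          for d :: "('a \<times> 'a) list \<Rightarrow>\<^sub>0 int" and e :: "'a list \<Rightarrow>\<^sub>0 int"
          using subset_UNIV
          by (induction d rule: frag_induction)
            (simp_all add: frag_linear fmap_linear frag_extend_fun_diff fmap_def)
        then show ?thesis by (simp add: A_def B_def frag_extend_fmap)
      qed
      then show ?thesis by (simp add: frag_extend_frag_extend)
    qed
    have exact_A: "\<exists>y \<in> chains_on (M (Suc i) j). ?a y = z"
      if "z \<in> chains_on (M i j)" "?a z = 0" for z i j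
    proof (rule fibrewise_exact [where \<iota> = Pair and \<pi> = fst and \<rho> = snd and d = bdry and D = A, OF _ _ _ _ _ that])
      fix \<sigma> :: "('a \<times> 'a) list" and z assume z: "z \<in> chains_on {w. (\<sigma>, w) \<in> M i j}" "frag_extend bdry z = 0"
      show "\<exists>y \<in> chains_on {w. (\<sigma>, w) \<in> M (Suc i) j}. frag_extend bdry y = z"
      proof (cases "\<sigma> \<in> split_frames \<and> length \<sigma> = j")
        case True
        then have "{w. (\<sigma>, w) \<in> M i j} = words {u. (\<sigma>, u) \<in> mixed_frames} i" for i
          by (auto simp: M_def words_def)
        with z exact_words_mixed_frames [OF frames, of \<sigma> i] True show ?thesis
          unfolding exact_words_def by auto
      next
        case False
        then have "{w. (\<sigma>, w) \<in> M i j} = {}"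
          using split_frames_prefix by (auto simp: M_def mixed_frames_def)
        with z(1) show ?thesis by (intro bexI [of _ 0]) (auto simp: chains_on_def)
      qed
    qed (auto simp: A_def)
    \<comment> \<open>By induction the columns are exact only below degree \<open>c\<close>; in
      degree \<open>c\<close> the decomposition of column 1 takes over.\<close>
    have exact_B: "\<exists>y \<in> chains_on (M i (Suc j)). ?b y = z"
      if "z \<in> chains_on (M i j)" "?b z = 0" "j < c" for z i j
    proof (rule fibrewise_exact [where \<iota> = "\<lambda>u \<sigma>. (\<sigma>, u)" and \<pi> = snd and \<rho> = fst and d = bdry and D = B, OF _ _ _ _ _ that(1,2)])
      fix u :: "'a list" and z assume z: "z \<in> chains_on {w. (w, u) \<in> M i j}" "frag_extend bdry z = 0"
      show "\<exists>y \<in> chains_on {w. (w, u) \<in> M i (Suc j)}. frag_extend bdry y = z"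
      proof (cases "length u = i")
        case True
        then have "{w. (w, u) \<in> M i j} = words {\<sigma>. (\<sigma>, u) \<in> mixed_frames} j" for j
          by (auto simp: M_def words_def)
        with z mixed_frames_exact [OF exact \<open>j < c\<close>, of u] True show ?thesis
          unfolding exact_words_def by auto
      next
        case False
        then have "{w. (w, u) \<in> M i j} = {}" by (auto simp: M_def)
        with z(1) show ?thesis by (intro bexI [of _ 0]) (auto simp: chains_on_def)
      qed
    qed (auto simp: B_def)
    show ?thesis unfolding exact_words_def
    proof (intro ballI impI)
      fix z :: "('a \<times> 'a) list \<Rightarrow>\<^sub>0 int" assume z: "z \<in> chains_on (words split_frames c)" "frag_extend bdry z = 0"
      let ?z = "fmap (\<lambda>\<sigma>. (\<sigma>, [])) z"
      have "\<exists>y \<in> chains_on (M (Suc 0) c). ?b y = 0 \<and> ?a y = ?z"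
      proof (rule zigzag)
        fix i j x assume "x \<in> chains_on (M (Suc i) j)"
        then show "?a x \<in> chains_on (M i j)" using A by (rule chains_frag_extend)
      next
        fix i j x assume "x \<in> chains_on (M i (Suc j))"
        then show "?b x \<in> chains_on (M i j)" using B by (rule chains_frag_extend)
      next
        fix y v assume y: "y \<in> chains_on (M (Suc c) 0)"
        \<comment> \<open>In row 0 every chain is a \<open>b\<close>-cycle, and the columns are
          exact there because \<open>c > 0\<close>.\<close>
        have "?b y = 0"
        proof (rule frag_extend_eq_0)
          fix t assume "t \<in> Poly_Mapping.keys y"
          then have "t \<in> M (Suc c) 0" by (rule keys_chains [OF y])
          then show "B t = 0" by (auto simp: M_def B_def)
        qed
        then show "\<exists>x \<in> chains_on (M (Suc c) (Suc 0)). ?a (?b x) = ?a y"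
          using exact_B [OF y] False by auto
      next
        show "?z \<in> chains_on (M 0 c)"
          using z(1) by (rule chains_fmap) (auto simp: words_def M_def mixed_frames_def)
        show "?a ?z = 0" by (simp add: frag_extend_fmap A_def)
        show "?b ?z = 0"
          using z(2) by (simp add: frag_extend_fmap B_def flip: fmap_frag_extend)
      qed (use False exact_A exact_B AA BB AB in \<open>auto simp: frag_linear intro: chains_diff\<close>)
      then obtain y where y: "y \<in> chains_on (M (Suc 0) c)" "?b y = 0" "?a y = ?z" by blast
      \<comment> \<open>The dual functional is chosen once for each \<open>u\<close>, so that a
        whole column is decomposed with respect to the same pair, the apex of the cone
        below.\<close>
      define ws :: "'a list \<Rightarrow> 'a list"
        where "ws u = (SOME ws. length ws = length u \<and> zip u ws \<in> split_frames)" for u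
      define T where "T = {(\<sigma>, u). length u = Suc 0 \<and> length \<sigma> = c \<and> length (ws u) = Suc 0 \<and> \<sigma> @ zip u (ws u) \<in> split_frames}"
      have "\<exists>y0 \<in> chains_on T. \<exists>x \<in> chains_on (M (Suc 0) (Suc c)). y = y0 + ?b x"
      proof (rule fibrewise_decomposition [where \<iota> = "\<lambda>u \<sigma>. (\<sigma>, u)" and \<pi> = snd and \<rho> = fst and d = bdry and D = B, OF _ _ _ _ _ y(1,2)])
        fix u :: "'a list" and z assume z: "z \<in> chains_on {w. (w, u) \<in> M (Suc 0) c}" "frag_extend bdry z = 0"
        show "\<exists>y0 \<in> chains_on {w. (w, u) \<in> T}. \<exists>y \<in> chains_on {w. (w, u) \<in> M (Suc 0) (Suc c)}. z = y0 + frag_extend bdry y"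
        proof (cases "length u = Suc 0 \<and> u \<in> frames")
          case True
          then have "\<exists>ws. length ws = length u \<and> zip u ws \<in> split_frames" unfolding frames_def by blast
          from someI_ex [OF this] have ws: "length (ws u) = length u" "zip u (ws u) \<in> split_frames"
            by (simp_all add: ws_def)
          have "{w. (w, u) \<in> M (Suc 0) j} = words {\<sigma>. (\<sigma>, u) \<in> mixed_frames} j" for j
            using True by (auto simp: M_def words_def)
          moreover have "{w. (w, u) \<in> T} = words {\<sigma>. \<sigma> @ zip u (ws u) \<in> split_frames} c"
            using True ws(1) by (auto simp: T_def words_def)
          ultimately show ?thesis
            using mixed_frames_decomposition [OF exact ws, of c z c] z by auto
        next
          case False
          then have "{w. (w, u) \<in> M (Suc 0) c} = {}"
            using split_frames_commute split_frames_prefix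
            unfolding M_def frames_def mixed_frames_def by blast
          with z(1) show ?thesis by (intro bexI [of _ 0]) (auto simp: chains_on_def)
        qed
      qed (auto simp: B_def)
      then obtain y0 x where y0: "y0 \<in> chains_on T" and x: "x \<in> chains_on (M (Suc 0) (Suc c))"
        and yx: "y = y0 + ?b x" by blast
      have by0: "?b y0 = 0" using y(2) yx BB [of x] by (simp add: frag_linear)
      \<comment> \<open>The apex depends only on \<open>u\<close>, which the faces in
        \<open>B\<close> keep. Hence the boundary of a cone is its base minus the cone over
        \<open>B\<close>, and the latter vanishes on the cycle \<open>y0\<close>.\<close>
      define cone where "cone t = (hd (snd t), hd (ws (snd t))) # fst t" for t :: "('a \<times> 'a) list \<times> 'a list"
      have cone: "frag_extend bdry (fmap cone y0) = fmap fst y0"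
      proof -
        have "bdry (cone t) = frag_of (fst t) - fmap cone (B t)" for t
          by (simp add: cone_def B_def fmap_fmap)
        then have "frag_extend bdry (fmap cone y0) = fmap fst y0 - fmap cone (?b y0)"
          by (simp add: frag_extend_fmap frag_extend_fun_diff fmap_frag_extend) (simp add: fmap_def)
        with by0 show ?thesis by simp
      qed
      have "fmap cone y0 \<in> chains_on (words split_frames (Suc c))"
        using y0
      proof (rule chains_fmap)
        fix t assume t: "t \<in> T"
        then obtain u w where "snd t = [u]" "ws (snd t) = [w]"
          by (auto simp: T_def length_Suc_conv)
        with t show "cone t \<in> words split_frames (Suc c)"
          using split_frames_commute [of "fst t" "[(u, w)]"] by (auto simp: cone_def T_def words_def)
      qed
      moreover have "fmap fst x \<in> chains_on (words split_frames (Suc c))"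
        using x by (rule chains_fmap) (auto simp: M_def words_def mixed_frames_def intro: split_frames_prefix)
      moreover have "z = frag_extend bdry (fmap cone y0 + fmap fst x)"
      proof -
        \<comment> \<open>Deleting the only vector of \<open>u\<close> merely forgets it, so on
          column 1 the map \<open>?a\<close> amounts to \<open>fmap fst\<close>.\<close>
        have fA: "fmap fst (A t) = frag_of (fst t)" if "t \<in> M (Suc 0) c" for t
          using that by (auto simp: A_def M_def length_Suc_conv)
        have fB: "fmap fst (B t) = bdry (fst t)" for t
          by (simp add: B_def fmap_fmap fmap_ident)
        have "z = fmap fst (?a y)" by (simp add: y(3) fmap_fmap fmap_ident)
        also have "\<dots> = frag_extend (\<lambda>t. frag_of (fst t)) y"
          unfolding fmap_frag_extend using y(1) fA by (rule frag_extend_cong)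
        also have "\<dots> = fmap fst y" by (simp add: fmap_def)
        also have "\<dots> = fmap fst y0 + frag_extend bdry (fmap fst x)"
          by (simp add: yx fmap_linear fmap_frag_extend fB frag_extend_fmap)
        finally show ?thesis by (simp add: frag_linear cone)
      qed
      ultimately show "\<exists>y\<in>chains_on (words split_frames (Suc c)). frag_extend bdry y = z"
        by (intro bexI [of _ "fmap cone y0 + fmap fst x"]) (auto intro: chains_add)
    qed
  qed
qed

end

section \<open>Bar complexes of action groupoids and Shapiro's lemma\<close>

section \<open>The bar complex of a group action\<close>

text \<open>The bar differential is split as \<open>T + P\<close>, where \<open>T\<close> drops the first group element and \<open>P\<close>
  collects the other faces. In the last face of \<open>P\<close> the last group element acts on the point.\<close>

definition bar_cons :: "'g \<Rightarrow> 'g list \<times> 'x \<Rightarrow> 'g list \<times> 'x"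
  where "bar_cons g t = (g # fst t, snd t)"

definition bar_merge ::
  "('g, 'b) monoid_scheme \<Rightarrow> ('g \<Rightarrow> 'x \<Rightarrow> 'x) \<Rightarrow> 'g \<Rightarrow> 'g list \<times> 'x \<Rightarrow> 'g list \<times> 'x"
  where "bar_merge G act g t = (case fst t of [] \<Rightarrow> ([], act g (snd t)) | h # hs \<Rightarrow> ((g \<otimes>\<^bsub>G\<^esub> h) # hs, snd t))"

definition bar_T :: "'g list \<times> 'x \<Rightarrow> ('g list \<times> 'x \<Rightarrow>\<^sub>0 int)"
  where "bar_T t = (case fst t of [] \<Rightarrow> 0 | g # gs \<Rightarrow> frag_of (gs, snd t))"

fun bar_P :: "('g, 'b) monoid_scheme \<Rightarrow> ('g \<Rightarrow> 'x \<Rightarrow> 'x) \<Rightarrow> 'g list \<times> 'x \<Rightarrow> ('g list \<times> 'x \<Rightarrow>\<^sub>0 int)"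
  where "bar_P G act ([], x) = 0"
  | "bar_P G act (g # gs, x) = - frag_of (bar_merge G act g (gs, x)) - fmap (bar_cons g) (bar_P G act (gs, x))"

definition bar_d :: "('g, 'b) monoid_scheme \<Rightarrow> ('g \<Rightarrow> 'x \<Rightarrow> 'x) \<Rightarrow> 'g list \<times> 'x \<Rightarrow> ('g list \<times> 'x \<Rightarrow>\<^sub>0 int)"
  where "bar_d G act t = bar_T t + bar_P G act t"

lemma bar_P_cons:
  "bar_P G act (bar_cons g t) = - frag_of (bar_merge G act g t) - fmap (bar_cons g) (bar_P G act t)"
  by (cases t) (simp add: bar_cons_def)

lemma bar_T_cons: "bar_T (bar_cons g t) = frag_of t"
  by (simp add: bar_T_def bar_cons_def)

lemma bar_merge_cons: "bar_merge G act g (bar_cons h t) = bar_cons (g \<otimes>\<^bsub>G\<^esub> h) t"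
  by (simp add: bar_merge_def bar_cons_def)

lemma bar_d_Nil: "bar_d G act ([], x) = 0"
  by (simp add: bar_d_def bar_T_def)

lemma bar_induct [case_names Nil Cons]:
  assumes "\<And>x. Q ([], x)" "\<And>g t. Q t \<Longrightarrow> Q (bar_cons g t)"
  shows "Q t"
proof -
  have "Q (gs, x)" for gs x
  proof (induction gs)
    case (Cons g gs)
    then show ?case using assms(2) [of "(gs, x)" g] by (simp add: bar_cons_def)
  qed (rule assms(1))
  then show ?thesis by (cases t) auto
qed

lemma bar_cases [case_names Nil Cons]:
  assumes "\<And>x. t = ([], x) \<Longrightarrow> thesis" "\<And>g s. t = bar_cons g s \<Longrightarrow> thesis"
  shows thesis
  using bar_induct [of "\<lambda>s. t = s \<longrightarrow> thesis" t] assms by blast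

text \<open>This is the part of \<open>d d = 0\<close> that involves dropping; a letter merged into
  the next one is dropped together with it. The other part is \<open>bar_P_P\<close>.\<close>

lemma bar_T_P: "frag_extend bar_T (bar_P G act t) + frag_extend (bar_P G act) (bar_T t)
    + frag_extend bar_T (bar_T t) = 0"
proof (cases t rule: bar_cases)
  case (Nil x)
  then show ?thesis by (simp add: bar_T_def)
next
  case (Cons g s)
  have "bar_T (bar_merge G act g s) = bar_T s"
    by (auto simp: bar_T_def bar_merge_def split: list.split)
  then show ?thesis
    by (simp add: Cons bar_P_cons bar_T_cons frag_linear frag_extend_fmap)
qed

locale bar_action = group G for G (structure) +
  fixes act :: "'a \<Rightarrow> 'x \<Rightarrow> 'x" and X :: "'x set"
  assumes act_closed: "g \<in> carrier G \<Longrightarrow> x \<in> X \<Longrightarrow> act g x \<in> X"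
    and act_mult: "g \<in> carrier G \<Longrightarrow> h \<in> carrier G \<Longrightarrow> x \<in> X \<Longrightarrow> act (g \<otimes> h) x = act g (act h x)"
    and act_one: "x \<in> X \<Longrightarrow> act \<one> x = x"
begin

definition bars :: "nat \<Rightarrow> ('a list \<times> 'x) set"
  where "bars n = {(gs, x). length gs = n \<and> set gs \<subseteq> carrier G \<and> x \<in> X}"

text \<open>Read from right to left, a bar is a chain of arrows of the action groupoid that starts
  at its point; this is where it ends.\<close>

definition target :: "'a list \<times> 'x \<Rightarrow> 'x"
  where "target t = foldr act (fst t) (snd t)"

lemma target_simps [simp]: "target ([], x) = x" "target (bar_cons g t) = act g (target t)"
  by (simp_all add: target_def bar_cons_def)

lemma bars_Nil [simp]: "([], x) \<in> bars n \<longleftrightarrow> n = 0 \<and> x \<in> X"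
  by (auto simp: bars_def)

lemma bars_cons [simp]: "bar_cons g t \<in> bars n \<longleftrightarrow> g \<in> carrier G \<and> n > 0 \<and> t \<in> bars (n - 1)"
  by (cases t) (auto simp: bars_def bar_cons_def)

lemma target_closed: "t \<in> bars n \<Longrightarrow> target t \<in> X"
  by (induction t arbitrary: n rule: bar_induct) (auto intro: act_closed)

lemma bar_merge_closed:
  assumes "g \<in> carrier G" "t \<in> bars n"
  shows "bar_merge G act g t \<in> bars n" "target (bar_merge G act g t) = act g (target t)"
proof -
  have "bar_merge G act g t \<in> bars n \<and> target (bar_merge G act g t) = act g (target t)"
    using assms(2)
  proof (induction t arbitrary: n rule: bar_induct)
    case (Nil x)
    with assms(1) show ?case by (simp add: bar_merge_def act_closed)
  next
    case (Cons h t)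
    with assms(1) show ?case by (auto simp: bar_merge_cons act_mult target_closed)
  qed
  then show "bar_merge G act g t \<in> bars n" "target (bar_merge G act g t) = act g (target t)" by auto
qed

text \<open>The faces in \<open>P\<close> keep the end of the chain of arrows, unlike
  \<open>T\<close>. This lets \<open>bar_P_prism\<close> treat the elements attached to that end as
  constants.\<close>

lemma bar_P_closed:
  "t \<in> bars n \<Longrightarrow> bar_P G act t \<in> chains_on {s \<in> bars (n - 1). target s = target t}"
proof (induction t arbitrary: n rule: bar_induct)
  case (Cons g t)
  have "fmap (bar_cons g) (bar_P G act t) \<in> chains_on {s \<in> bars (n - 1). target s = target (bar_cons g t)}"
  proof (cases "n - 1 > 0")
    case True
    show ?thesis
      by (rule chains_fmap [OF Cons.IH [of "n - 1"]]) (use Cons.prems True in auto)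
  next
    case False
    with Cons.prems have "fst t = []" by (auto simp: bars_def bar_cons_def)
    then have "bar_P G act t = 0" by (cases t) auto
    then show ?thesis by simp
  qed
  with Cons.prems show ?case
    by (auto simp: bar_P_cons bar_merge_closed intro!: chains_diff chains_minus)
qed simp

lemma bar_T_closed: "t \<in> bars n \<Longrightarrow> bar_T t \<in> chains_on (bars (n - 1))"
proof (induction t rule: bar_induct)
  case (Nil x)
  then show ?case by (simp add: bar_T_def)
qed (simp add: bar_T_cons)

lemma bar_d_closed: "t \<in> bars n \<Longrightarrow> bar_d G act t \<in> chains_on (bars (n - 1))"
  unfolding bar_d_def using chains_mono [OF bar_P_closed] bar_T_closed by (blast intro: chains_add)

lemma bar_merge_merge:
  "g \<in> carrier G \<Longrightarrow> h \<in> carrier G \<Longrightarrow> t \<in> bars n \<Longrightarrow>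
    bar_merge G act g (bar_merge G act h t) = bar_merge G act (g \<otimes> h) t"
  by (auto simp: bar_merge_def bars_def act_mult m_assoc split: list.split)

text \<open>Absorbing \<open>g\<close> at the end of the chain of arrows commutes with the faces in
  \<open>P\<close>, by associativity and the action law.\<close>

lemma bar_P_merge:
  assumes "g \<in> carrier G" "t \<in> bars n"
  shows "bar_P G act (bar_merge G act g t) = fmap (bar_merge G act g) (bar_P G act t)"
  using assms(2)
proof (induction t rule: bar_induct)
  case (Cons h t)
  with assms(1) show ?case
    by (auto simp: bar_merge_cons bar_P_cons fmap_linear fmap_fmap bar_merge_merge)
qed (simp add: bar_merge_def)

lemma bar_P_P: "t \<in> bars n \<Longrightarrow> frag_extend (bar_P G act) (bar_P G act t) = 0"
proof (induction t arbitrary: n rule: bar_induct)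
  case (Cons g t)
  have "frag_extend (bar_P G act) (fmap (bar_cons g) c)
      = - fmap (bar_merge G act g) c - fmap (bar_cons g) (frag_extend (bar_P G act) c)" for c
    by (simp add: frag_extend_fmap bar_P_cons frag_extend_fun_diff frag_extend_fun_minus fmap_frag_extend)
      (simp add: fmap_def)
  with Cons show ?case
    by (auto simp: bar_P_cons frag_linear bar_P_merge)
qed simp

lemma bar_d_d:
  assumes "t \<in> bars n"
  shows "frag_extend (bar_d G act) (bar_d G act t) = 0"
proof -
  have "frag_extend (bar_d G act) c = frag_extend bar_T c + frag_extend (bar_P G act) c" for c
    by (simp add: bar_d_def [abs_def] frag_extend_fun_add)
  then show ?thesis
    using bar_T_P [of G act t] bar_P_P [OF assms]
    by (simp add: bar_d_def frag_linear algebra_simps)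
qed

end

text \<open>Shapiro's lemma: the action groupoid of a transitive action retracts onto a stabiliser, and
  \<open>prism\<close> is the chain homotopy of the natural transformation given by the elements
  \<open>inv (t x)\<close>.\<close>

locale transitive_bar_action = bar_action G act X
    for G (structure) and act :: "'a \<Rightarrow> 'b \<Rightarrow> 'b" and X :: "'b set" +
  fixes x0 :: 'b and t :: "'b \<Rightarrow> 'a"
  assumes x0: "x0 \<in> X" and t_closed: "x \<in> X \<Longrightarrow> t x \<in> carrier G" and t_act: "x \<in> X \<Longrightarrow> act (t x) x0 = x"
begin

definition stabiliser :: "'a set"
  where "stabiliser = {g \<in> carrier G. act g x0 = x0}"

text \<open>The arrow from \<open>x\<close> to \<open>act g x\<close> is carried to
  \<open>x0\<close> along the elements \<open>t\<close>, which makes it a loop at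
  \<open>x0\<close>.\<close>

definition conj_t :: "'b \<Rightarrow> 'a \<Rightarrow> 'a"
  where "conj_t x g = inv (t (act g x)) \<otimes> g \<otimes> t x"

fun retract :: "'a list \<times> 'b \<Rightarrow> 'a list \<times> 'b"
  where "retract ([], x) = ([], x0)"
  | "retract (g # gs, x) = bar_cons (conj_t (target (gs, x)) g) (retract (gs, x))"

fun prism :: "'a list \<times> 'b \<Rightarrow> ('a list \<times> 'b \<Rightarrow>\<^sub>0 int)"
  where "prism ([], x) = frag_of ([inv (t x)], x)"
  | "prism (g # gs, x) = frag_of (inv (t (act g (target (gs, x)))) # g # gs, x)
      - fmap (bar_cons (conj_t (target (gs, x)) g)) (prism (gs, x))"

lemma retract_cons: "retract (bar_cons g s) = bar_cons (conj_t (target s) g) (retract s)"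
  by (cases s) (simp add: bar_cons_def)

lemma prism_Nil: "prism ([], x) = frag_of (bar_cons (inv (t x)) ([], x))"
  by (simp add: bar_cons_def)

lemma prism_cons: "prism (bar_cons g s) = frag_of (bar_cons (inv (t (act g (target s)))) (bar_cons g s))
    - fmap (bar_cons (conj_t (target s) g)) (prism s)"
  by (cases s) (simp add: bar_cons_def)

lemma inv_t_act: "x \<in> X \<Longrightarrow> act (inv (t x)) x = x0"
  using act_mult [of "inv (t x)" "t x" x0] by (simp add: t_closed t_act x0 act_one)

lemma conj_t_closed: "x \<in> X \<Longrightarrow> g \<in> carrier G \<Longrightarrow> conj_t x g \<in> stabiliser"
  by (simp add: stabiliser_def conj_t_def t_closed act_closed act_mult x0 t_act inv_t_act)

lemma conj_t_carrier: "x \<in> X \<Longrightarrow> g \<in> carrier G \<Longrightarrow> conj_t x g \<in> carrier G"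
  using conj_t_closed by (simp add: stabiliser_def)

text \<open>This is naturality of the transformation with components \<open>inv (t x)\<close>;
  \<open>conj_t_mult\<close> is functoriality of the retraction.\<close>

lemma conj_t_inv: "x \<in> X \<Longrightarrow> g \<in> carrier G \<Longrightarrow> conj_t x g \<otimes> inv (t x) = inv (t (act g x)) \<otimes> g"
  by (simp add: conj_t_def t_closed act_closed m_assoc)

lemma conj_t_mult: "x \<in> X \<Longrightarrow> g \<in> carrier G \<Longrightarrow> h \<in> carrier G \<Longrightarrow>
    conj_t (act h x) g \<otimes> conj_t x h = conj_t x (g \<otimes> h)"
  by (simp add: conj_t_def t_closed act_closed act_mult m_assoc inv_solve_left' flip: m_assoc)
    (simp add: t_closed act_closed m_assoc)

lemma retract_closed:
  "s \<in> bars n \<Longrightarrow> retract s \<in> {(gs, x). length gs = n \<and> set gs \<subseteq> stabiliser \<and> x = x0}"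
proof (induction s arbitrary: n rule: bar_induct)
  case (Cons g s)
  then have "s \<in> bars (n - 1)" "g \<in> carrier G" "n > 0" by auto
  then show ?case
    using Cons.IH [of "n - 1"] conj_t_closed [of "target s" g]
    by (auto simp: retract_cons target_closed bar_cons_def)
qed simp

lemma prism_closed: "s \<in> bars n \<Longrightarrow> prism s \<in> chains_on (bars (Suc n))"
proof (induction s arbitrary: n rule: bar_induct)
  case (Nil x)
  then show ?case by (simp add: prism_Nil t_closed del: prism.simps)
next
  case (Cons g s)
  then have "fmap (bar_cons (conj_t (target s) g)) (prism s) \<in> chains_on (bars (Suc n))"
    by (intro chains_fmap [OF Cons.IH [of "n - 1"]]) (auto simp: conj_t_carrier target_closed)
  with Cons.prems show ?case
    by (auto simp: prism_cons t_closed act_closed target_closed intro!: chains_diff)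
qed

text \<open>\<open>T\<close> strips the letter that the prism adds, which gives the identity, while
  \<open>P\<close> gives the retraction in \<open>bar_P_prism\<close>. Together they yield
  \<open>d prism + prism d = 1 - retract\<close>.\<close>

lemma bar_T_prism: "frag_extend bar_T (prism s) + frag_extend prism (bar_T s) = frag_of s"
proof (induction s rule: bar_induct)
  case (Nil x)
  then show ?case by (simp add: bar_T_def)
next
  case (Cons g s)
  then show ?case
    by (simp add: prism_cons bar_T_cons frag_linear frag_extend_fmap)
qed

text \<open>By \<open>conj_t_inv\<close>, merging into the leading term of the prism gives exactly
  the last term here, which it cancels. The remaining terms agree by
  \<open>conj_t_mult\<close>.\<close>

lemma prism_merge:
  assumes "g \<in> carrier G" "s \<in> bars n"
  shows "prism (bar_merge G act g s) =
    frag_of (bar_cons (inv (t (act g (target s)))) (bar_merge G act g s))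
    + fmap (bar_merge G act (conj_t (target s) g)) (prism s)
    - frag_of (bar_cons (inv (t (act g (target s))) \<otimes> g) s)"
  using assms(2)
proof (induction s arbitrary: n rule: bar_induct)
  case (Nil x)
  have "bar_merge G act g ([], x) = ([], act g x)"
    by (simp add: bar_merge_def)
  with Nil assms(1) show ?case
    by (simp add: prism_Nil bar_merge_cons conj_t_inv del: prism.simps)
next
  case (Cons h s)
  then have "s \<in> bars (n - 1)" "h \<in> carrier G" by auto
  moreover from this have "target s \<in> X" by (simp add: target_closed)
  ultimately show ?case
    using assms(1)
    by (simp add: bar_merge_cons prism_cons fmap_linear fmap_fmap conj_t_inv conj_t_mult act_mult act_closed)
qed

lemma bar_P_prism:
  "s \<in> bars n \<Longrightarrow> frag_extend (bar_P G act) (prism s) + frag_extend prism (bar_P G act s) = - frag_of (retract s)"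
proof (induction s arbitrary: n rule: bar_induct)
  case (Nil x)
  then show ?case
    by (simp add: prism_Nil bar_P_cons inv_t_act del: prism.simps) (simp add: bar_merge_def inv_t_act)
next
  case (Cons g s)
  then have s: "s \<in> bars (n - 1)" "g \<in> carrier G" by auto
  define f where "f = conj_t (target s) g"
  define \<eta> where "\<eta> = inv (t (act g (target s)))"
  let ?P = "bar_P G act" and ?m = "bar_merge G act"
  have P_f: "frag_extend ?P (fmap (bar_cons f) c) = - fmap (?m f) c - fmap (bar_cons f) (frag_extend ?P c)" for c
    by (simp add: frag_extend_fmap bar_P_cons frag_extend_fun_diff frag_extend_fun_minus fmap_frag_extend)
      (simp add: fmap_def)
  have 1: "frag_extend ?P (prism (bar_cons g s)) = - frag_of (?m \<eta> (bar_cons g s))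
      + frag_of (bar_cons \<eta> (?m g s)) + fmap (\<lambda>u. bar_cons \<eta> (bar_cons g u)) (?P s)
      + fmap (?m f) (prism s) + fmap (bar_cons f) (frag_extend ?P (prism s))"
    by (simp add: prism_cons frag_extend_diff P_f bar_P_cons fmap_linear fmap_fmap flip: f_def \<eta>_def)
  have 2: "frag_extend prism (?P (bar_cons g s)) = - prism (?m g s)
      - fmap (\<lambda>u. bar_cons \<eta> (bar_cons g u)) (?P s) + fmap (bar_cons f) (frag_extend prism (?P s))"
  proof -
    have "frag_extend prism (fmap (bar_cons g) (?P s))
        = frag_extend (\<lambda>u. frag_of (bar_cons \<eta> (bar_cons g u)) - fmap (bar_cons f) (prism u)) (?P s)"
      unfolding frag_extend_fmap using bar_P_closed [OF s(1)]
      by (rule frag_extend_cong) (auto simp: prism_cons f_def \<eta>_def)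
    also have "\<dots> = fmap (\<lambda>u. bar_cons \<eta> (bar_cons g u)) (?P s) - fmap (bar_cons f) (frag_extend prism (?P s))"
      by (simp add: frag_extend_fun_diff fmap_frag_extend) (simp add: fmap_def)
    finally show ?thesis by (simp add: bar_P_cons frag_linear)
  qed
  have 3: "prism (?m g s) = frag_of (bar_cons \<eta> (?m g s)) + fmap (?m f) (prism s)
      - frag_of (?m \<eta> (bar_cons g s))"
    using prism_merge [OF s(2,1)] by (simp add: f_def \<eta>_def bar_merge_cons)
  have "fmap (bar_cons f) (frag_extend ?P (prism s)) + fmap (bar_cons f) (frag_extend prism (?P s))
      = - frag_of (retract (bar_cons g s))"
    using Cons.IH [OF s(1)] by (simp add: retract_cons f_def fmap_minus flip: fmap_add)
  then show ?case unfolding 1 2 3 by simp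
qed

lemma shapiro:
  assumes z: "z \<in> chains_on (bars n)" "frag_extend (bar_d G act) z = 0"
  shows "\<exists>y0 \<in> chains_on {(gs, x). length gs = n \<and> set gs \<subseteq> stabiliser \<and> x = x0}.
    \<exists>y \<in> chains_on (bars (Suc n)). z = y0 + frag_extend (bar_d G act) y"
proof -
  have "frag_extend (bar_d G act) (prism s) + frag_extend prism (bar_d G act s) = frag_of s - frag_of (retract s)"
    if "s \<in> bars n" for s
    using bar_T_prism [of s] bar_P_prism [OF that]
    by (simp add: bar_d_def [abs_def] frag_extend_fun_add frag_extend_add algebra_simps)
  then have "frag_extend (\<lambda>s. frag_extend (bar_d G act) (prism s) + frag_extend prism (bar_d G act s)) z
      = frag_extend (\<lambda>s. frag_of s - frag_of (retract s)) z"
    using z(1) by (intro frag_extend_cong)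
  then have "z = fmap retract z + frag_extend (bar_d G act) (frag_extend prism z)"
    using z(2)
    by (simp add: frag_extend_fun_add frag_extend_fun_diff fmap_def flip: frag_extend_frag_extend)
  moreover have "fmap retract z \<in> chains_on {(gs, x). length gs = n \<and> set gs \<subseteq> stabiliser \<and> x = x0}"
    using z(1) retract_closed by (rule chains_fmap)
  moreover have "frag_extend prism z \<in> chains_on (bars (Suc n))"
    using z(1) prism_closed by (rule chains_frag_extend)
  ultimately show ?thesis by blast
qed

end

section \<open>Vanishing of homology groups in terms of chains\<close>

section \<open>Homology groups and exactness\<close>

definition bar_exact :: "nat \<Rightarrow> ('g, 'b) monoid_scheme \<Rightarrow> bool"
  where "bar_exact n G \<longleftrightarrow> (\<forall>c \<in> chains_on (bar_simplices G n). ss_boundary (bar_face G) n c = 0 \<longrightarrow>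
    (\<exists>e \<in> chains_on (bar_simplices G (Suc n)). ss_boundary (bar_face G) (Suc n) e = c))"

lemma carrier_free_Abelian_group: "carrier (free_Abelian_group S) = chains_on S"
  by (auto simp: chains_on_def)

lemma ss_boundary_diff: "ss_boundary d p (c - c') = ss_boundary d p c - ss_boundary d p c'"
  by (simp add: ss_boundary_def frag_linear)

lemma ss_boundary_add: "ss_boundary d p (c + c') = ss_boundary d p c + ss_boundary d p c'"
  by (simp add: ss_boundary_def frag_linear)

lemma ss_boundary_0: "ss_boundary d p 0 = 0"
  by (simp add: ss_boundary_def)

lemma zero_in_ss_boundaries: "0 \<in> ss_boundaries S d p"
  unfolding ss_boundaries_def by (rule image_eqI [of _ _ 0]) (simp_all add: ss_boundary_0)

lemma in_r_coset_free:
  "0 \<in> B \<Longrightarrow> c \<in> B #>\<^bsub>subgroup_generated (free_Abelian_group S) Z\<^esub> c"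
  by (force simp: r_coset_def)

text \<open>Triviality makes the coset of \<open>c\<close> equal to \<open>B\<close>, and this coset
  contains \<open>c\<close> because 0 lies in \<open>B\<close>.\<close>

lemma trivial_quotientD:
  assumes triv: "trivial_group (subgroup_generated (free_Abelian_group S) Z Mod B)"
    and B: "0 \<in> B" and c: "c \<in> Z" "c \<in> chains_on S"
  shows "c \<in> B"
proof -
  let ?G = "subgroup_generated (free_Abelian_group S) Z"
  have "c \<in> carrier ?G"
    using c by (auto simp: carrier_subgroup_generated carrier_free_Abelian_group intro: generate.incl)
  then have "B #>\<^bsub>?G\<^esub> c \<in> carrier (?G Mod B)"
    by (auto simp: FactGroup_def RCOSETS_def)
  then have "B #>\<^bsub>?G\<^esub> c = B"
    using triv by (auto simp: trivial_group_def FactGroup_def)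
  with in_r_coset_free [OF B, of c S Z] show ?thesis by simp
qed

lemma subgroup_ss_cycles: "subgroup (ss_cycles S d p) (free_Abelian_group (S p))"
proof
  show "inv\<^bsub>free_Abelian_group (S p)\<^esub> c \<in> ss_cycles S d p" if "c \<in> ss_cycles S d p" for c
    using that ss_boundary_diff [of d p 0 c]
    by (simp add: ss_cycles_def ss_boundary_0 del: minus_frag_cmul)
qed (auto simp: ss_cycles_def ss_boundary_add ss_boundary_0 carrier_free_Abelian_group chains_add
    simp del: carrier_free_Abelian_group_iff)

lemma bar_face_map:
  assumes f: "f \<in> hom G H" and gs: "gs \<in> bar_simplices G n" and i: "i \<le> n"
  shows "bar_face H i (map f gs) = map f (bar_face G i gs)"
proof -
  have "f (gs ! (i - 1)) \<otimes>\<^bsub>H\<^esub> f (gs ! i) = f (gs ! (i - 1) \<otimes>\<^bsub>G\<^esub> gs ! i)"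
    if "i \<noteq> 0" "i \<noteq> n"
  proof -
    have "gs ! (i - 1) \<in> carrier G" "gs ! i \<in> carrier G"
      using gs i that nth_mem [of "i - 1" gs] nth_mem [of i gs] by (auto simp: bar_simplices_def)
    then show ?thesis using hom_mult [OF f] by simp
  qed
  with gs i show ?thesis
    by (auto simp: bar_face_def bar_simplices_def map_tl map_butlast take_map drop_map)
qed

lemma ss_boundary_map:
  assumes f: "f \<in> hom G H" and c: "c \<in> chains_on (bar_simplices G n)"
  shows "ss_boundary (bar_face H) n (fmap (map f) c) = fmap (map f) (ss_boundary (bar_face G) n c)"
proof (cases "n = 0")
  case False
  have *: "(\<Sum>i\<le>n. frag_cmul ((-1) ^ i) (frag_of (bar_face H i (map f gs)))) =
      fmap (map f) (\<Sum>i\<le>n. frag_cmul ((-1) ^ i) (frag_of (bar_face G i gs)))"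
    if "gs \<in> bar_simplices G n" for gs
  proof -
    have "fmap (map f) (\<Sum>i\<le>n. frag_cmul ((-1) ^ i) (frag_of (bar_face G i gs)))
        = (\<Sum>i\<le>n. frag_cmul ((-1) ^ i) (frag_of (map f (bar_face G i gs))))"
      by (simp add: fmap_def frag_extend_sum comp_def frag_extend_cmul)
    then show ?thesis using bar_face_map [OF f that] by simp
  qed
  then show ?thesis
    using False by (simp add: ss_boundary_def fmap_frag_extend frag_extend_fmap)
      (rule frag_extend_cong [OF c], rule *)
qed (simp add: ss_boundary_def)

lemma map_bar_simplices:
  assumes "f \<in> hom G H" "c \<in> chains_on (bar_simplices G n)"
  shows "fmap (map f) c \<in> chains_on (bar_simplices H n)"
  using assms(2)
  by (rule chains_fmap) (use hom_in_carrier [OF assms(1)] in \<open>auto simp: bar_simplices_def\<close>)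

text \<open>Forgetting the point turns the action of the last letter on it into the deletion of that
  letter, the last face of the bar complex.\<close>

lemma fst_bar_P: "fmap fst (bar_P G act (gs, x)) =
    (\<Sum>i = Suc 0..length gs. frag_cmul ((-1) ^ i) (frag_of (bar_face G i gs)))"
proof (induction gs)
  case (Cons g gs)
  have 1: "fst (bar_merge G act g (gs, x)) = bar_face G (Suc 0) (g # gs)"
    by (cases gs) (auto simp: bar_merge_def bar_face_def)
  have 2: "bar_face G (Suc i) (g # gs) = g # bar_face G i gs" if "i \<in> {Suc 0..length gs}" for i
    using that by (cases i) (auto simp: bar_face_def)
  have "fmap fst (fmap (bar_cons g) (bar_P G act (gs, x))) = fmap ((#) g) (fmap fst (bar_P G act (gs, x)))"
    by (simp add: fmap_fmap bar_cons_def)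
  also have "\<dots> = (\<Sum>i = Suc 0..length gs. frag_cmul ((-1) ^ i) (frag_of (g # bar_face G i gs)))"
    unfolding Cons.IH by (simp add: fmap_def frag_extend_sum comp_def frag_extend_cmul)
  also have "\<dots> = - (\<Sum>i = Suc 0..length gs. frag_cmul ((-1) ^ Suc i) (frag_of (bar_face G (Suc i) (g # gs))))"
    unfolding sum_negf [symmetric] by (rule sum.cong) (simp_all add: 2)
  finally have "fmap fst (bar_P G act (g # gs, x)) = - frag_of (bar_face G (Suc 0) (g # gs))
      + (\<Sum>i = Suc 0..length gs. frag_cmul ((-1) ^ Suc i) (frag_of (bar_face G (Suc i) (g # gs))))"
    by (simp add: fmap_linear 1)
  also have "\<dots> = (\<Sum>i = Suc 0..length (g # gs). frag_cmul ((-1) ^ i) (frag_of (bar_face G i (g # gs))))"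
    unfolding list.size(4) add_Suc_right add_0_right
    by (subst (2) sum.atLeast_Suc_atMost) (simp_all only: sum.shift_bounds_cl_Suc_ivl, simp_all)
  finally show ?case .
qed simp

lemma fst_bar_d:
  "fmap fst (bar_d G act (gs, x)) = ss_boundary (bar_face G) (length gs) (frag_of gs)"
proof (cases gs)
  case Nil
  then show ?thesis by (simp add: bar_d_Nil ss_boundary_def)
next
  case (Cons g hs)
  have "fmap fst (bar_d G act (gs, x)) = frag_of (bar_face G 0 gs) + fmap fst (bar_P G act (gs, x))"
    by (simp add: bar_d_def fmap_linear bar_T_def Cons bar_face_def)
  also have "\<dots> = (\<Sum>i\<le>length gs. frag_cmul ((-1) ^ i) (frag_of (bar_face G i gs)))"
    unfolding fst_bar_P by (simp add: atMost_atLeast0 sum.atLeast_Suc_atMost)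
  finally show ?thesis by (simp add: ss_boundary_def Cons)
qed

lemma fst_bar_d_chain:
  assumes "c \<in> chains_on {(gs, x). length gs = n}"
  shows "fmap fst (frag_extend (bar_d G act) c) = ss_boundary (bar_face G) n (fmap fst c)"
proof -
  have "ss_boundary (bar_face G) n (fmap fst c) = frag_extend (\<lambda>t. ss_boundary (bar_face G) n (frag_of (fst t))) c"
    by (simp add: ss_boundary_def frag_extend_fmap)
  also have "\<dots> = frag_extend (\<lambda>t. fmap fst (bar_d G act t)) c"
    using assms by (rule frag_extend_cong) (auto simp: fst_bar_d)
  finally show ?thesis by (simp add: fmap_frag_extend)
qed

text \<open>The trivial action on one point makes the bar complex of the group a case of
  \<open>bar_action\<close>, where \<open>bar_d_d\<close> is available.\<close>

lemma ss_boundary_bar_closed: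
  assumes "group G" "c \<in> chains_on (bar_simplices G n)"
  shows "ss_boundary (bar_face G) n c \<in> chains_on (bar_simplices G (n - 1))"
    "ss_boundary (bar_face G) (n - 1) (ss_boundary (bar_face G) n c) = 0"
proof -
  interpret group G by fact
  interpret bar_action G "\<lambda>g x. ()" UNIV by unfold_locales auto
  let ?c = "fmap (\<lambda>gs. (gs, ())) c"
  let ?b = "frag_extend (bar_d G (\<lambda>g x. ()))"
  have c: "?c \<in> chains_on (bars n)"
    using assms(2) by (rule chains_fmap) (auto simp: bars_def bar_simplices_def)
  then have bc: "?b ?c \<in> chains_on (bars (n - 1))"
    by (rule chains_frag_extend) (rule bar_d_closed)
  have "ss_boundary (bar_face G) n c = fmap fst (?b ?c)"
    using c by (subst fst_bar_d_chain [of _ n]) (auto simp: fmap_fmap fmap_ident bars_def elim!: chains_mono)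
  moreover have "fmap fst (?b ?c) \<in> chains_on (bar_simplices G (n - 1))"
    using bc by (rule chains_fmap) (auto simp: bars_def bar_simplices_def)
  moreover have "ss_boundary (bar_face G) (n - 1) (fmap fst (?b ?c)) = 0"
  proof -
    have "?b (?b ?c) = 0"
      unfolding frag_extend_frag_extend
      by (rule frag_extend_eq_0) (use keys_chains [OF c] bar_d_d in blast)
    moreover have "ss_boundary (bar_face G) (n - 1) (fmap fst (?b ?c)) = fmap fst (?b (?b ?c))"
      using bc by (subst fst_bar_d_chain [of _ "n - 1"]) (auto simp: bars_def elim!: chains_mono)
    ultimately show ?thesis by simp
  qed
  ultimately show "ss_boundary (bar_face G) n c \<in> chains_on (bar_simplices G (n - 1))"
    "ss_boundary (bar_face G) (n - 1) (ss_boundary (bar_face G) n c) = 0" by simp_all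
qed

lemma trivial_group_homologyI:
  assumes "group G" "bar_exact n G"
  shows "trivial_group (group_homology n G)"
proof -
  let ?S = "bar_simplices G" and ?d = "bar_face G"
  let ?F = "free_Abelian_group (?S n)"
  have eq: "ss_boundaries ?S ?d n = ss_cycles ?S ?d n"
    using assms(2) ss_boundary_bar_closed [OF assms(1), of _ "Suc n"]
    by (auto simp: ss_boundaries_def ss_cycles_def bar_exact_def carrier_free_Abelian_group)
  interpret F: comm_group ?F by (rule abelian_free_Abelian_group)
  have sub: "subgroup (ss_cycles ?S ?d n) ?F" by (rule subgroup_ss_cycles)
  then have carr: "carrier (ss_cycle_group ?S ?d n) = ss_cycles ?S ?d n"
    unfolding ss_cycle_group_def by (rule subgroup.carrier_subgroup_generated_subgroup)
  interpret Z: comm_group "ss_cycle_group ?S ?d n"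
    unfolding ss_cycle_group_def by (rule F.abelian_subgroup_generated) (rule abelian_free_Abelian_group)
  have "subgroup (ss_cycles ?S ?d n) (ss_cycle_group ?S ?d n)"
    using Z.subgroup_self by (simp add: carr)
  then have "normal (ss_boundaries ?S ?d n) (ss_cycle_group ?S ?d n)"
    unfolding eq by (rule Z.subgroup_imp_normal)
  then interpret N: normal "ss_boundaries ?S ?d n" "ss_cycle_group ?S ?d n" .
  have "carrier (group_homology n G) = {ss_boundaries ?S ?d n}"
    unfolding group_homology_def ss_homology_def FactGroup_def RCOSETS_def
    using Z.coset_join2 [OF _ N.subgroup_axioms] carr eq Z.one_closed by (auto simp: carr)
  then show ?thesis
    unfolding trivial_group_def using N.factorgroup_is_group
    by (simp add: group_homology_def ss_homology_def FactGroup_def)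
qed

text \<open>The induced map is a union of cosets over all representatives of a class. As
  \<open>c\<close> is one of them, its image lies in that union, which by assumption is the group of
  boundaries.\<close>

lemma group_homology_map_trivialD:
  assumes zero: "\<And>x. x \<in> carrier (group_homology n G) \<Longrightarrow>
      group_homology_map n H f x = \<one>\<^bsub>group_homology n H\<^esub>"
    and c: "c \<in> chains_on (bar_simplices G n)" "ss_boundary (bar_face G) n c = 0"
  shows "\<exists>e \<in> chains_on (bar_simplices H (Suc n)). ss_boundary (bar_face H) (Suc n) e = fmap (map f) c"
proof -
  let ?Z = "ss_cycle_group (bar_simplices G) (bar_face G) n"
  let ?B = "ss_boundaries (bar_simplices G) (bar_face G) n"
  let ?x = "?B #>\<^bsub>?Z\<^esub> c"
  have "c \<in> carrier ?Z"
    using c by (auto simp: ss_cycle_group_def carrier_subgroup_generated ss_cycles_def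
        carrier_free_Abelian_group intro: generate.incl)
  then have "?x \<in> carrier (group_homology n G)"
    by (auto simp: group_homology_def ss_homology_def FactGroup_def RCOSETS_def)
  then have "group_homology_map n H f ?x = ss_boundaries (bar_simplices H) (bar_face H) n"
    using zero by (simp add: group_homology_def ss_homology_def FactGroup_def)
  moreover have "c \<in> ?x"
    unfolding ss_cycle_group_def by (rule in_r_coset_free) (rule zero_in_ss_boundaries)
  then have "fmap (map f) c \<in> group_homology_map n H f ?x"
    unfolding group_homology_map_def ss_homology_map_def ss_cycle_group_def
    unfolding fmap_def by (rule UN_I) (rule in_r_coset_free, rule zero_in_ss_boundaries)
  ultimately show ?thesis
    by (auto simp: ss_boundaries_def carrier_free_Abelian_group)
qed

section \<open>Transitivity, and stabilisers as copies of the unit group\<close>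

section \<open>The action of the unit group on split frames\<close>

lemma group_ring_units: "group (ring_units :: 'a::ring_1 monoid)"
proof -
  interpret monoid "\<lparr>carrier = UNIV, monoid.mult = (*), one = (1 :: 'a)\<rparr>"
    by unfold_locales (simp_all add: mult.assoc)
  show ?thesis unfolding ring_units_def by (rule units_group)
qed

lemma ring_units_simps [simp]:
  "x \<otimes>\<^bsub>ring_units\<^esub> y = x * y" "\<one>\<^bsub>ring_units\<^esub> = 1"
  by (simp_all add: ring_units_def units_of_def)

lemma ring_units_carrier: "g \<in> carrier ring_units \<longleftrightarrow> (\<exists>h. g * h = 1 \<and> h * g = 1)"
  by (auto simp: ring_units_def units_of_def Units_def)

lemma ring_units_inv:
  fixes g h :: "'a::ring_1"
  assumes "g * h = 1" "h * g = 1"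
  shows "g \<in> carrier ring_units" "inv\<^bsub>ring_units\<^esub> g = h"
proof -
  interpret group "ring_units :: 'a monoid" by (rule group_ring_units)
  show g: "g \<in> carrier ring_units" using assms ring_units_carrier by blast
  have "h \<in> carrier ring_units" using assms ring_units_carrier by blast
  with g assms show "inv\<^bsub>ring_units\<^esub> g = h" by (intro inv_equality) auto
qed

lemma ring_units_inv_mult:
  fixes g :: "'a::ring_1"
  assumes "g \<in> carrier ring_units"
  shows "g * inv\<^bsub>ring_units\<^esub> g = 1" "inv\<^bsub>ring_units\<^esub> g * g = 1"
  using assms ring_units_inv ring_units_carrier by metis+

definition unit_act :: "'a::ring_1 \<Rightarrow> ('a \<times> 'a) list \<Rightarrow> ('a \<times> 'a) list"
  where "unit_act g \<sigma> = map (lrmult g (inv\<^bsub>ring_units\<^esub> g)) \<sigma>"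

lemma bar_action_split_frames:
  "bar_action (ring_units :: 'a::ring_1 monoid) unit_act (words split_frames i)"
proof -
  interpret group "ring_units :: 'a monoid" by (rule group_ring_units)
  show ?thesis
  proof
    fix g h :: 'a and \<sigma> :: "('a \<times> 'a) list"
    assume g: "g \<in> carrier ring_units" and \<sigma>: "\<sigma> \<in> words split_frames i"
    show "unit_act g \<sigma> \<in> words split_frames i"
      using \<sigma> split_frames_unit [OF ring_units_inv_mult [OF g]] by (auto simp: unit_act_def words_def)
    assume h: "h \<in> carrier ring_units"
    show "unit_act (g \<otimes>\<^bsub>ring_units\<^esub> h) \<sigma> = unit_act g (unit_act h \<sigma>)"
      using inv_mult_group [OF g h] by (simp add: unit_act_def lrmult_def mult.assoc)
  next
    fix \<sigma> :: "('a \<times> 'a) list"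
    show "unit_act \<one>\<^bsub>ring_units\<^esub> \<sigma> = \<sigma>"
      using inv_one by (auto simp: unit_act_def prod_eq_iff intro!: map_idI)
  qed
qed

text \<open>The stabiliser for \<open>unit_act\<close> is written without inverses: its elements are
  the identity on the span of \<open>\<sigma>\<close> and preserve the complement.\<close>

definition frame_stab :: "('a::ring_1 \<times> 'a) list \<Rightarrow> 'a set"
  where "frame_stab \<sigma> = {g \<in> carrier ring_units. \<forall>p\<in>set \<sigma>. g * fst p = fst p \<and> snd p * g = snd p}"

lemma frame_stab_iff:
  assumes "g \<in> carrier ring_units"
  shows "unit_act g \<sigma> = \<sigma> \<longleftrightarrow> g \<in> frame_stab \<sigma>"
proof -
  note inv = ring_units_inv_mult [OF assms]
  have "snd p * inv\<^bsub>ring_units\<^esub> g = snd p \<longleftrightarrow> snd p * g = snd p" for p :: "'a \<times> 'a"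
    using inv by (metis mult.assoc mult.right_neutral)
  then show ?thesis
    using assms by (auto simp: unit_act_def frame_stab_def list_eq_iff_nth_eq prod_eq_iff all_set_conv_all_nth)
qed

lemma orth_nth:
  assumes "orth \<sigma>" "j < length \<sigma>" "k < length \<sigma>"
  shows "snd (\<sigma> ! j) * fst (\<sigma> ! k) = (if j = k then 1 else 0)"
proof -
  have "snd (\<sigma> ! j) * fst (\<sigma> ! k) = 0 \<and> snd (\<sigma> ! k) * fst (\<sigma> ! j) = 0"
    if "j < k" "k < length \<sigma>" for j k
    using assms(1) that by (auto simp: orth_def sorted_wrt_iff_nth_less)
  with assms show ?thesis
    by (cases j k rule: linorder_cases) (auto simp: orth_def)
qed

text \<open>This takes the vectors of \<open>\<sigma>\<close> to those of \<open>\<tau>\<close> and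
  one complement to the other. Both complements are copies of A, so it is invertible, with the
  transporter in the other direction as inverse.\<close>

definition transporter ::
  "('a::ring_1 \<times> 'a) list \<Rightarrow> ('a \<times> 'a) list \<Rightarrow> 'a \<Rightarrow> 'a \<Rightarrow> 'a"
  where "transporter \<sigma> \<tau> \<gamma> \<beta> = (\<Sum>j<length \<sigma>. fst (\<tau> ! j) * snd (\<sigma> ! j)) + \<gamma> * \<beta>"

lemma transporter:
  assumes \<sigma>: "orth \<sigma>" "compl \<sigma> \<alpha> \<beta>" and \<tau>: "orth \<tau>" "compl \<tau> \<gamma> \<delta>" and len: "length \<tau> = length \<sigma>"
  shows "k < length \<sigma> \<Longrightarrow> transporter \<sigma> \<tau> \<gamma> \<beta> * fst (\<sigma> ! k) = fst (\<tau> ! k)"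
    and "k < length \<sigma> \<Longrightarrow> snd (\<sigma> ! k) * transporter \<tau> \<sigma> \<alpha> \<delta> = snd (\<tau> ! k)"
    and "transporter \<sigma> \<tau> \<gamma> \<beta> * transporter \<tau> \<sigma> \<alpha> \<delta> = 1"
proof -
  have \<beta>\<sigma>: "\<beta> * fst (\<sigma> ! k) = 0" "snd (\<sigma> ! k) * \<alpha> = 0" if "k < length \<sigma>" for k
    using compl_orth [OF \<sigma>] that by auto
  show "transporter \<sigma> \<tau> \<gamma> \<beta> * fst (\<sigma> ! k) = fst (\<tau> ! k)" if k: "k < length \<sigma>"
  proof -
    have "transporter \<sigma> \<tau> \<gamma> \<beta> * fst (\<sigma> ! k) = (\<Sum>j<length \<sigma>. fst (\<tau> ! j) * (snd (\<sigma> ! j) * fst (\<sigma> ! k)))"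
      by (simp add: transporter_def distrib_right sum_distrib_right mult.assoc \<beta>\<sigma> k)
    also have "\<dots> = (\<Sum>j<length \<sigma>. if j = k then fst (\<tau> ! k) else 0)"
      by (rule sum.cong) (auto simp: orth_nth \<sigma> k)
    finally show ?thesis using k by simp
  qed
  show *: "snd (\<sigma> ! k) * transporter \<tau> \<sigma> \<alpha> \<delta> = snd (\<tau> ! k)" if k: "k < length \<sigma>" for k
  proof -
    have "snd (\<sigma> ! k) * transporter \<tau> \<sigma> \<alpha> \<delta> = (\<Sum>j<length \<sigma>. snd (\<sigma> ! k) * fst (\<sigma> ! j) * snd (\<tau> ! j))"
      by (simp add: transporter_def distrib_left sum_distrib_left \<beta>\<sigma> k len flip: mult.assoc)
    also have "\<dots> = (\<Sum>j<length \<sigma>. if j = k then snd (\<tau> ! k) else 0)"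
      by (rule sum.cong) (auto simp: orth_nth \<sigma> k)
    finally show ?thesis using k by simp
  qed
  have \<beta>h: "\<beta> * transporter \<tau> \<sigma> \<alpha> \<delta> = \<delta>"
    using \<sigma>(2) by (simp add: transporter_def distrib_left sum_distrib_left \<beta>\<sigma> len compl_def flip: mult.assoc)
  have "transporter \<sigma> \<tau> \<gamma> \<beta> * transporter \<tau> \<sigma> \<alpha> \<delta>
      = (\<Sum>j<length \<sigma>. fst (\<tau> ! j) * snd (\<tau> ! j)) + \<gamma> * \<delta>"
    unfolding transporter_def [of \<sigma> \<tau>] by (simp add: distrib_right sum_distrib_right mult.assoc * \<beta>h)
  then show "transporter \<sigma> \<tau> \<gamma> \<beta> * transporter \<tau> \<sigma> \<alpha> \<delta> = 1"
    using \<tau>(2) by (simp add: compl_def proj_def sum_list_sum_nth len atLeast0LessThan)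
qed

lemma split_frames_transitive:
  assumes "\<sigma> \<in> words split_frames i" "\<tau> \<in> words split_frames i"
  shows "\<exists>g \<in> carrier ring_units. unit_act g \<sigma> = \<tau>"
proof -
  obtain \<alpha> \<beta> \<gamma> \<delta> where \<sigma>: "orth \<sigma>" "compl \<sigma> \<alpha> \<beta>" and \<tau>: "orth \<tau>" "compl \<tau> \<gamma> \<delta>"
    using assms by (auto simp: words_def split_frames_def)
  have len: "length \<tau> = length \<sigma>" using assms by (simp add: words_def)
  let ?g = "transporter \<sigma> \<tau> \<gamma> \<beta>" and ?h = "transporter \<tau> \<sigma> \<alpha> \<delta>"
  note g = transporter [OF \<sigma> \<tau> len] and h = transporter [OF \<tau> \<sigma> len [symmetric]]
  note inv = ring_units_inv [OF g(3) h(3)]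
  have "unit_act ?g \<sigma> = \<tau>"
    by (rule nth_equalityI) (simp_all add: unit_act_def inv(2) len prod_eq_iff g(1,2))
  with inv(1) show ?thesis by blast
qed

lemma split_frames_shapiro:
  assumes \<sigma>: "\<sigma> \<in> words split_frames i"
    and z: "z \<in> chains_on (bar_action.bars ring_units (words split_frames i) n)"
      "frag_extend (bar_d ring_units unit_act) z = 0"
  shows "\<exists>y0 \<in> chains_on {(gs, x). length gs = n \<and> set gs \<subseteq> frame_stab \<sigma> \<and> x = \<sigma>}.
    \<exists>y \<in> chains_on (bar_action.bars ring_units (words split_frames i) (Suc n)).
      z = y0 + frag_extend (bar_d ring_units unit_act) y"
proof -
  interpret bar_action ring_units unit_act "words split_frames i" by (rule bar_action_split_frames)
  obtain t where t: "\<And>\<tau>. \<tau> \<in> words split_frames i \<Longrightarrow> t \<tau> \<in> carrier ring_units \<and> unit_act (t \<tau>) \<sigma> = \<tau>"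
    using split_frames_transitive [OF \<sigma>] by metis
  interpret transitive_bar_action ring_units unit_act "words split_frames i" \<sigma> t
    by unfold_locales (simp_all add: \<sigma> t)
  have "stabiliser = frame_stab \<sigma>"
    using frame_stab_iff by (auto simp: stabiliser_def frame_stab_def)
  with shapiro [OF z] show ?thesis by simp
qed

text \<open>The stabiliser is the automorphism group of the complement, a copy of A. Compression to
  the complement, \<open>\<kappa>\<close>, and extension by the identity on the span,
  \<open>\<epsilon>\<close>, identify it with the unit group, where the filling is found.\<close>

lemma frame_stab_boundary:
  assumes \<sigma>: "\<sigma> \<in> split_frames" and exact: "bar_exact k (ring_units :: 'a::ring_1 monoid)"
    and c: "c \<in> chains_on {gs. length gs = k \<and> set gs \<subseteq> frame_stab \<sigma>}"
      "ss_boundary (bar_face (ring_units :: 'a monoid)) k c = 0"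
  shows "\<exists>e \<in> chains_on {gs. length gs = Suc k \<and> set gs \<subseteq> frame_stab \<sigma>}.
    ss_boundary (bar_face (ring_units :: 'a monoid)) (Suc k) e = c"
proof -
  obtain \<alpha> \<beta> where o: "orth \<sigma>" and co: "compl \<sigma> \<alpha> \<beta>" using \<sigma> by (auto simp: split_frames_def)
  have \<beta>\<alpha>: "\<beta> * \<alpha> = 1" "\<And>x. \<beta> * (\<alpha> * x) = x" and \<alpha>\<beta>: "\<alpha> * \<beta> = 1 - proj \<sigma>"
    using co by (auto simp: compl_def simp flip: mult.assoc)
  define S :: "'a monoid" where "S = ring_units\<lparr>carrier := frame_stab \<sigma>\<rparr>"
  have S: "bar_simplices S n = {gs. length gs = n \<and> set gs \<subseteq> frame_stab \<sigma>}" "bar_face S = bar_face ring_units" for n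
    by (auto simp: S_def bar_simplices_def bar_face_def fun_eq_iff)
  have proj: "g * proj \<sigma> = proj \<sigma>" "proj \<sigma> * g = proj \<sigma>" if "g \<in> frame_stab \<sigma>" for g
  proof -
    have "fst p = g * fst p" "snd p = snd p * g" if "p \<in> set \<sigma>" for p
      using \<open>g \<in> frame_stab \<sigma>\<close> that by (auto simp: frame_stab_def)
    then show "g * proj \<sigma> = proj \<sigma>" "proj \<sigma> * g = proj \<sigma>"
      unfolding proj_def sum_list_const_mult [symmetric] sum_list_mult_const [symmetric]
      by (auto intro!: arg_cong [of _ _ sum_list] map_cong simp flip: mult.assoc)
        (auto intro!: arg_cong [of _ _ sum_list] map_cong simp: mult.assoc)
  qed
  define \<kappa> where "\<kappa> g = \<beta> * g * \<alpha>" for g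
  define \<epsilon> where "\<epsilon> u = proj \<sigma> + \<alpha> * u * \<beta>" for u
  have proj\<alpha>: "proj \<sigma> * \<alpha> = 0" "\<beta> * proj \<sigma> = 0" using compl_proj [OF o co] by auto
  have prpr: "proj \<sigma> * proj \<sigma> = proj \<sigma>"
  proof -
    have "(1 - proj \<sigma>) * proj \<sigma> = 0" unfolding \<alpha>\<beta> [symmetric] by (simp add: mult.assoc proj\<alpha>)
    then show ?thesis by (simp add: left_diff_distrib)
  qed
  have \<kappa>_mult: "\<kappa> (g * h) = \<kappa> g * \<kappa> h" if "g \<in> frame_stab \<sigma>" for g h
  proof -
    have "\<kappa> g * \<kappa> h = \<beta> * (g * (\<alpha> * \<beta>)) * h * \<alpha>" by (simp add: \<kappa>_def mult.assoc)
    also have "\<dots> = \<kappa> (g * h)"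
      by (simp add: \<alpha>\<beta> right_diff_distrib proj [OF that] left_diff_distrib proj\<alpha> \<kappa>_def mult.assoc)
    finally show ?thesis by simp
  qed
  have stab_inv: "\<exists>h \<in> frame_stab \<sigma>. g * h = 1 \<and> h * g = 1" if g: "g \<in> frame_stab \<sigma>" for g
  proof -
    obtain h where h: "g * h = 1" "h * g = 1" using g by (auto simp: frame_stab_def ring_units_carrier)
    have "h * fst p = fst p \<and> snd p * h = snd p" if "p \<in> set \<sigma>" for p
    proof -
      have "g * fst p = fst p" "snd p * g = snd p"
        using \<open>g \<in> frame_stab \<sigma>\<close> that by (auto simp: frame_stab_def)
      then show ?thesis using h by (metis mult.assoc mult.left_neutral mult.right_neutral)
    qed
    with h show ?thesis by (auto simp: frame_stab_def ring_units_carrier)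
  qed
  have \<kappa>: "\<kappa> \<in> hom S ring_units"
  proof (rule homI)
    fix g assume "g \<in> carrier S"
    then have g: "g \<in> frame_stab \<sigma>" by (simp add: S_def)
    then obtain h where h: "h \<in> frame_stab \<sigma>" "g * h = 1" "h * g = 1" using stab_inv by blast
    then have "\<kappa> g * \<kappa> h = 1" "\<kappa> h * \<kappa> g = 1"
      using \<kappa>_mult [OF g, of h] \<kappa>_mult [OF h(1), of g] \<beta>\<alpha> by (simp_all add: \<kappa>_def)
    then show "\<kappa> g \<in> carrier ring_units" using ring_units_carrier by blast
  qed (simp add: S_def \<kappa>_mult)
  have \<epsilon>_mult: "\<epsilon> (u * v) = \<epsilon> u * \<epsilon> v" for u v
  proof -
    have "\<epsilon> u * \<epsilon> v = proj \<sigma> * proj \<sigma> + (proj \<sigma> * \<alpha>) * v * \<beta> + \<alpha> * u * (\<beta> * proj \<sigma>) + \<alpha> * u * (\<beta> * \<alpha>) * v * \<beta>"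
      by (simp add: \<epsilon>_def algebra_simps)
    then show ?thesis by (simp add: proj\<alpha> prpr \<beta>\<alpha> \<epsilon>_def mult.assoc)
  qed
  have "\<epsilon> 1 = 1" using \<alpha>\<beta> by (simp add: \<epsilon>_def)
  have \<epsilon>: "\<epsilon> \<in> hom ring_units S"
  proof (rule homI)
    fix u :: 'a assume "u \<in> carrier ring_units"
    then obtain v where "u * v = 1" "v * u = 1" using ring_units_carrier by blast
    then have "\<epsilon> u * \<epsilon> v = 1" "\<epsilon> v * \<epsilon> u = 1" using \<open>\<epsilon> 1 = 1\<close> by (simp_all flip: \<epsilon>_mult)
    then have "\<epsilon> u \<in> carrier ring_units" using ring_units_carrier by blast
    moreover have "\<epsilon> u * fst p = fst p \<and> snd p * \<epsilon> u = snd p" if "p \<in> set \<sigma>" for p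
      using compl_orth [OF o co that] proj_fst [OF o that] snd_proj [OF o that]
      by (simp add: \<epsilon>_def distrib_left distrib_right mult.assoc) (simp flip: mult.assoc)
    ultimately show "\<epsilon> u \<in> carrier S" by (simp add: S_def frame_stab_def)
  qed (simp add: S_def \<epsilon>_mult)
  have \<epsilon>\<kappa>: "\<epsilon> (\<kappa> g) = g" if "g \<in> frame_stab \<sigma>" for g
  proof -
    have "\<epsilon> (\<kappa> g) = proj \<sigma> + (\<alpha> * \<beta>) * g * (\<alpha> * \<beta>)" by (simp add: \<epsilon>_def \<kappa>_def mult.assoc)
    also have "\<dots> = g"
      by (simp add: \<alpha>\<beta> left_diff_distrib right_diff_distrib proj [OF that] prpr)
    finally show ?thesis .
  qed
  have cS: "c \<in> chains_on (bar_simplices S k)" using c(1) by (simp add: S)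
  have "fmap (map \<kappa>) c \<in> chains_on (bar_simplices ring_units k)"
    using \<kappa> cS by (rule map_bar_simplices)
  moreover have "ss_boundary (bar_face ring_units) k (fmap (map \<kappa>) c) = 0"
    using ss_boundary_map [OF \<kappa> cS] c(2) by (simp add: S)
  ultimately obtain e where e: "e \<in> chains_on (bar_simplices ring_units (Suc k))"
      "ss_boundary (bar_face ring_units) (Suc k) e = fmap (map \<kappa>) c"
    using exact unfolding bar_exact_def by blast
  have "fmap (map \<epsilon>) e \<in> chains_on (bar_simplices S (Suc k))"
    using \<epsilon> e(1) by (rule map_bar_simplices)
  moreover have "ss_boundary (bar_face ring_units) (Suc k) (fmap (map \<epsilon>) e) = c"
  proof -
    have "ss_boundary (bar_face ring_units) (Suc k) (fmap (map \<epsilon>) e) = fmap (map \<epsilon>) (fmap (map \<kappa>) c)"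
      using ss_boundary_map [OF \<epsilon> e(1)] e(2) by (simp add: S)
    also have "\<dots> = c"
      unfolding fmap_fmap
    proof (rule fmap_ident)
      fix gs assume "gs \<in> Poly_Mapping.keys c"
      then have "set gs \<subseteq> frame_stab \<sigma>" using keys_chains [OF c(1)] by blast
      then show "map \<epsilon> (map \<kappa> gs) = gs" by (auto simp: \<epsilon>\<kappa> intro!: map_idI)
    qed
    finally show ?thesis .
  qed
  ultimately show ?thesis by (auto simp: S)
qed

text \<open>The letters fix \<open>x0\<close>, so the point never changes and is only carried along
  by the boundary.\<close>

lemma bar_d_fixed:
  assumes "c \<in> chains_on {(gs, x). length gs = n \<and> set gs \<subseteq> {g. act g x0 = x0} \<and> x = x0}"
  shows "frag_extend (bar_d G act) c = fmap (\<lambda>gs. (gs, x0)) (ss_boundary (bar_face G) n (fmap fst c))"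
proof -
  have P: "bar_P G act (gs, x0) \<in> chains_on {s. snd s = x0}" if "set gs \<subseteq> {g. act g x0 = x0}" for gs
    using that
  proof (induction gs)
    case (Cons g gs)
    then have "snd (bar_merge G act g (gs, x0)) = x0"
      by (auto simp: bar_merge_def split: list.split)
    moreover have "fmap (bar_cons g) (bar_P G act (gs, x0)) \<in> chains_on {s. snd s = x0}"
      by (rule chains_fmap [OF Cons.IH]) (use Cons.prems in \<open>auto simp: bar_cons_def\<close>)
    ultimately show ?case by (simp add: chains_diff chains_minus)
  qed simp
  have "bar_d G act t \<in> chains_on {s. snd s = x0}"
    if "t \<in> {(gs, x). length gs = n \<and> set gs \<subseteq> {g. act g x0 = x0} \<and> x = x0}" for t
    using that P unfolding bar_d_def
    by (auto intro!: chains_add simp: bar_T_def split: list.split)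
  with assms have *: "frag_extend (bar_d G act) c \<in> chains_on {s. snd s = x0}"
    by (rule chains_frag_extend)
  have "frag_extend (bar_d G act) c = fmap (\<lambda>gs. (gs, x0)) (fmap fst (frag_extend (bar_d G act) c))"
    unfolding fmap_fmap
    by (rule fmap_ident [symmetric]) (use keys_chains [OF *] in \<open>auto simp: prod_eq_iff\<close>)
  also have "fmap fst (frag_extend (bar_d G act) c) = ss_boundary (bar_face G) n (fmap fst c)"
    using assms by (intro fst_bar_d_chain) (auto elim!: chains_mono)
  finally show ?thesis .
qed

text \<open>There is one term per letter, with alternating signs starting with plus. This computes
  the maps between the degree 0 homology groups of neighbouring columns.\<close>

lemma augmentation_bdry: "fmap (\<lambda>_. ()) (bdry \<sigma>) = (if odd (length \<sigma>) then frag_of () else 0)"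
  by (induction \<sigma>) (simp_all add: fmap_linear fmap_fmap)

lemma augmentation_bar_d:
  assumes "v \<in> chains_on {(gs, x). length gs = Suc 0}"
  shows "fmap (\<lambda>_. ()) (frag_extend (bar_d G act) v) = 0"
  unfolding fmap_frag_extend
proof (rule frag_extend_eq_0)
  fix t assume "t \<in> Poly_Mapping.keys v"
  then obtain g x where "t = ([g], x)"
    using keys_chains [OF assms] by (cases t) (auto simp: length_Suc_conv)
  then show "fmap (\<lambda>_. ()) (bar_d G act t) = 0"
    by (simp add: bar_d_def bar_T_def fmap_linear bar_merge_def)
qed

section \<open>The spectral sequence argument for the unit group\<close>

context leavitt
begin

text \<open>The double complex of bars with values in split frames: its rows are exact, and by Shapiro's
  lemma its columns compute the homology of the stabilisers of split frames, each of which is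
  isomorphic to the whole unit group. Therefore every cycle of degree \<open>n\<close> comes from the stabiliser
  of a split frame of length 1.\<close>

lemma bar_exact_ring_units_step:
  assumes exact: "\<And>c. exact_words (split_frames :: ('a \<times> 'a) list set) c"
    and IH: "\<And>k. 0 < k \<Longrightarrow> k < n \<Longrightarrow> bar_exact k (ring_units :: 'a monoid)" and n: "n > 0"
    and stab: "\<And>c. c \<in> chains_on {gs. length gs = n \<and> set gs \<subseteq> frame_stab [(s2, t2)]} \<Longrightarrow>
      ss_boundary (bar_face (ring_units :: 'a monoid)) n c = 0 \<Longrightarrow>
      \<exists>e \<in> chains_on (bar_simplices (ring_units :: 'a monoid) (Suc n)). ss_boundary (bar_face ring_units) (Suc n) e = c"
  shows "bar_exact n (ring_units :: 'a monoid)"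
  unfolding bar_exact_def
proof (intro ballI impI)
  let ?U = "ring_units :: 'a monoid"
  define A :: "'a list \<times> ('a \<times> 'a) list \<Rightarrow> _" where "A t = fmap (Pair (fst t)) (bdry (snd t))" for t
  let ?a = "frag_extend A" and ?b = "frag_extend (bar_d ?U unit_act)"
  define M where "M i = bar_action.bars ?U (words (split_frames :: ('a \<times> 'a) list set) i)" for i
  interpret bar_action ?U unit_act "words split_frames i" for i by (rule bar_action_split_frames)
  have M: "M i j = {(gs, \<sigma>). length gs = j \<and> set gs \<subseteq> carrier ?U \<and> \<sigma> \<in> words split_frames i}" for i j
    unfolding M_def by (rule bar_action.bars_def [OF bar_action_split_frames])
  have A: "A t \<in> chains_on (M i j)" if "t \<in> M (Suc i) j" for t i j
  proof -
    have "snd t \<in> words split_frames (Suc i)" using that by (auto simp: M)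
    then show ?thesis
      unfolding A_def using that
      by (intro chains_fmap [OF bdry_chains [OF downclosed_split_frames]]) (auto simp: M)
  qed
  have B: "bar_d ?U unit_act t \<in> chains_on (M i j)" if "t \<in> M i (Suc j)" for t i j
    using bar_d_closed [of t i "Suc j"] that by (simp add: M_def)
  have AA: "?a (?a x) = 0" for x
    by (simp add: frag_extend_frag_extend A_def frag_extend_fmap bdry_bdry flip: fmap_frag_extend)
  have BB: "?b (?b x) = 0" if "x \<in> chains_on (M i j)" for x i j
    unfolding frag_extend_frag_extend
  proof (rule frag_extend_eq_0)
    fix t assume "t \<in> Poly_Mapping.keys x"
    then have "t \<in> bars i j" using keys_chains [OF that] by (simp add: M_def)
    then show "?b (bar_d ?U unit_act t) = 0" by (rule bar_d_d)
  qed
  \<comment> \<open>Units act letter by letter on split frames, so they commute with the deletion of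
    letters.\<close>
  have AB: "?a (?b x) = ?b (?a x)" for x
  proof -
    have A_cons: "A (bar_cons g t) = fmap (bar_cons g) (A t)" for g t
      by (simp add: A_def bar_cons_def fmap_fmap)
    have A_merge: "A (bar_merge ?U unit_act g t) = fmap (bar_merge ?U unit_act g) (A t)" for g t
      by (simp add: A_def bar_merge_def fmap_fmap unit_act_def bdry_map split: list.split)
    have P: "?a (bar_P ?U unit_act t) = frag_extend (bar_P ?U unit_act) (A t)" for t
    proof (induction t rule: bar_induct)
      case (Nil x)
      show ?case by (simp add: A_def frag_extend_fmap)
    next
      case (Cons g t)
      have "?a (fmap (bar_cons g) c) = fmap (bar_cons g) (?a c)" for c
        by (simp add: frag_extend_fmap A_cons fmap_frag_extend)
      moreover have "frag_extend (bar_P ?U unit_act) (fmap (bar_cons g) c)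
          = - fmap (bar_merge ?U unit_act g) c - fmap (bar_cons g) (frag_extend (bar_P ?U unit_act) c)" for c
        by (simp add: frag_extend_fmap bar_P_cons frag_extend_fun_diff frag_extend_fun_minus fmap_frag_extend)
          (simp add: fmap_def)
      ultimately show ?case
        by (simp add: bar_P_cons A_cons frag_linear A_merge Cons)
    qed
    have T: "?a (bar_T t) = frag_extend bar_T (A t)" for t
    proof (cases t rule: bar_cases)
      case (Nil x)
      then show ?thesis by (simp add: A_def bar_T_def frag_extend_fmap)
    next
      case (Cons g s)
      then show ?thesis by (simp add: A_cons bar_T_cons frag_extend_fmap)
    qed
    show ?thesis
      by (simp add: frag_extend_frag_extend bar_d_def frag_linear P T frag_extend_fun_add)
        (simp add: bar_d_def [abs_def] frag_extend_fun_add frag_extend_frag_extend)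
  qed
  have exact_A: "\<exists>y \<in> chains_on (M (Suc i) j). ?a y = z"
    if "z \<in> chains_on (M i j)" "?a z = 0" for z i j
  proof (rule fibrewise_exact [where \<iota> = Pair and \<pi> = fst and \<rho> = snd and d = bdry and D = A, OF _ _ _ _ _ that])
    fix gs :: "'a list" and z assume z: "z \<in> chains_on {w. (gs, w) \<in> M i j}" "frag_extend bdry z = 0"
    show "\<exists>y \<in> chains_on {w. (gs, w) \<in> M (Suc i) j}. frag_extend bdry y = z"
    proof (cases "length gs = j \<and> set gs \<subseteq> carrier ?U")
      case True
      with z exact [of i] show ?thesis by (simp add: M exact_words_def)
    next
      case False
      then have "{w. (gs, w) \<in> M i j} = {}" by (auto simp: M)
      with z(1) show ?thesis by (intro bexI [of _ 0]) (auto simp: chains_on_def)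
    qed
  qed (auto simp: A_def)
  have frame: "\<exists>\<sigma>. \<sigma> \<in> words (split_frames :: ('a \<times> 'a) list set) i" for i
    using ex_split_frame [of i] by (auto simp: words_def)
  have fixed: "?b c = fmap (\<lambda>gs. (gs, \<sigma>)) (ss_boundary (bar_face ?U) j (fmap fst c))"
    if "c \<in> chains_on {(gs, x). length gs = j \<and> set gs \<subseteq> frame_stab \<sigma> \<and> x = \<sigma>}" for c j \<sigma>
    using that by (intro bar_d_fixed) (auto elim!: chains_mono simp: frame_stab_def frame_stab_iff)
  \<comment> \<open>By Shapiro's lemma a cycle is homologous to one of a stabiliser, and
    \<open>IH\<close> fills it there because stabilisers are copies of the unit group.\<close>
  have exact_B: "\<exists>y \<in> chains_on (M i (Suc j)). ?b y = z"
    if z: "z \<in> chains_on (M i j)" "?b z = 0" and j: "0 < j" "j < n" for z i j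
  proof -
    obtain \<sigma> :: "('a \<times> 'a) list" where \<sigma>: "\<sigma> \<in> words split_frames i" using frame by blast
    obtain y0 y where y0: "y0 \<in> chains_on {(gs, x). length gs = j \<and> set gs \<subseteq> frame_stab \<sigma> \<and> x = \<sigma>}"
        and y: "y \<in> chains_on (M i (Suc j))" and eq: "z = y0 + ?b y"
      using split_frames_shapiro [OF \<sigma>] z unfolding M_def by blast
    let ?\<iota> = "fmap (\<lambda>gs. (gs, \<sigma>))"
    have y0_eq: "y0 = ?\<iota> (fmap fst y0)"
      unfolding fmap_fmap by (rule fmap_ident [symmetric]) (use keys_chains [OF y0] in auto)
    have c: "fmap fst y0 \<in> chains_on {gs. length gs = j \<and> set gs \<subseteq> frame_stab \<sigma>}"
      using y0 by (rule chains_fmap) auto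
    have "?b y0 = 0" using z(2) eq BB [OF y] by (simp add: frag_linear)
    then have "fmap fst (?\<iota> (ss_boundary (bar_face ?U) j (fmap fst y0))) = 0"
      using fixed [OF y0] by simp
    then have "ss_boundary (bar_face ?U) j (fmap fst y0) = 0"
      by (simp add: fmap_fmap fmap_ident)
    then obtain e where e: "e \<in> chains_on {gs. length gs = Suc j \<and> set gs \<subseteq> frame_stab \<sigma>}"
        "ss_boundary (bar_face ?U) (Suc j) e = fmap fst y0"
      using frame_stab_boundary [OF _ IH [OF j] c] \<sigma> by (auto simp: words_def)
    have e': "?\<iota> e \<in> chains_on {(gs, x). length gs = Suc j \<and> set gs \<subseteq> frame_stab \<sigma> \<and> x = \<sigma>}"
      using e(1) by (rule chains_fmap) auto
    have "?b (?\<iota> e) = y0"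
      using fixed [OF e'] e(2) y0_eq by (simp add: fmap_fmap fmap_ident)
    moreover have "?\<iota> e \<in> chains_on (M i (Suc j))"
      using e' by (rule chains_mono) (use \<sigma> in \<open>auto simp: M frame_stab_def\<close>)
    ultimately show ?thesis
      using y eq by (intro bexI [of _ "?\<iota> e + y"]) (auto simp: frag_linear intro: chains_add)
  qed
  \<comment> \<open>In degree 0 the homology of a column is detected by the augmentation, so
    \<open>y\<close> is first changed by an \<open>a\<close>-boundary into a chain of augmentation
    0.\<close>
  have exact_B_0: "\<exists>x \<in> chains_on (M (Suc n) (Suc 0)). ?a (?b x) = ?a y"
    if y: "y \<in> chains_on (M (Suc n) 0)" and v: "v \<in> chains_on (M n (Suc 0))" and eq: "?a y = ?b v" for y v
  proof -
    let ?aug = "fmap (\<lambda>_. ())"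
    have aug_A: "?aug (?a c) = (if odd i then ?aug c else 0)" if "c \<in> chains_on (M i j)" for c i j
    proof -
      have "?aug (?a c) = frag_extend (\<lambda>_. if odd i then frag_of () else 0) c"
        unfolding fmap_frag_extend using that
        by (rule frag_extend_cong) (auto simp: A_def fmap_fmap augmentation_bdry M words_def)
      then show ?thesis by (simp add: fmap_def)
    qed
    have "?aug (?b v) = 0"
      using v by (intro augmentation_bar_d) (auto elim!: chains_mono simp: M)
    with eq have aug_y: "?aug (?a y) = 0" by simp
    have "\<exists>y' \<in> chains_on (M (Suc n) 0). ?aug y' = 0 \<and> ?a y' = ?a y"
    \<comment> \<open>If \<open>n + 1\<close> is odd, \<open>?a\<close> preserves the augmentation
      of \<open>y\<close>, which is therefore 0. If it is even, \<open>?a\<close> preserves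
      augmentations one column further, and a multiple of a single frame of length
      \<open>n + 2\<close> provides the correction.\<close>
    proof (cases "odd (Suc n)")
      case True
      with aug_A [OF y] aug_y y show ?thesis by auto
    next
      case False
      obtain \<tau> :: "('a \<times> 'a) list" where \<tau>: "\<tau> \<in> words split_frames (Suc (Suc n))" using frame by blast
      let ?q = "fmap (\<lambda>_. ([], \<tau>)) (?aug y)"
      have q: "?q \<in> chains_on (M (Suc (Suc n)) 0)"
        by (rule chains_fmap [of _ UNIV]) (use \<tau> in \<open>auto simp: M chains_on_def\<close>)
      have "?aug (?a ?q) = ?aug y"
        using aug_A [OF q] False by (simp add: fmap_fmap)
      moreover have "?a ?q \<in> chains_on (M (Suc n) 0)"
        using q A by (rule chains_frag_extend)
      ultimately show ?thesis
        using y by (intro bexI [of _ "y - ?a ?q"]) (auto simp: fmap_linear frag_linear AA intro: chains_diff)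
    qed
    then obtain y' where y': "y' \<in> chains_on (M (Suc n) 0)" "?aug y' = 0" "?a y' = ?a y" by blast
    have "?b y' = 0"
    proof (rule frag_extend_eq_0)
      fix t assume "t \<in> Poly_Mapping.keys y'"
      then have "t \<in> M (Suc n) 0" by (rule keys_chains [OF y'(1)])
      then show "bar_d ?U unit_act t = 0" by (auto simp: M bar_d_Nil)
    qed
    obtain \<sigma> :: "('a \<times> 'a) list" where \<sigma>: "\<sigma> \<in> words split_frames (Suc n)" using frame by blast
    obtain y0 x where y0: "y0 \<in> chains_on {(gs, x). length gs = 0 \<and> set gs \<subseteq> frame_stab \<sigma> \<and> x = \<sigma>}"
        and x: "x \<in> chains_on (M (Suc n) (Suc 0))" and eq': "y' = y0 + ?b x"
      using split_frames_shapiro [OF \<sigma>] y'(1) \<open>?b y' = 0\<close> unfolding M_def by blast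
    have "?aug (?b x) = 0"
      using x by (intro augmentation_bar_d) (auto elim!: chains_mono simp: M)
    then have "?aug y0 = 0" using y'(2) eq' by (simp add: fmap_linear)
    \<comment> \<open>In degree 0 the chain \<open>y0\<close> is a multiple of one bar, hence
      determined by its augmentation.\<close>
    moreover have "y0 = fmap (\<lambda>_. ([], \<sigma>)) (?aug y0)"
      unfolding fmap_fmap by (rule fmap_ident [symmetric]) (use keys_chains [OF y0] in auto)
    ultimately have "y0 = 0" by simp
    with eq' x y'(3) show ?thesis by (intro bexI [of _ x]) auto
  qed
  fix c assume c: "c \<in> chains_on (bar_simplices ?U n)" "ss_boundary (bar_face ?U) n c = 0"
  let ?z = "fmap (\<lambda>gs. (gs, [] :: ('a \<times> 'a) list)) c"
  have "\<exists>y \<in> chains_on (M (Suc 0) n). ?b y = 0 \<and> ?a y = ?z"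
  proof (rule zigzag)
    fix i j x assume "x \<in> chains_on (M (Suc i) j)"
    then show "?a x \<in> chains_on (M i j)" using A by (rule chains_frag_extend)
  next
    fix i j x assume "x \<in> chains_on (M i (Suc j))"
    then show "?b x \<in> chains_on (M i j)" using B by (rule chains_frag_extend)
  next
    show "?z \<in> chains_on (M 0 n)"
      using c(1) by (rule chains_fmap) (use frame [of 0] in \<open>auto simp: words_def M bar_simplices_def\<close>)
    show "?a ?z = 0" by (simp add: frag_extend_fmap A_def)
    have "?z \<in> chains_on {(gs, x). length gs = n \<and> set gs \<subseteq> frame_stab [] \<and> x = []}"
      using c(1) by (rule chains_fmap) (auto simp: frame_stab_def bar_simplices_def)
    from fixed [OF this] have "?b ?z = fmap (\<lambda>gs. (gs, [])) (ss_boundary (bar_face ?U) n (fmap fst ?z))" .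
    moreover have "fmap fst ?z = c" by (simp add: fmap_fmap fmap_ident)
    ultimately show "?b ?z = 0" by (simp add: c(2))
  qed (use n exact_A exact_B exact_B_0 AA BB AB in \<open>auto simp: frag_linear intro: chains_diff\<close>)
  then obtain y where y: "y \<in> chains_on (M (Suc 0) n)" "?b y = 0" "?a y = ?z" by blast
  have \<sigma>: "[(s2, t2)] \<in> words split_frames (Suc 0)" by (simp add: words_def base_split_frame)
  \<comment> \<open>Transitivity allows any frame of length 1 here; the base frame is the one whose
    stabiliser inclusion is compared with \<open>GL_incl\<close>.\<close>
  obtain y0 x where y0: "y0 \<in> chains_on {(gs, x). length gs = n \<and> set gs \<subseteq> frame_stab [(s2, t2)] \<and> x = [(s2, t2)]}"
      and x: "x \<in> chains_on (M (Suc 0) (Suc n))" and eq: "y = y0 + ?b x"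
    using split_frames_shapiro [OF \<sigma>] y(1,2) unfolding M_def by blast
  have "c = fmap fst (?a y)" by (simp add: y(3) fmap_fmap fmap_ident)
  also have "\<dots> = frag_extend (\<lambda>t. frag_of (fst t)) y"
    unfolding fmap_frag_extend using y(1)
    by (rule frag_extend_cong) (auto simp: A_def M words_def length_Suc_conv)
  also have "\<dots> = fmap fst y0 + fmap fst (?b x)" by (simp add: eq frag_linear fmap_def)
  also have "fmap fst (?b x) = ss_boundary (bar_face ?U) (Suc n) (fmap fst x)"
    using x by (intro fst_bar_d_chain) (auto elim!: chains_mono simp: M)
  finally have c_eq: "c = fmap fst y0 + ss_boundary (bar_face ?U) (Suc n) (fmap fst x)" .
  have x': "fmap fst x \<in> chains_on (bar_simplices ?U (Suc n))"
    using x by (rule chains_fmap) (auto simp: M bar_simplices_def)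
  have "ss_boundary (bar_face ?U) n (fmap fst y0) = 0"
    using c(2) ss_boundary_bar_closed(2) [OF group_ring_units x']
    by (simp add: c_eq ss_boundary_add)
  moreover have "fmap fst y0 \<in> chains_on {gs. length gs = n \<and> set gs \<subseteq> frame_stab [(s2, t2)]}"
    using y0 by (rule chains_fmap) auto
  ultimately obtain e where "e \<in> chains_on (bar_simplices ?U (Suc n))"
      "ss_boundary (bar_face ?U) (Suc n) e = fmap fst y0"
    using stab by blast
  with x' c_eq show "\<exists>e \<in> chains_on (bar_simplices ?U (Suc n)). ss_boundary (bar_face ?U) (Suc n) e = c"
    by (intro bexI [of _ "e + fmap fst x"]) (auto simp: ss_boundary_add intro: chains_add)
qed

end

section \<open>Isomorphisms of A with free modules of positive rank\<close>

section \<open>Coordinates\<close>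

text \<open>The sum of the \<open>\<alpha> i\<close> times the entries of a column is an isomorphism
  from A^r to A, and the \<open>\<beta> i\<close> are the components of its inverse.\<close>

definition coord_system :: "nat \<Rightarrow> (nat \<Rightarrow> 'a::ring_1) \<Rightarrow> (nat \<Rightarrow> 'a) \<Rightarrow> bool"
  where "coord_system r \<alpha> \<beta> \<longleftrightarrow> (\<forall>i<r. \<forall>j<r. \<beta> i * \<alpha> j = (if i = j then 1 else 0)) \<and>
    (\<Sum>i<r. \<alpha> i * \<beta> i) = 1"

lemma coord_systemD:
  assumes "coord_system r \<alpha> \<beta>"
  shows "i < r \<Longrightarrow> j < r \<Longrightarrow> \<beta> i * \<alpha> j = (if i = j then 1 else 0)" "(\<Sum>i<r. \<alpha> i * \<beta> i) = 1"
  using assms by (auto simp: coord_system_def)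

lemma coord_sum:
  fixes y :: "'a::ring_1"
  assumes "coord_system r \<alpha> \<beta>"
  shows "(\<Sum>i<r. x * \<alpha> i * (\<beta> i * y)) = x * y"
proof -
  have "(\<Sum>i<r. x * \<alpha> i * (\<beta> i * y)) = x * (\<Sum>i<r. \<alpha> i * \<beta> i) * y"
    by (simp add: sum_distrib_left sum_distrib_right mult.assoc)
  with coord_systemD(2) [OF assms] show ?thesis by simp
qed

lemma coord_sum1:
  fixes y :: "'a::ring_1"
  shows "coord_system r \<alpha> \<beta> \<Longrightarrow> (\<Sum>i<r. \<alpha> i * (\<beta> i * y)) = y"
  using coord_sum [of r \<alpha> \<beta> 1 y] by simp

lemma coord_pick:
  assumes "coord_system r \<alpha> \<beta>" "i < r"
  shows "(\<Sum>j<r. \<beta> i * (\<alpha> j * f j)) = f i" "(\<Sum>j<r. f j * (\<beta> j * \<alpha> i)) = f i"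
proof -
  have "(\<Sum>j<r. \<beta> i * (\<alpha> j * f j)) = (\<Sum>j<r. if j = i then f i else 0)"
    using assms by (intro sum.cong) (auto simp: coord_systemD simp flip: mult.assoc)
  then show "(\<Sum>j<r. \<beta> i * (\<alpha> j * f j)) = f i" using assms(2) by simp
  have "(\<Sum>j<r. f j * (\<beta> j * \<alpha> i)) = (\<Sum>j<r. if j = i then f i else 0)"
    using assms by (intro sum.cong) (auto simp: coord_systemD)
  then show "(\<Sum>j<r. f j * (\<beta> j * \<alpha> i)) = f i" using assms(2) by simp
qed

context leavitt
begin

text \<open>The first \<open>r\<close> coordinates describe the image of \<open>s1\<close>, the last
  one that of \<open>s2\<close>. The last basis vector is thus the base frame, so block matrices
  with a final 1 are the elements of its stabiliser.\<close>

lemma coord_system_Suc: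
  assumes "coord_system r \<alpha> \<beta>"
  shows "coord_system (Suc r) (\<lambda>i. if i < r then s1 * \<alpha> i else s2) (\<lambda>i. if i < r then \<beta> i * t1 else t2)"
proof -
  have "(\<Sum>i<r. s1 * \<alpha> i * (\<beta> i * t1)) = s1 * t1" using assms by (rule coord_sum)
  then have "(\<Sum>i<Suc r. (if i < r then s1 * \<alpha> i else s2) * (if i < r then \<beta> i * t1 else t2)) = 1"
    by (simp add: st)
  moreover have "\<beta> i * t1 * s2 = 0" for i using ts by (simp add: mult.assoc)
  ultimately show ?thesis
    using coord_systemD(1) [OF assms] unfolding coord_system_def
    by (auto simp: less_Suc_eq mult.assoc ts_mult ts)
qed

lemma ex_coord_system: "r > 0 \<Longrightarrow> \<exists>\<alpha> \<beta> :: nat \<Rightarrow> 'a. coord_system r \<alpha> \<beta>"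
proof (induction r rule: nat_induct_non_zero)
  case 1
  have "coord_system 1 (\<lambda>_. 1) (\<lambda>_. 1 :: 'a)" by (simp add: coord_system_def)
  then show ?case by blast
next
  case (Suc r)
  then show ?case using coord_system_Suc by blast
qed

end


section \<open>Units of A as invertible matrices of any positive size\<close>

section \<open>General linear groups\<close>

definition to_mat :: "nat \<Rightarrow> (nat \<Rightarrow> 'a::ring_1) \<Rightarrow> (nat \<Rightarrow> 'a) \<Rightarrow> 'a \<Rightarrow> 'a mat"
  where "to_mat r \<alpha> \<beta> g = mat r r (\<lambda>(i, j). \<beta> i * g * \<alpha> j)"

definition of_mat :: "nat \<Rightarrow> (nat \<Rightarrow> 'a::ring_1) \<Rightarrow> (nat \<Rightarrow> 'a) \<Rightarrow> 'a mat \<Rightarrow> 'a"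
  where "of_mat r \<alpha> \<beta> M = (\<Sum>i<r. \<Sum>j<r. \<alpha> i * M $$ (i, j) * \<beta> j)"

lemma GL_simps [simp]:
  "x \<otimes>\<^bsub>GL r\<^esub> y = x * y" "\<one>\<^bsub>GL r\<^esub> = 1\<^sub>m r"
  by (simp_all add: GL_def units_of_def ring_mat_simps)

lemma GL_carrier: "M \<in> carrier (GL r) \<longleftrightarrow>
    M \<in> carrier_mat r r \<and> (\<exists>N \<in> carrier_mat r r. M * N = 1\<^sub>m r \<and> N * M = 1\<^sub>m r)"
  by (auto simp: GL_def units_of_def Units_def ring_mat_simps)

lemma to_mat_mult:
  assumes "coord_system r \<alpha> \<beta>"
  shows "to_mat r \<alpha> \<beta> g * to_mat r \<alpha> \<beta> h = to_mat r \<alpha> \<beta> (g * h)"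
proof (rule eq_matI)
  fix i j assume "i < dim_row (to_mat r \<alpha> \<beta> (g * h))" "j < dim_col (to_mat r \<alpha> \<beta> (g * h))"
  then have ij: "i < r" "j < r" by (simp_all add: to_mat_def)
  have "(\<Sum>k<r. \<beta> i * g * \<alpha> k * (\<beta> k * (h * \<alpha> j))) = \<beta> i * g * (h * \<alpha> j)"
    using assms by (rule coord_sum)
  with ij show "(to_mat r \<alpha> \<beta> g * to_mat r \<alpha> \<beta> h) $$ (i, j) = to_mat r \<alpha> \<beta> (g * h) $$ (i, j)"
    by (simp add: to_mat_def scalar_prod_def mult.assoc atLeast0LessThan)
qed (simp_all add: to_mat_def)

lemma to_mat_1: "coord_system r \<alpha> \<beta> \<Longrightarrow> to_mat r \<alpha> \<beta> 1 = 1\<^sub>m r"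
  by (rule eq_matI) (simp_all add: to_mat_def coord_systemD)

lemma to_mat_hom:
  fixes \<alpha> \<beta> :: "nat \<Rightarrow> 'a::ring_1"
  assumes "coord_system r \<alpha> \<beta>"
  shows "to_mat r \<alpha> \<beta> \<in> hom ring_units (GL r)"
proof (rule homI)
  fix g :: 'a assume "g \<in> carrier ring_units"
  then obtain h where "g * h = 1" "h * g = 1" using ring_units_carrier by blast
  then have "to_mat r \<alpha> \<beta> g * to_mat r \<alpha> \<beta> h = 1\<^sub>m r" "to_mat r \<alpha> \<beta> h * to_mat r \<alpha> \<beta> g = 1\<^sub>m r"
    by (simp_all add: to_mat_mult [OF assms] to_mat_1 [OF assms])
  then show "to_mat r \<alpha> \<beta> g \<in> carrier (GL r)"
    unfolding GL_carrier by (auto simp: to_mat_def)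
qed (simp add: to_mat_mult [OF assms])

lemma of_to_mat:
  assumes "coord_system r \<alpha> \<beta>"
  shows "of_mat r \<alpha> \<beta> (to_mat r \<alpha> \<beta> g) = g"
proof -
  have "of_mat r \<alpha> \<beta> (to_mat r \<alpha> \<beta> g) = (\<Sum>i<r. \<alpha> i * (\<beta> i * (\<Sum>j<r. g * \<alpha> j * (\<beta> j * 1))))"
    by (simp add: of_mat_def to_mat_def sum_distrib_left mult.assoc)
  also have "\<dots> = g" unfolding coord_sum [OF assms] using coord_sum1 [OF assms] by simp
  finally show ?thesis .
qed

lemma of_mat_mult:
  assumes "coord_system r \<alpha> \<beta>" "M \<in> carrier_mat r r" "N \<in> carrier_mat r r"
  shows "of_mat r \<alpha> \<beta> (M * N) = of_mat r \<alpha> \<beta> M * of_mat r \<alpha> \<beta> N"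
proof -
  have "\<beta> k * of_mat r \<alpha> \<beta> N = (\<Sum>j<r. N $$ (k, j) * \<beta> j)" if "k < r" for k
  proof -
    have "\<beta> k * of_mat r \<alpha> \<beta> N = (\<Sum>l<r. \<beta> k * (\<alpha> l * (\<Sum>j<r. N $$ (l, j) * \<beta> j)))"
      by (simp add: of_mat_def sum_distrib_left mult.assoc)
    then show ?thesis by (simp add: coord_pick [OF assms(1) that])
  qed
  then have "of_mat r \<alpha> \<beta> M * of_mat r \<alpha> \<beta> N
      = (\<Sum>i<r. \<Sum>k<r. \<alpha> i * (M $$ (i, k) * (\<Sum>j<r. N $$ (k, j) * \<beta> j)))"
    unfolding of_mat_def [of r \<alpha> \<beta> M] by (simp add: sum_distrib_right mult.assoc)
  also have "\<dots> = (\<Sum>i<r. \<Sum>k<r. \<Sum>j<r. \<alpha> i * (M $$ (i, k) * N $$ (k, j)) * \<beta> j)"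
    by (simp add: sum_distrib_left mult.assoc)
  also have "\<dots> = (\<Sum>i<r. \<Sum>j<r. \<Sum>k<r. \<alpha> i * (M $$ (i, k) * N $$ (k, j)) * \<beta> j)"
    by (intro sum.cong refl sum.swap)
  also have "\<dots> = of_mat r \<alpha> \<beta> (M * N)"
    using assms(2,3)
    by (simp add: of_mat_def scalar_prod_def sum_distrib_left sum_distrib_right atLeast0LessThan)
  finally show ?thesis by simp
qed

lemma of_mat_hom:
  fixes \<alpha> \<beta> :: "nat \<Rightarrow> 'a::ring_1"
  assumes "coord_system r \<alpha> \<beta>"
  shows "of_mat r \<alpha> \<beta> \<in> hom (GL r) ring_units"
proof (rule homI)
  fix M :: "'a mat" assume "M \<in> carrier (GL r)"
  then obtain N where MN: "M \<in> carrier_mat r r" "N \<in> carrier_mat r r" "M * N = 1\<^sub>m r" "N * M = 1\<^sub>m r"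
    using GL_carrier by blast
  have "of_mat r \<alpha> \<beta> (1\<^sub>m r) = 1"
    using of_to_mat [OF assms, of 1] by (simp add: to_mat_1 [OF assms])
  then have "of_mat r \<alpha> \<beta> M * of_mat r \<alpha> \<beta> N = 1" "of_mat r \<alpha> \<beta> N * of_mat r \<alpha> \<beta> M = 1"
    using of_mat_mult [OF assms MN(1,2)] of_mat_mult [OF assms MN(2,1)] MN(3,4) by simp_all
  then show "of_mat r \<alpha> \<beta> M \<in> carrier ring_units" using ring_units_carrier by blast
qed (auto simp: GL_carrier of_mat_mult [OF assms])

lemma index_GL_incl:
  assumes "M \<in> carrier_mat r r" "i < Suc r" "j < Suc r"
  shows "GL_incl M $$ (i, j) = (if i < r \<and> j < r then M $$ (i, j) else if i = j then 1 else 0)"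
  using assms by (auto simp: GL_incl_def less_Suc_eq)

lemma GL_incl_carrier: "M \<in> carrier_mat r r \<Longrightarrow> GL_incl M \<in> carrier_mat (Suc r) (Suc r)"
  by (auto simp: GL_incl_def)

context leavitt
begin

text \<open>The inclusion of the stabiliser into the unit group is the composite of
  \<open>\<kappa>\<close>, \<open>GL_incl\<close> and \<open>of_mat\<close>. The middle map is zero
  on homology, hence so is the inclusion.\<close>

lemma frame_stab_boundary_GL:
  assumes zero: "\<And>x. x \<in> carrier (group_homology n (GL (n + 2) :: 'a mat monoid)) \<Longrightarrow>
      group_homology_map n (GL (n + 3) :: 'a mat monoid) GL_incl x
        = \<one>\<^bsub>group_homology n (GL (n + 3) :: 'a mat monoid)\<^esub>"
    and c: "c \<in> chains_on {gs. length gs = n \<and> set gs \<subseteq> frame_stab [(s2, t2)]}"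
      "ss_boundary (bar_face (ring_units :: 'a monoid)) n c = 0"
  shows "\<exists>e \<in> chains_on (bar_simplices (ring_units :: 'a monoid) (Suc n)).
    ss_boundary (bar_face ring_units) (Suc n) e = c"
proof -
  define r where "r = n + 2"
  obtain \<alpha> \<beta> :: "nat \<Rightarrow> 'a" where \<alpha>\<beta>: "coord_system r \<alpha> \<beta>" using ex_coord_system [of r] r_def by auto
  let ?\<alpha> = "\<lambda>i. if i < r then s1 * \<alpha> i else s2" and ?\<beta> = "\<lambda>i. if i < r then \<beta> i * t1 else t2"
  have \<alpha>\<beta>': "coord_system (Suc r) ?\<alpha> ?\<beta>" using \<alpha>\<beta> by (rule coord_system_Suc)
  define S :: "'a monoid" where "S = ring_units\<lparr>carrier := frame_stab [(s2, t2)]\<rparr>"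
  have S: "bar_simplices S k = {gs. length gs = k \<and> set gs \<subseteq> frame_stab [(s2, t2)]}" "bar_face S = bar_face ring_units" for k
    by (auto simp: S_def bar_simplices_def bar_face_def fun_eq_iff)
  have stab: "g * s2 = s2" "t2 * g = t2" if "g \<in> frame_stab [(s2, t2)]" for g
    using that by (auto simp: frame_stab_def)
  define \<kappa> where "\<kappa> g = to_mat r \<alpha> \<beta> (t1 * g * s1)" for g
  have "(\<lambda>g. t1 * g * s1) \<in> hom S ring_units"
  proof (rule homI)
    have mult: "t1 * (g * h) * s1 = t1 * g * s1 * (t1 * h * s1)" if "g \<in> frame_stab [(s2, t2)]" for g h
    proof -
      have "t1 * g * s1 * (t1 * h * s1) = t1 * g * (s1 * t1) * h * s1" by (simp add: mult.assoc)
      also have "s1 * t1 = 1 - s2 * t2" using st by (simp add: eq_diff_eq)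
      also have "t1 * g * (1 - s2 * t2) = t1 * g - t1 * (g * s2) * t2"
        by (simp add: right_diff_distrib mult.assoc)
      finally show ?thesis by (simp add: stab(1) [OF that] ts mult.assoc)
    qed
    fix g assume "g \<in> carrier S"
    then have g: "g \<in> frame_stab [(s2, t2)]" by (simp add: S_def)
    then obtain h where h: "g * h = 1" "h * g = 1" by (auto simp: frame_stab_def ring_units_carrier)
    have "h * s2 = h * (g * s2)" "t2 * h = t2 * g * h" by (simp_all add: stab [OF g])
    then have "h * s2 = s2" "t2 * h = t2" by (simp_all add: h mult.assoc) (simp add: h flip: mult.assoc)
    with h have h': "h \<in> frame_stab [(s2, t2)]" by (auto simp: frame_stab_def ring_units_carrier)
    show "t1 * g * s1 \<in> carrier ring_units"
      using mult [OF g, of h] mult [OF h', of g] h ts unfolding ring_units_carrier by auto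
    fix h show "t1 * (g \<otimes>\<^bsub>S\<^esub> h) * s1 = t1 * g * s1 \<otimes>\<^bsub>ring_units\<^esub> (t1 * h * s1)"
      using mult [OF g] by (simp add: S_def)
  qed
  then have \<kappa>: "\<kappa> \<in> hom S (GL r)"
    using Group.hom_compose [OF _ to_mat_hom [OF \<alpha>\<beta>]] by (fastforce simp: \<kappa>_def [abs_def] comp_def)
  \<comment> \<open>Since \<open>g\<close> fixes \<open>s2\<close> and \<open>t2\<close>, its matrix
    in the enlarged coordinates has the last row and column of the identity.\<close>
  have incl: "GL_incl (\<kappa> g) = to_mat (Suc r) ?\<alpha> ?\<beta> g" if g: "g \<in> frame_stab [(s2, t2)]" for g
  proof (rule eq_matI)
    have \<kappa>g: "\<kappa> g \<in> carrier_mat r r" by (simp add: \<kappa>_def to_mat_def)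
    show "dim_row (GL_incl (\<kappa> g)) = dim_row (to_mat (Suc r) ?\<alpha> ?\<beta> g)"
      "dim_col (GL_incl (\<kappa> g)) = dim_col (to_mat (Suc r) ?\<alpha> ?\<beta> g)"
      using GL_incl_carrier [OF \<kappa>g] by (auto simp: to_mat_def)
    fix i j assume "i < dim_row (to_mat (Suc r) ?\<alpha> ?\<beta> g)" "j < dim_col (to_mat (Suc r) ?\<alpha> ?\<beta> g)"
    then have ij: "i < Suc r" "j < Suc r" by (simp_all add: to_mat_def)
    have "t2 * (g * x) = t2 * x" for x using stab(2) [OF g] by (simp flip: mult.assoc)
    then show "GL_incl (\<kappa> g) $$ (i, j) = to_mat (Suc r) ?\<alpha> ?\<beta> g $$ (i, j)"
      using ij unfolding index_GL_incl [OF \<kappa>g ij]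
      by (auto simp: \<kappa>_def to_mat_def mult.assoc stab(1) [OF g] ts ts_mult)
  qed
  have cS: "c \<in> chains_on (bar_simplices S n)" using c(1) by (simp add: S)
  have "fmap (map \<kappa>) c \<in> chains_on (bar_simplices (GL (n + 2)) n)"
    using map_bar_simplices [OF \<kappa> cS] by (simp add: r_def)
  moreover have "ss_boundary (bar_face (GL (n + 2))) n (fmap (map \<kappa>) c) = 0"
    using ss_boundary_map [OF \<kappa> cS] c(2) by (simp add: S r_def)
  ultimately obtain e where e: "e \<in> chains_on (bar_simplices (GL (n + 3)) (Suc n))"
      "ss_boundary (bar_face (GL (n + 3))) (Suc n) e = fmap (map GL_incl) (fmap (map \<kappa>) c)"
    using group_homology_map_trivialD [OF zero] by blast
  have r: "n + 3 = Suc r" by (simp add: r_def)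
  note hom = of_mat_hom [OF \<alpha>\<beta>', folded r]
  let ?o = "of_mat (n + 3) ?\<alpha> ?\<beta>"
  have "ss_boundary (bar_face ring_units) (Suc n) (fmap (map ?o) e) = fmap (\<lambda>gs. map ?o (map GL_incl (map \<kappa> gs))) c"
    using ss_boundary_map [OF hom e(1)] e(2) by (simp only: fmap_fmap)
  also have "\<dots> = c"
  proof (rule fmap_ident)
    fix gs assume "gs \<in> Poly_Mapping.keys c"
    then have "set gs \<subseteq> frame_stab [(s2, t2)]" using keys_chains [OF c(1)] by blast
    then show "map ?o (map GL_incl (map \<kappa> gs)) = gs"
      unfolding map_map by (intro map_idI) (auto simp: incl r of_to_mat [OF \<alpha>\<beta>'])
  qed
  finally show ?thesis using map_bar_simplices [OF hom e(1)] by blast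
qed

end

section \<open>Frames of A^r as frames in A\<close>

section \<open>Frames of free modules\<close>

definition to_vec :: "nat \<Rightarrow> (nat \<Rightarrow> 'a::ring_1) \<Rightarrow> 'a \<Rightarrow> 'a vec"
  where "to_vec r b x = vec r (\<lambda>i. b i * x)"

definition of_vec :: "nat \<Rightarrow> (nat \<Rightarrow> 'a::ring_1) \<Rightarrow> 'a vec \<Rightarrow> 'a"
  where "of_vec r a v = (\<Sum>i<r. a i * v $ i)"

lemma to_vec_carrier [simp]: "to_vec r b x \<in> carrier_vec r"
  by (simp add: to_vec_def)

lemma rsmult_carrier [simp]: "v \<in> carrier_vec r \<Longrightarrow> v \<cdot>\<^sub>r x \<in> carrier_vec r"
  by (auto simp: rsmult_vec_def)

lemma to_vec_add: "to_vec r b (x + y) = to_vec r b x + to_vec r b y"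
  by (rule eq_vecI) (simp_all add: to_vec_def distrib_left)

lemma to_vec_mult: "to_vec r b (x * y) = to_vec r b x \<cdot>\<^sub>r y"
  by (rule eq_vecI) (simp_all add: to_vec_def rsmult_vec_def mult.assoc)

lemma to_vec_0 [simp]: "to_vec r b 0 = 0\<^sub>v r"
  by (rule eq_vecI) (simp_all add: to_vec_def)

lemma of_vec_add: "v \<in> carrier_vec r \<Longrightarrow> w \<in> carrier_vec r \<Longrightarrow> of_vec r a (v + w) = of_vec r a v + of_vec r a w"
  by (simp add: of_vec_def distrib_left sum.distrib)

lemma of_vec_rsmult: "v \<in> carrier_vec r \<Longrightarrow> of_vec r a (v \<cdot>\<^sub>r x) = of_vec r a v * x"
  by (simp add: of_vec_def rsmult_vec_def sum_distrib_right mult.assoc)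

lemma of_vec_0 [simp]: "of_vec r a (0\<^sub>v r) = 0"
  by (simp add: of_vec_def)

lemma of_to_vec: "coord_system r a b \<Longrightarrow> of_vec r a (to_vec r b x) = x"
  by (simp add: of_vec_def to_vec_def coord_sum1)

lemma to_of_vec:
  assumes "coord_system r a b" "v \<in> carrier_vec r"
  shows "to_vec r b (of_vec r a v) = v"
proof (rule eq_vecI)
  fix i assume "i < dim_vec v"
  with assms(2) have "i < r" by simp
  then show "to_vec r b (of_vec r a v) $ i = v $ i"
    using coord_pick(1) [OF assms(1)] by (simp add: to_vec_def of_vec_def sum_distrib_left)
qed (use assms(2) in \<open>simp add: to_vec_def\<close>)

lemma of_vec_eq_iff:
  "coord_system r a b \<Longrightarrow> v \<in> carrier_vec r \<Longrightarrow> w \<in> carrier_vec r \<Longrightarrow> of_vec r a v = of_vec r a w \<longleftrightarrow> v = w"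
  using to_of_vec by metis

lemma foldr_add_carrier:
  "set ws \<subseteq> carrier_vec r \<Longrightarrow> foldr (+) ws (0\<^sub>v r) \<in> carrier_vec r"
  by (induction ws) auto

lemma of_vec_foldr:
  "set ws \<subseteq> carrier_vec r \<Longrightarrow> of_vec r a (foldr (+) ws (0\<^sub>v r)) = (\<Sum>w\<leftarrow>ws. of_vec r a w)"
  by (induction ws) (auto simp: of_vec_add foldr_add_carrier)

lemma list_all2_cyclic:
  "list_all2 (\<in>) ws (map cyclic_submodule vs) \<longleftrightarrow> (\<exists>xs. length xs = length vs \<and> ws = map2 (\<cdot>\<^sub>r) vs xs)"
proof (induction vs arbitrary: ws)
  case (Cons v vs)
  show ?case
  proof
    assume "list_all2 (\<in>) ws (map cyclic_submodule (v # vs))"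
    then obtain w ws' where ws: "ws = w # ws'" "w \<in> cyclic_submodule v" "list_all2 (\<in>) ws' (map cyclic_submodule vs)"
      by (auto simp: list_all2_Cons2)
    then obtain x xs where "w = v \<cdot>\<^sub>r x" "length xs = length vs" "ws' = map2 (\<cdot>\<^sub>r) vs xs"
      using Cons.IH by (auto simp: cyclic_submodule_def)
    with ws(1) show "\<exists>xs. length xs = length (v # vs) \<and> ws = map2 (\<cdot>\<^sub>r) (v # vs) xs"
      by (intro exI [of _ "x # xs"]) simp
  next
    assume "\<exists>xs. length xs = length (v # vs) \<and> ws = map2 (\<cdot>\<^sub>r) (v # vs) xs"
    then obtain x xs where "length xs = length vs" "ws = (v \<cdot>\<^sub>r x) # map2 (\<cdot>\<^sub>r) vs xs"
      by (auto simp: length_Suc_conv)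
    moreover have "v \<cdot>\<^sub>r x \<in> cyclic_submodule v" by (simp add: cyclic_submodule_def)
    ultimately show "list_all2 (\<in>) ws (map cyclic_submodule (v # vs))"
      using Cons.IH by auto
  qed
qed simp

lemma decomposition_iff:
  assumes cs: "coord_system r a b" and vs: "set vs \<subseteq> carrier_vec r" and C: "C \<subseteq> carrier_vec r"
    and x: "x \<in> carrier_vec r"
  shows "list_all2 (\<in>) ws (map cyclic_submodule vs @ [C]) \<and> x = foldr (+) ws (0\<^sub>v r) \<longleftrightarrow>
    (\<exists>xs c. length xs = length vs \<and> c \<in> C \<and> ws = map2 (\<cdot>\<^sub>r) vs xs @ [c] \<and>
      of_vec r a x = (\<Sum>j<length vs. of_vec r a (vs ! j) * xs ! j) + of_vec r a c)"
proof -
  have sum: "x = foldr (+) (map2 (\<cdot>\<^sub>r) vs xs @ [c]) (0\<^sub>v r) \<longleftrightarrow>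
      of_vec r a x = (\<Sum>j<length vs. of_vec r a (vs ! j) * xs ! j) + of_vec r a c"
    if "length xs = length vs" "c \<in> C" for xs c
  proof -
    have ws: "set (map2 (\<cdot>\<^sub>r) vs xs @ [c]) \<subseteq> carrier_vec r"
      using vs C that(2) by (auto dest!: set_zip_leftD)
    have "(\<Sum>w\<leftarrow>map2 (\<cdot>\<^sub>r) vs xs. of_vec r a w) = (\<Sum>j<length vs. of_vec r a (vs ! j) * xs ! j)"
      unfolding sum_list_sum_nth atLeast0LessThan using that(1) vs
      by (intro sum.cong) (auto simp: of_vec_rsmult subset_iff)
    then show ?thesis
      using of_vec_eq_iff [OF cs x foldr_add_carrier [OF ws]] of_vec_foldr [OF ws, of a] by auto
  qed
  have "list_all2 (\<in>) ws (map cyclic_submodule vs @ [C]) \<longleftrightarrow>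
      (\<exists>xs c. length xs = length vs \<and> c \<in> C \<and> ws = map2 (\<cdot>\<^sub>r) vs xs @ [c])"
    unfolding list_all2_append2 list_all2_Cons2
    by (fastforce simp: list_all2_cyclic dest: list_all2_lengthD)
  with sum show ?thesis by blast
qed

lemma orthI:
  assumes "length ws = length u"
    "\<And>i j. i < length u \<Longrightarrow> j < length u \<Longrightarrow> ws ! i * u ! j = (if i = j then 1 else 0)"
  shows "orth (zip u ws)"
  using assms by (auto simp: orth_def in_set_zip sorted_wrt_iff_nth_less)

text \<open>\<open>D\<close> stands for the complement inside A and \<open>g\<close> for its
  isomorphism with A. The decomposition of 1 has the dual functionals \<open>ws\<close> as
  coefficients and the projection to \<open>D\<close> as its component \<open>y\<close>: multiplied
  on the right by \<open>x\<close> it becomes the decomposition of \<open>x\<close>, which is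
  unique.\<close>

lemma framesI:
  fixes u :: "'a::ring_1 list"
  assumes ex: "\<exists>xs y. length xs = length u \<and> y \<in> D \<and> 1 = (\<Sum>j<length u. u ! j * xs ! j) + y"
    and uniq: "\<And>xs xs' y y'. length xs = length u \<Longrightarrow> length xs' = length u \<Longrightarrow> y \<in> D \<Longrightarrow> y' \<in> D \<Longrightarrow>
      (\<Sum>j<length u. u ! j * xs ! j) + y = (\<Sum>j<length u. u ! j * xs' ! j) + y' \<Longrightarrow> xs = xs' \<and> y = y'"
    and D: "0 \<in> D" "\<And>y x. y \<in> D \<Longrightarrow> y * x \<in> D"
    and g: "inj_on g D" "\<And>y x. y \<in> D \<Longrightarrow> g (y * x) = g y * x" and \<gamma>: "\<gamma> \<in> D" "g \<gamma> = 1"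
  shows "u \<in> frames"
proof -
  obtain ws y where ws: "length ws = length u" and y: "y \<in> D"
    and one: "1 = (\<Sum>j<length u. u ! j * ws ! j) + y"
    using ex by blast
  have coord: "map (\<lambda>w. w * x) ws = xs \<and> y * x = z"
    if "length xs = length u" "z \<in> D" "x = (\<Sum>j<length u. u ! j * xs ! j) + z" for x xs z
  proof (rule uniq)
    have "x = ((\<Sum>j<length u. u ! j * ws ! j) + y) * x" unfolding one [symmetric] by simp
    also have "\<dots> = (\<Sum>j<length u. u ! j * map (\<lambda>w. w * x) ws ! j) + y * x"
      using ws by (simp add: distrib_right sum_distrib_right mult.assoc)
    finally show "(\<Sum>j<length u. u ! j * map (\<lambda>w. w * x) ws ! j) + y * x = (\<Sum>j<length u. u ! j * xs ! j) + z"
      using that(3) by simp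
  qed (use ws y D that in auto)
  have wu: "ws ! j * u ! i = (if j = i then 1 else 0)" if "i < length u" "j < length u" for i j
  proof -
    let ?e = "map (\<lambda>j. if j = i then 1 else 0) [0..<length u]"
    have "(\<Sum>j<length u. u ! j * ?e ! j) = (\<Sum>j<length u. if j = i then u ! i else 0)"
      by (rule sum.cong) auto
    then have "map (\<lambda>w. w * u ! i) ws = ?e"
      using coord [of ?e 0 "u ! i"] D(1) that(1) by simp
    then have "map (\<lambda>w. w * u ! i) ws ! j = ?e ! j" by simp
    with that(2) ws show ?thesis by simp
  qed
  have yD: "y * d = d" if "d \<in> D" for d
    using coord [of "replicate (length u) 0" d d] that by simp
  \<comment> \<open>By right linearity \<open>g\<close> is left multiplication by \<open>g y\<close>
    on \<open>D\<close>, and its inverse is left multiplication by \<open>\<gamma>\<close>.\<close>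
  have "\<gamma> * g y = y"
  proof (rule inj_onD [OF g(1)])
    show "g (\<gamma> * g y) = g y" by (simp add: g(2) \<gamma>)
  qed (use D(2) \<gamma>(1) y in auto)
  moreover have "g y * \<gamma> = 1"
    using g(2) [OF y, of \<gamma>] yD [OF \<gamma>(1)] \<gamma>(2) by simp
  moreover have "y = 1 - proj (zip u ws)"
    unfolding proj_zip [OF ws] by (subst one) simp
  ultimately have "compl (zip u ws) \<gamma> (g y)" by (simp add: compl_def)
  then show ?thesis
    using orthI [OF ws] wu ws unfolding frames_def split_frames_def by auto
qed

context leavitt
begin

text \<open>The bound on the length makes the free complement one of positive rank, so it is
  isomorphic to A, as \<open>compl\<close> requires.\<close>

lemma is_frame_frames:
  fixes vs :: "'a vec list"
  assumes cs: "coord_system r a b" and frame: "is_frame r vs" and len: "length vs < r"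
  shows "map (of_vec r a) vs \<in> frames"
proof -
  define m where "m = r - length vs"
  obtain a' b' :: "nat \<Rightarrow> 'a" where cs': "coord_system m a' b'" using ex_coord_system [of m] len m_def by auto
  obtain C f where vs: "set vs \<subseteq> carrier_vec r"
    and v_inj: "\<And>v. v \<in> set vs \<Longrightarrow> inj (\<lambda>x. v \<cdot>\<^sub>r x)"
    and ds: "internal_direct_sum r (map cyclic_submodule vs @ [C])"
    and f: "rmodule_iso C (\<cdot>\<^sub>r) (carrier_vec m) (\<cdot>\<^sub>r) f"
    using frame unfolding is_frame_def rmodule_iso_def m_def bij_betw_def by auto
  have C: "rsubmodule r C" using ds by (simp add: internal_direct_sum_def)
  then have C_sub: "C \<subseteq> carrier_vec r" by (simp add: rsubmodule_def)
  have unique: "\<exists>!ws. list_all2 (\<in>) ws (map cyclic_submodule vs @ [C]) \<and> x = foldr (+) ws (0\<^sub>v r)"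
    if "x \<in> carrier_vec r" for x
    using ds that by (simp add: internal_direct_sum_def)
  note dec = decomposition_iff [OF cs vs C_sub]
  let ?u = "map (of_vec r a) vs" and ?D = "of_vec r a ` C"
  have fbij: "bij_betw f C (carrier_vec m)" and fmult: "\<And>x y. x \<in> C \<Longrightarrow> f (x \<cdot>\<^sub>r y) = f x \<cdot>\<^sub>r y"
    using f by (auto simp: rmodule_iso_def)
  have f_carrier: "f x \<in> carrier_vec m" if "x \<in> C" for x using fbij that by (auto simp: bij_betw_def)
  have to_of: "to_vec r b (of_vec r a c) = c" if "c \<in> C" for c using to_of_vec [OF cs] C_sub that by auto
  define g where "g y = of_vec m a' (f (to_vec r b y))" for y
  define c1 where "c1 = inv_into C f (to_vec m b' 1)"
  have c1: "c1 \<in> C" "f c1 = to_vec m b' 1"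
    using fbij unfolding c1_def by (auto simp: bij_betw_def intro: inv_into_into f_inv_into_f)
  show ?thesis
  proof (rule framesI [where D = ?D and g = g and \<gamma> = "of_vec r a c1"])
    obtain ws where "list_all2 (\<in>) ws (map cyclic_submodule vs @ [C]) \<and> to_vec r b 1 = foldr (+) ws (0\<^sub>v r)"
      using unique [of "to_vec r b 1"] by auto
    then obtain xs c where "length xs = length vs" "c \<in> C"
        "1 = (\<Sum>j<length vs. of_vec r a (vs ! j) * xs ! j) + of_vec r a c"
      unfolding dec [OF to_vec_carrier] of_to_vec [OF cs] by blast
    then show "\<exists>xs y. length xs = length ?u \<and> y \<in> ?D \<and> 1 = (\<Sum>j<length ?u. ?u ! j * xs ! j) + y"
      by (intro exI [of _ xs] exI [of _ "of_vec r a c"]) auto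
  next
    fix xs xs' y y'
    assume xs: "length xs = length ?u" "length xs' = length ?u" and y: "y \<in> ?D" "y' \<in> ?D"
      and eq: "(\<Sum>j<length ?u. ?u ! j * xs ! j) + y = (\<Sum>j<length ?u. ?u ! j * xs' ! j) + y'"
    obtain c c' where c: "c \<in> C" "y = of_vec r a c" "c' \<in> C" "y' = of_vec r a c'" using y by blast
    define x where "x = to_vec r b ((\<Sum>j<length vs. of_vec r a (vs ! j) * xs ! j) + y)"
    have x: "x \<in> carrier_vec r" "of_vec r a x = (\<Sum>j<length vs. of_vec r a (vs ! j) * xs ! j) + y"
      by (simp_all add: x_def of_to_vec [OF cs])
    have x': "of_vec r a x = (\<Sum>j<length vs. of_vec r a (vs ! j) * xs' ! j) + y'"
      using eq x(2) by simp
    define P where "P l \<longleftrightarrow> (\<exists>xs c. length xs = length vs \<and> c \<in> C \<and> l = map2 (\<cdot>\<^sub>r) vs xs @ [c] \<and>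
        of_vec r a x = (\<Sum>j<length vs. of_vec r a (vs ! j) * xs ! j) + of_vec r a c)" for l
    have P: "P (map2 (\<cdot>\<^sub>r) vs xs @ [c])" "P (map2 (\<cdot>\<^sub>r) vs xs' @ [c'])"
      unfolding P_def
      by (rule exI [of _ xs], rule exI [of _ c], use x(2) c xs in simp)
        (rule exI [of _ xs'], rule exI [of _ c'], use x' c xs in simp)
    have "\<exists>!l. P l"
      using unique [OF x(1)] unfolding dec [OF x(1)] P_def .
    then obtain l where l: "\<And>l'. P l' \<Longrightarrow> l' = l" by (elim ex1E) blast
    have "map2 (\<cdot>\<^sub>r) vs xs @ [c] = map2 (\<cdot>\<^sub>r) vs xs' @ [c']"
      using l [OF P(1)] l [OF P(2)] by (rule trans [OF _ sym])
    then have eq': "map2 (\<cdot>\<^sub>r) vs xs = map2 (\<cdot>\<^sub>r) vs xs'" "c = c'" by auto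
    have "xs = xs'"
    proof (rule nth_equalityI)
      show "length xs = length xs'" using xs by simp
      fix i assume i: "i < length xs"
      then have "vs ! i \<cdot>\<^sub>r xs ! i = vs ! i \<cdot>\<^sub>r xs' ! i"
        using arg_cong [OF eq'(1), of "\<lambda>l. l ! i"] xs by simp
      then show "xs ! i = xs' ! i"
        using v_inj [of "vs ! i"] i xs by (auto dest: injD)
    qed
    with eq' c show "xs = xs' \<and> y = y'" by simp
  next
    show "0 \<in> ?D" using C by (intro image_eqI [of _ _ "0\<^sub>v r"]) (auto simp: rsubmodule_def)
    show "y * x \<in> ?D" if y: "y \<in> ?D" for y x
    proof -
      obtain c where c: "c \<in> C" "y = of_vec r a c" using y by blast
      then have "y * x = of_vec r a (c \<cdot>\<^sub>r x)" using of_vec_rsmult C_sub by force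
      with c C show ?thesis by (auto simp: rsubmodule_def)
    qed
    show "inj_on g ?D"
    proof (rule inj_onI)
      fix y y' assume "y \<in> ?D" "y' \<in> ?D" and eq: "g y = g y'"
      then obtain c c' where c: "c \<in> C" "y = of_vec r a c" "c' \<in> C" "y' = of_vec r a c'" by blast
      then have "f c = f c'"
        using eq of_vec_eq_iff [OF cs' f_carrier f_carrier] by (simp add: g_def to_of)
      with c fbij show "y = y'" by (auto simp: bij_betw_def dest: inj_onD)
    qed
    show "g (y * x) = g y * x" if "y \<in> ?D" for y x
      using that by (auto simp: g_def to_vec_mult to_of fmult of_vec_rsmult f_carrier)
    show "of_vec r a c1 \<in> ?D" using c1(1) by blast
    show "g (of_vec r a c1) = 1" using c1 by (simp add: g_def to_of of_to_vec [OF cs'])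
  qed
qed

text \<open>The complement given by \<open>\<gamma>\<close> is a copy of A, and A is isomorphic to
  the free module of rank \<open>r - length u\<close> because this rank is positive.\<close>

lemma frames_is_frame:
  fixes u :: "'a list"
  assumes cs: "coord_system r a b" and u: "u \<in> frames" and len: "length u < r"
  shows "is_frame r (map (to_vec r b) u)"
proof -
  define m where "m = r - length u"
  obtain a' b' :: "nat \<Rightarrow> 'a" where cs': "coord_system m a' b'" using ex_coord_system [of m] len m_def by auto
  obtain ws \<gamma> \<delta> where ws: "length ws = length u" and o: "orth (zip u ws)" and co: "compl (zip u ws) \<gamma> \<delta>"
    using u by (auto simp: frames_def split_frames_def)
  have \<delta>\<gamma>: "\<delta> * \<gamma> = 1" "\<And>x. \<delta> * (\<gamma> * x) = x" using co by (auto simp: compl_def simp flip: mult.assoc)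
  have one: "(\<Sum>j<length u. u ! j * ws ! j) + \<gamma> * \<delta> = 1" using co by (simp add: compl_def proj_zip ws)
  have wu: "ws ! i * u ! j = (if i = j then 1 else 0)" if "i < length u" "j < length u" for i j
    using orth_nth [OF o, of i j] that ws by simp
  have 0: "ws ! i * \<gamma> = 0" "\<delta> * u ! i = 0" if "i < length u" for i
    using compl_orth [OF o co, of "(u ! i, ws ! i)"] that ws by (auto simp: set_zip)
  let ?vs = "map (to_vec r b) u"
  define C where "C = (\<lambda>x. to_vec r b (\<gamma> * x)) ` UNIV"
  have C_sub: "C \<subseteq> carrier_vec r" and vs: "set ?vs \<subseteq> carrier_vec r" by (auto simp: C_def)
  note dec = decomposition_iff [OF cs vs C_sub]
  have rsub: "rsubmodule r (range (\<lambda>x. to_vec r b (z * x)))" for z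
    unfolding rsubmodule_def
  proof (intro conjI ballI allI)
    show "0\<^sub>v r \<in> range (\<lambda>x. to_vec r b (z * x))" by (rule range_eqI [of _ _ 0]) simp
    fix x y assume "x \<in> range (\<lambda>x. to_vec r b (z * x))" "y \<in> range (\<lambda>x. to_vec r b (z * x))"
    then obtain x' y' where "x = to_vec r b (z * x')" "y = to_vec r b (z * y')" by blast
    then show "x + y \<in> range (\<lambda>x. to_vec r b (z * x))"
      by (intro range_eqI [of _ _ "x' + y'"]) (simp add: distrib_left to_vec_add)
  next
    fix x y assume "x \<in> range (\<lambda>x. to_vec r b (z * x))"
    then obtain x' where "x = to_vec r b (z * x')" by blast
    then show "x \<cdot>\<^sub>r y \<in> range (\<lambda>x. to_vec r b (z * x))"
      by (intro range_eqI [of _ _ "x' * y"]) (simp flip: to_vec_mult mult.assoc)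
  qed auto
  have cyc: "cyclic_submodule (to_vec r b z) = range (\<lambda>x. to_vec r b (z * x))" for z
    by (simp add: cyclic_submodule_def to_vec_mult)
  have iso: "rmodule_iso UNIV (*) (cyclic_submodule v) (\<cdot>\<^sub>r) (\<lambda>x. v \<cdot>\<^sub>r x)" if v: "v \<in> set ?vs" for v
  proof -
    obtain i where i: "i < length u" "v = to_vec r b (u ! i)" using v by (auto simp: in_set_conv_nth)
    have "inj (\<lambda>x. v \<cdot>\<^sub>r x)"
    proof (rule injI)
      fix x y assume "v \<cdot>\<^sub>r x = v \<cdot>\<^sub>r y"
      then have "of_vec r a (to_vec r b (u ! i * x)) = of_vec r a (to_vec r b (u ! i * y))"
        by (simp add: i(2) to_vec_mult)
      then have "ws ! i * (u ! i * x) = ws ! i * (u ! i * y)" by (simp add: of_to_vec [OF cs])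
      then show "x = y" by (simp add: wu i(1) flip: mult.assoc)
    qed
    moreover have "v \<cdot>\<^sub>r (x + y) = v \<cdot>\<^sub>r x + v \<cdot>\<^sub>r y" "v \<cdot>\<^sub>r (x * y) = v \<cdot>\<^sub>r x \<cdot>\<^sub>r y" for x y
      by (simp_all add: i(2) distrib_left to_vec_add flip: to_vec_mult mult.assoc)
    ultimately show ?thesis
      by (simp add: rmodule_iso_def bij_betw_def cyclic_submodule_def)
  qed
  have ds: "internal_direct_sum r (map cyclic_submodule ?vs @ [C])"
    unfolding internal_direct_sum_def
  proof (intro conjI ballI)
    fix N assume "N \<in> set (map cyclic_submodule ?vs @ [C])"
    then show "rsubmodule r N" using rsub by (auto simp: cyc C_def)
  next
    fix x :: "'a vec" assume x: "x \<in> carrier_vec r"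
    let ?x = "of_vec r a x"
    let ?xs = "map (\<lambda>w. w * ?x) ws" and ?c = "to_vec r b (\<gamma> * (\<delta> * ?x))"
    have "?x = ((\<Sum>j<length u. u ! j * ws ! j) + \<gamma> * \<delta>) * ?x" by (simp add: one)
    then have sum: "?x = (\<Sum>j<length u. u ! j * (ws ! j * ?x)) + \<gamma> * (\<delta> * ?x)"
      by (simp add: distrib_right sum_distrib_right mult.assoc)
    show "\<exists>!ws. list_all2 (\<in>) ws (map cyclic_submodule ?vs @ [C]) \<and> x = foldr (+) ws (0\<^sub>v r)"
      unfolding dec [OF x]
    proof (rule ex1I [of _ "map2 (\<cdot>\<^sub>r) ?vs ?xs @ [?c]"])
      show "\<exists>xs c. length xs = length ?vs \<and> c \<in> C \<and> map2 (\<cdot>\<^sub>r) ?vs ?xs @ [?c] = map2 (\<cdot>\<^sub>r) ?vs xs @ [c] \<and>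
          ?x = (\<Sum>j<length ?vs. of_vec r a (?vs ! j) * xs ! j) + of_vec r a c"
        using sum ws by (intro exI [of _ ?xs] exI [of _ ?c]) (auto simp: of_to_vec [OF cs] C_def)
    next
      fix l assume "\<exists>xs c. length xs = length ?vs \<and> c \<in> C \<and> l = map2 (\<cdot>\<^sub>r) ?vs xs @ [c] \<and>
          ?x = (\<Sum>j<length ?vs. of_vec r a (?vs ! j) * xs ! j) + of_vec r a c"
      then obtain xs y where xs: "length xs = length u" and l: "l = map2 (\<cdot>\<^sub>r) ?vs xs @ [to_vec r b (\<gamma> * y)]"
        and eq: "?x = (\<Sum>j<length u. u ! j * xs ! j) + \<gamma> * y"
        by (auto simp: C_def of_to_vec [OF cs])
      have "\<delta> * ?x = y"
        unfolding eq by (simp add: distrib_left sum_distrib_left \<delta>\<gamma> 0 flip: mult.assoc)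
      moreover have "ws ! i * ?x = xs ! i" if i: "i < length u" for i
      proof -
        have "ws ! i * ?x = (\<Sum>j<length u. ws ! i * u ! j * xs ! j)"
          unfolding eq by (simp add: distrib_left sum_distrib_left 0 i flip: mult.assoc)
        also have "\<dots> = (\<Sum>j<length u. if j = i then xs ! i else 0)"
          by (rule sum.cong) (auto simp: wu i)
        finally show ?thesis using i by simp
      qed
      then have "?xs = xs" using ws xs by (intro nth_equalityI) auto
      ultimately show "l = map2 (\<cdot>\<^sub>r) ?vs ?xs @ [?c]" using l by simp
    qed
  qed
  have "rmodule_iso C (\<cdot>\<^sub>r) (carrier_vec m) (\<cdot>\<^sub>r) (\<lambda>x. to_vec m b' (\<delta> * of_vec r a x))"
    unfolding rmodule_iso_def
  proof (intro conjI ballI allI)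
    show "bij_betw (\<lambda>x. to_vec m b' (\<delta> * of_vec r a x)) C (carrier_vec m)"
    proof (rule bij_betw_byWitness [where f' = "\<lambda>y. to_vec r b (\<gamma> * of_vec m a' y)"])
      show "\<forall>x\<in>C. to_vec r b (\<gamma> * of_vec m a' (to_vec m b' (\<delta> * of_vec r a x))) = x"
        by (auto simp: C_def of_to_vec [OF cs] of_to_vec [OF cs'] \<delta>\<gamma>)
      show "\<forall>y\<in>carrier_vec m. to_vec m b' (\<delta> * of_vec r a (to_vec r b (\<gamma> * of_vec m a' y))) = y"
        by (auto simp: of_to_vec [OF cs] \<delta>\<gamma> to_of_vec [OF cs'])
    qed (auto simp: C_def)
  next
    fix x y assume "x \<in> C" "y \<in> C"
    then show "to_vec m b' (\<delta> * of_vec r a (x + y)) = to_vec m b' (\<delta> * of_vec r a x) + to_vec m b' (\<delta> * of_vec r a y)"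
      using C_sub by (subst of_vec_add) (auto simp: distrib_left to_vec_add)
  next
    fix x y assume "x \<in> C"
    then show "to_vec m b' (\<delta> * of_vec r a (x \<cdot>\<^sub>r y)) = to_vec m b' (\<delta> * of_vec r a x) \<cdot>\<^sub>r y"
      using C_sub by (subst of_vec_rsmult) (auto simp flip: to_vec_mult mult.assoc)
  qed
  then show ?thesis
    unfolding is_frame_def using vs iso ds by (auto simp: m_def)
qed

end

lemma bdry_eq_sum: "bdry w = (\<Sum>i<length w. frag_cmul ((-1) ^ i) (frag_of (take i w @ drop (Suc i) w)))"
proof (induction w)
  case (Cons x w)
  have "fmap ((#) x) (bdry w) = (\<Sum>i<length w. frag_cmul ((-1) ^ i) (frag_of (x # take i w @ drop (Suc i) w)))"
    unfolding Cons.IH by (simp add: fmap_def frag_extend_sum comp_def frag_extend_cmul)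
  also have "\<dots> = - (\<Sum>i<length w. frag_cmul ((-1) ^ Suc i) (frag_of (take (Suc i) (x # w) @ drop (Suc (Suc i)) (x # w))))"
    unfolding sum_negf [symmetric] by (rule sum.cong) simp_all
  finally show ?case by (simp add: sum.lessThan_Suc_shift del: sum.lessThan_Suc)
qed simp

lemma ss_boundary_frame_face:
  assumes "p > 0" "c \<in> chains_on {w. length w = Suc p}"
  shows "ss_boundary frame_face p c = frag_extend bdry c"
proof -
  have "(\<Sum>i\<le>p. frag_cmul ((-1) ^ i) (frag_of (frame_face i w))) = bdry w" if "length w = Suc p" for w :: "'a vec list"
    using that by (simp add: bdry_eq_sum frame_face_def lessThan_Suc_atMost)
  then show ?thesis
    using assms by (auto simp: ss_boundary_def intro!: frag_extend_cong)
qed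

lemma fmap_const: "fmap (\<lambda>_. x) c = frag_cmul (augmentation c) (frag_of x)"
proof -
  have "(\<Sum>i\<in>I. frag_cmul (f i) (frag_of x)) = frag_cmul (\<Sum>i\<in>I. f i) (frag_of x)" for I :: "'b set" and f
    by (induction I rule: infinite_finite_induct) (simp_all add: frag_cmul_distrib)
  then show ?thesis by (simp add: fmap_def frag_extend_def augmentation_def)
qed

context leavitt
begin

lemma exact_words_frames:
  assumes acyclic: "\<And>r i. r \<ge> 4 \<Longrightarrow> i \<le> r - 3 \<Longrightarrow> trivial_group (frame_reduced_homology TYPE('a) i r)"
  shows "exact_words (frames :: 'a list set) n"
  unfolding exact_words_def
proof (intro ballI impI)
  fix z :: "'a list \<Rightarrow>\<^sub>0 int" assume z: "z \<in> chains_on (words frames n)" "frag_extend bdry z = 0"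
  show "\<exists>y \<in> chains_on (words frames (Suc n)). frag_extend bdry y = z"
  proof (cases n)
    \<comment> \<open>The empty word is the simplex of degree -1; exactness there means that some
      frame exists.\<close>
    case 0
    have "[s2] \<in> frames"
      unfolding frames_def using base_split_frame(3) by (auto intro!: exI [of _ "[t2]"])
    then have "fmap (\<lambda>_. [s2]) z \<in> chains_on (words frames (Suc n))"
      using 0 by (intro chains_fmap [OF z(1)]) (auto simp: words_def)
    moreover have "frag_extend bdry (fmap (\<lambda>_. [s2]) z) = z"
      unfolding frag_extend_fmap using z(1) by (rule frag_extend_ident) (use 0 in \<open>auto simp: words_def\<close>)
    ultimately show ?thesis by blast
  next
    case (Suc i)
    \<comment> \<open>With this rank \<open>r >= 4\<close>, the simplicial degree
      \<open>i = n - 1\<close> is at most \<open>r - 3\<close>, and all frames involved, of length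
      at most \<open>n + 1\<close>, are shorter than \<open>r\<close>.\<close>
    define r where "r = n + 4"
    obtain a b :: "nat \<Rightarrow> 'a" where cs: "coord_system r a b" using ex_coord_system [of r] r_def by auto
    let ?S = "frame_simplices r :: nat \<Rightarrow> 'a vec list set"
    have to: "map (to_vec r b) u \<in> ?S i" if "u \<in> words frames n" for u
      using that frames_is_frame [OF cs, of u] Suc by (auto simp: frame_simplices_def words_def r_def)
    have "from": "map (of_vec r a) vs \<in> words frames (Suc n)" if "vs \<in> ?S n" for vs
      using that is_frame_frames [OF cs, of vs] by (auto simp: frame_simplices_def words_def r_def)
    have of_to: "map (of_vec r a) (map (to_vec r b) u) = u" for u
      by (simp add: of_to_vec [OF cs] map_idI)
    let ?z = "fmap (map (to_vec r b)) z"
    have z': "?z \<in> chains_on (?S i)" using z(1) to by (rule chains_fmap)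
    have dz: "frag_extend bdry ?z = 0"
      using z(2) by (simp add: frag_extend_fmap bdry_map flip: fmap_frag_extend)
    have cycle: "?z \<in> ss_reduced_cycles ?S frame_face i"
    \<comment> \<open>On words of length 1 \<open>bdry\<close> is the augmentation, whereas
      \<open>ss_boundary\<close> is 0 in degree 0.\<close>
    proof (cases "i = 0")
      case True
      have "frag_extend bdry ?z = fmap (\<lambda>_. []) ?z"
        unfolding fmap_def [of "\<lambda>_. []"] using z'
        by (rule frag_extend_cong) (auto simp: True frame_simplices_def length_Suc_conv)
      then have "augmentation ?z = 0" using dz by (simp add: fmap_const)
      with True z' show ?thesis
        by (simp add: ss_reduced_cycles_def ss_cycles_def ss_boundary_def carrier_free_Abelian_group
            del: carrier_free_Abelian_group_iff)
    next
      case False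
      then have "ss_boundary frame_face i ?z = 0"
        using dz z' by (subst ss_boundary_frame_face) (auto simp: frame_simplices_def elim!: chains_mono)
      with False z' show ?thesis
        by (simp add: ss_reduced_cycles_def ss_cycles_def carrier_free_Abelian_group
            del: carrier_free_Abelian_group_iff)
    qed
    have "trivial_group (frame_reduced_homology TYPE('a) i r)"
      using Suc by (intro acyclic) (simp_all add: r_def)
    then have "?z \<in> ss_boundaries ?S frame_face i"
      unfolding frame_reduced_homology_def ss_reduced_homology_def
      by (rule trivial_quotientD [OF _ zero_in_ss_boundaries cycle z'])
    then obtain e where e: "e \<in> chains_on (?S n)" "?z = ss_boundary frame_face n e"
      unfolding ss_boundaries_def carrier_free_Abelian_group Suc by blast
    have "ss_boundary frame_face n e = frag_extend bdry e"
      using e(1) Suc by (intro ss_boundary_frame_face) (auto simp: frame_simplices_def elim!: chains_mono)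
    then have "frag_extend bdry (fmap (map (of_vec r a)) e) = fmap (map (of_vec r a)) ?z"
      using e(2) by (simp add: frag_extend_fmap bdry_map flip: fmap_frag_extend)
    also have "\<dots> = z" unfolding fmap_fmap of_to by (simp add: fmap_ident)
    finally have "frag_extend bdry (fmap (map (of_vec r a)) e) = z" .
    moreover have "fmap (map (of_vec r a)) e \<in> chains_on (words frames (Suc n))"
      using e(1) "from" by (rule chains_fmap)
    ultimately show ?thesis by blast
  qed
qed

end

text \<open>\<open>s1\<close>, \<open>s2\<close> are the images of the standard basis, and
  \<open>t1\<close>, \<open>t2\<close> are the entries of the preimage \<open>h\<close> of 1. By
  right linearity \<open>f\<close> sends \<open>h\<close> times \<open>x\<close> to
  \<open>x\<close>, so multiplying \<open>h\<close> by elements of A inverts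
  \<open>f\<close>.\<close>

lemma leavitt_of_iso:
  assumes "rmodule_iso (carrier_vec 2 :: 'a::ring_1 vec set) (\<cdot>\<^sub>r) (UNIV :: 'a set) (*) f"
  shows "\<exists>s1 s2 t1 t2 :: 'a. leavitt s1 s2 t1 t2"
proof -
  have bij: "bij_betw f (carrier_vec 2) UNIV"
    and add: "\<And>x y. x \<in> carrier_vec 2 \<Longrightarrow> y \<in> carrier_vec 2 \<Longrightarrow> f (x + y) = f x + f y"
    and mult: "\<And>x c. x \<in> carrier_vec 2 \<Longrightarrow> f (x \<cdot>\<^sub>r c) = f x * c"
    using assms by (auto simp: rmodule_iso_def)
  define e :: "nat \<Rightarrow> 'a vec" where "e k = vec 2 (\<lambda>i. if i = k then 1 else 0)" for k
  have e: "e k \<in> carrier_vec 2" for k by (simp add: e_def)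
  have "1 \<in> f ` carrier_vec 2" using bij by (simp add: bij_betw_def)
  then obtain h where h: "h \<in> carrier_vec 2" "f h = 1" by force
  have eq: "x = y" if "x \<in> carrier_vec 2" "y \<in> carrier_vec 2" "f x = f y" for x y
    using bij that by (auto simp: bij_betw_def dest: inj_onD)
  have he: "h \<cdot>\<^sub>r f (e k) = e k" for k
    using h e by (intro eq) (simp_all add: mult)
  have ts: "h $ i * f (e k) = (if i = k then 1 else 0)" if "i < 2" for i k
  proof -
    have "(h \<cdot>\<^sub>r f (e k)) $ i = e k $ i" by (simp add: he)
    then show ?thesis using that h(1) by (simp add: rsmult_vec_def e_def)
  qed
  have "h = e 0 \<cdot>\<^sub>r (h $ 0) + e 1 \<cdot>\<^sub>r (h $ 1)"
    using h(1) by (intro eq_vecI) (auto simp: e_def rsmult_vec_def less_2_cases_iff)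
  then have "f h = f (e 0) * h $ 0 + f (e 1) * h $ 1"
    using add [of "e 0 \<cdot>\<^sub>r (h $ 0)" "e 1 \<cdot>\<^sub>r (h $ 1)"] e by (simp add: mult)
  then have "leavitt (f (e 0)) (f (e 1)) (h $ 0) (h $ 1)"
    using h(2) ts [of 0 0] ts [of 1 1] ts [of 0 1] ts [of 1 0] by unfold_locales simp_all
  then show ?thesis by blast
qed

theorem theorem4p1:
  fixes scale :: "bit \<Rightarrow> 'a::ring_1 \<Rightarrow> 'a"
  assumes "unital_algebra scale"
    and "\<exists>f. rmodule_iso (carrier_vec 2 :: 'a vec set) (\<cdot>\<^sub>r) (UNIV :: 'a set) (*) f"
    and "\<forall>n>0. \<forall>x \<in> carrier (group_homology n (GL (n + 2) :: 'a mat monoid)).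
           group_homology_map n (GL (n + 3) :: 'a mat monoid) GL_incl x
             = \<one>\<^bsub>group_homology n (GL (n + 3) :: 'a mat monoid)\<^esub>"
    and "\<forall>r\<ge>4. \<forall>i\<le>r - 3. trivial_group (frame_reduced_homology TYPE('a) i r)"
  shows "\<forall>n>0. trivial_group (group_homology n (ring_units :: 'a monoid))"
proof (intro allI impI)
  obtain s1 s2 t1 t2 :: 'a where "leavitt s1 s2 t1 t2"
    using assms(2) leavitt_of_iso by blast
  then interpret leavitt s1 s2 t1 t2 .
  have "exact_words (frames :: 'a list set) n" for n
    using assms(4) by (intro exact_words_frames) blast
  then have exact: "exact_words (split_frames :: ('a \<times> 'a) list set) n" for n
    by (rule exact_split_frames)
  have "bar_exact n (ring_units :: 'a monoid)" if "n > 0" for n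
    using that
  proof (induction n rule: less_induct)
    case (less n)
    show ?case
    proof (rule bar_exact_ring_units_step)
      fix c assume "c \<in> chains_on {gs. length gs = n \<and> set gs \<subseteq> frame_stab [(s2, t2)]}"
        "ss_boundary (bar_face (ring_units :: 'a monoid)) n c = 0"
      then show "\<exists>e \<in> chains_on (bar_simplices (ring_units :: 'a monoid) (Suc n)). ss_boundary (bar_face ring_units) (Suc n) e = c"
        using assms(3) less.prems by (intro frame_stab_boundary_GL) blast
    qed (use exact less in blast)+
  qed
  then show "trivial_group (group_homology n (ring_units :: 'a monoid))" if "n > 0" for n
    using that group_ring_units by (blast intro: trivial_group_homologyI)
qed

end
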